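(* Let $t\ge2$ and let $\lambda_1,\dots,\lambda_t$ be distinct lines in $\mathbb P^2$, no three concurrent; let $C_t$ be the set of their $\binom{t}{2}$ pairwise intersection points and $\mathbb Z_t$ the first infinitesimal neighborhood of $C_t$. (a) The first difference of the Hilbert function of $\mathbb Z_t$ is $\Delta h_{\mathbb Z_t}(d)=d+1$ for $0\le d\le t-1$, $\Delta h_{\mathbb Z_t}(d)=t$ for $t\le d\le 2t-3$, and $\Delta h_{\mathbb Z_t}(d)=0$ for $d\ge 2t-2$. (b) If $\mathbb X\subset\mathbb P^2$ is any reduced finite set of points whose Hilbert function has first difference $(1,2,3,\dots,t-1)$ (in degrees $0,\dots,t-2$, zero afterwards) and $\mathbb Z$ is its first infinitesimal neighborhood, then $h_{\mathbb Z}(d)\ge h_{\mathbb Z_t}(d)$ for all $d$. (c) With $\mathbb X,\mathbb Z$ as in (b), if $h_{\mathbb Z}(t)=h_{\mathbb Z_t}(t)$ (in particular if $h_{\mathbb Z}=h_{\mathbb Z_t}$), then $\mathbb X$ is the set of pairwise intersection points of some $t$ distinct lines, no three concurrent, so that $\mathbb Z$ is a scheme $\mathbb Z_t$ for a different choice of lines.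
   Context: $k$ is an infinite field of characteristic zero, $R=k[x_0,x_1,x_2]$. For a zero-dimensional scheme with saturated ideal $I$, $h(d)=\dim_k(R/I)_d$ and $\Delta h(d)=h(d)-h(d-1)$. The first infinitesimal neighborhood of $\{P_1,\dots,P_s\}$ (prime ideals $\wp_i$) is the scheme defined by $\wp_1^2\cap\cdots\cap\wp_s^2$. *)

theory Defs
  imports Complex_Main "HOL-Library.Function_Algebras"
begin

text \<open>Points of the projective plane over a field 'k: a point is the class
  {c v | c nonzero} of a nonzero vector v in k^3 (triples).  Lines are
  encoded the same way by their (nonzero) coefficient triples.\<close>

type_synonym 'k vec3 = "'k \<times> 'k \<times> 'k"

definition smult3 :: "'k::field \<Rightarrow> 'k vec3 \<Rightarrow> 'k vec3" where
  "smult3 c v = (case v of (x, y, z) \<Rightarrow> (c * x, c * y, c * z))"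

definition dot3 :: "'k::field vec3 \<Rightarrow> 'k vec3 \<Rightarrow> 'k" where
  "dot3 u v = (case u of (a, b, c) \<Rightarrow> case v of (x, y, z) \<Rightarrow> a * x + b * y + c * z)"

definition pt :: "'k::field vec3 \<Rightarrow> 'k vec3 set" where
  "pt v = {smult3 c v | c. c \<noteq> 0}"

definition P2 :: "'k::field vec3 set set" where
  "P2 = {pt v | v. v \<noteq> (0, 0, 0)}"

definition on_line :: "'k::field vec3 set \<Rightarrow> 'k vec3 set \<Rightarrow> bool" where
  "on_line p L \<longleftrightarrow> (\<forall>a\<in>L. \<forall>v\<in>p. dot3 a v = 0)"

definition good_lines :: "nat \<Rightarrow> (nat \<Rightarrow> 'k::field vec3 set) \<Rightarrow> bool" where
  "good_lines t lam \<longleftrightarrow>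
     (\<forall>i<t. lam i \<in> P2) \<and> inj_on lam {..<t} \<and>
     (\<forall>i<t. \<forall>j<t. \<forall>k<t. i \<noteq> j \<and> i \<noteq> k \<and> j \<noteq> k \<longrightarrow>
        \<not> (\<exists>p\<in>P2. on_line p (lam i) \<and> on_line p (lam j) \<and> on_line p (lam k)))"

definition cross_pts :: "nat \<Rightarrow> (nat \<Rightarrow> 'k::field vec3 set) \<Rightarrow> 'k vec3 set set" where
  "cross_pts t lam = {p \<in> P2. \<exists>i<t. \<exists>j<t. i \<noteq> j \<and> on_line p (lam i) \<and> on_line p (lam j)}"

text \<open>Homogeneous forms of degree d in k[x0,x1,x2]: coefficient functions on
  exponent triples, supported on monomials of degree d.\<close>
definition mons :: "nat \<Rightarrow> (nat \<times> nat \<times> nat) set" where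
  "mons d = {(a, b, c). a + b + c = d}"

definition forms :: "nat \<Rightarrow> (nat \<times> nat \<times> nat \<Rightarrow> 'k::field) set" where
  "forms d = {F. \<forall>m. F m \<noteq> 0 \<longrightarrow> m \<in> mons d}"

definition evalF :: "nat \<Rightarrow> (nat \<times> nat \<times> nat \<Rightarrow> 'k::field) \<Rightarrow> 'k vec3 \<Rightarrow> 'k" where
  "evalF d F v = (case v of (x, y, z) \<Rightarrow>
     \<Sum>(a, b, c)\<in>mons d. F (a, b, c) * x ^ a * y ^ b * z ^ c)"

definition dF0 :: "nat \<Rightarrow> (nat \<times> nat \<times> nat \<Rightarrow> 'k::field) \<Rightarrow> 'k vec3 \<Rightarrow> 'k" where
  "dF0 d F v = (case v of (x, y, z) \<Rightarrow>
     \<Sum>(a, b, c)\<in>mons d. F (a, b, c) * of_nat a * x ^ (a - 1) * y ^ b * z ^ c)"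

definition dF1 :: "nat \<Rightarrow> (nat \<times> nat \<times> nat \<Rightarrow> 'k::field) \<Rightarrow> 'k vec3 \<Rightarrow> 'k" where
  "dF1 d F v = (case v of (x, y, z) \<Rightarrow>
     \<Sum>(a, b, c)\<in>mons d. F (a, b, c) * of_nat b * x ^ a * y ^ (b - 1) * z ^ c)"

definition dF2 :: "nat \<Rightarrow> (nat \<times> nat \<times> nat \<Rightarrow> 'k::field) \<Rightarrow> 'k vec3 \<Rightarrow> 'k" where
  "dF2 d F v = (case v of (x, y, z) \<Rightarrow>
     \<Sum>(a, b, c)\<in>mons d. F (a, b, c) * of_nat c * x ^ a * y ^ b * z ^ (c - 1))"

text \<open>Degree-d parts of the ideals p_1 \<inter> ... \<inter> p_s (reduced points) and
  p_1^2 \<inter> ... \<inter> p_s^2 (first infinitesimal neighbourhood): forms vanishing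
  (to order 2) at every point.\<close>
definition I1 :: "'k::field vec3 set set \<Rightarrow> nat \<Rightarrow> (nat \<times> nat \<times> nat \<Rightarrow> 'k) set" where
  "I1 X d = {F \<in> forms d. \<forall>p\<in>X. \<forall>v\<in>p. evalF d F v = 0}"

definition I2 :: "'k::field vec3 set set \<Rightarrow> nat \<Rightarrow> (nat \<times> nat \<times> nat \<Rightarrow> 'k) set" where
  "I2 X d = {F \<in> forms d. \<forall>p\<in>X. \<forall>v\<in>p.
      evalF d F v = 0 \<and> dF0 d F v = 0 \<and> dF1 d F v = 0 \<and> dF2 d F v = 0}"

definition kdim :: "(nat \<times> nat \<times> nat \<Rightarrow> 'k::field) set \<Rightarrow> nat" where
  "kdim V = vector_space.dim (\<lambda>c F. \<lambda>m. c * F m) V"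

definition hilbX :: "'k::field vec3 set set \<Rightarrow> nat \<Rightarrow> nat" where
  "hilbX X d = kdim (forms d :: (nat \<times> nat \<times> nat \<Rightarrow> 'k) set) - kdim (I1 X d)"

definition hilbZ :: "'k::field vec3 set set \<Rightarrow> nat \<Rightarrow> nat" where
  "hilbZ X d = kdim (forms d :: (nat \<times> nat \<times> nat \<Rightarrow> 'k) set) - kdim (I2 X d)"

text \<open>First difference, with h(-1) = 0.\<close>
definition Delta :: "(nat \<Rightarrow> nat) \<Rightarrow> nat \<Rightarrow> int" where
  "Delta h d = (if d = 0 then int (h 0) else int (h d) - int (h (d - 1)))"

end

theory Submission
  imports Defs "HOL-Library.Product_Plus" "HOL-Computational_Algebra.Polynomial"
begin

text \<open>Put \<open>t = n + 2\<close> and let \<open>X\<close> be \<open>(n + 2 choose 2)\<close> points on no curve of degree \<open>n\<close>, so that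
  every \<open>P\<close> in \<open>X\<close> has a separator \<open>f\<^sub>P\<close> of degree \<open>n\<close>.  Multiples of the squares \<open>f\<^sub>P\<^sup>2\<close> show that the double
  points impose independent conditions in all degrees \<open>\<ge> 2n + 1\<close>, and partial derivatives show that no curve of
  degree \<open>n + 1\<close> is singular along \<open>X\<close>.  Restriction to a line that avoids \<open>X\<close> shows that the increments
  of the dimension of the degree \<open>d\<close> forms singular along \<open>X\<close> are strictly increasing in \<open>d\<close> from the first
  nonzero one on; with the known value in degree \<open>2n + 1\<close> this bounds these dimensions, and forces equality as soon
  as there is a singular form \<open>F\<close> of degree \<open>t\<close>.  For the crossings of \<open>t\<close> lines \<open>F\<close> is their product.

  In the equality case all singular forms of degree \<open>2n + 1\<close> are multiples of \<open>F\<close>, in particular the product of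
  \<open>f\<^sub>P\<close>, \<open>f\<^sub>Q\<close> and the line \<open>PQ\<close>.  Hence either the line \<open>PQ\<close> divides \<open>F\<close>, or \<open>F\<close> divides
  \<open>f\<^sub>P f\<^sub>Q\<close>, which for fixed \<open>P\<close> happens for at most \<open>(n choose 2)\<close> points \<open>Q\<close>.  As a line contains at
  most \<open>n + 1\<close> points of \<open>X\<close>, at least two lines through each \<open>P\<close> divide \<open>F\<close>.  At most \<open>t\<close> lines divide \<open>F\<close>,
  and double counting incidences makes all these bounds equalities.\<close>

section \<open>Finite-dimensional spaces of functions\<close>

text \<open>The scaling is the one in \<open>kdim\<close>, so \<open>fs.dim\<close> is the dimension
  in which the Hilbert functions are stated. The index type stays arbitrary in order to cover
  coefficient functions, polynomial functions and vectors of values alike.\<close>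

interpretation fs: vector_space "(\<lambda>c f m. c * f m) :: 'k::field \<Rightarrow> ('i \<Rightarrow> 'k) \<Rightarrow> 'i \<Rightarrow> 'k"
  by unfold_locales (auto simp: fun_eq_iff algebra_simps)

text \<open>\<open>fs.dim\<close> is 0 on infinite-dimensional spaces, so every comparison of
  dimensions needs this certificate.\<close>

definition findim :: "('i \<Rightarrow> 'k::field) set \<Rightarrow> bool" where
  "findim V \<longleftrightarrow> fs.subspace V \<and> (\<exists>S. finite S \<and> V \<subseteq> fs.span S)"

lemma findim_subspace: "findim V \<Longrightarrow> fs.subspace V"
  by (simp add: findim_def)

lemma findim_subset:
  assumes "findim V" "fs.subspace W" "W \<subseteq> V"
  shows "findim W"
  using assms by (auto simp: findim_def)

lemma findim_finite:
  assumes "findim V" "B \<subseteq> V" "fs.independent B"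
  shows "finite B"
proof -
  obtain S where "finite S" "V \<subseteq> fs.span S" using assms(1) by (auto simp: findim_def)
  then show ?thesis using fs.independent_span_bound[of S B] assms by blast
qed

lemma findim_basis:
  assumes "findim V"
  obtains B where "B \<subseteq> V" "fs.independent B" "V \<subseteq> fs.span B" "finite B" "fs.dim V = card B"
proof -
  obtain B where B: "B \<subseteq> V" "fs.independent B" "V \<subseteq> fs.span B" "card B = fs.dim V"
    using fs.basis_exists by blast
  then show ?thesis using that findim_finite[OF assms] by metis
qed

lemma dim_mono:
  assumes "findim W" "V \<subseteq> W"
  shows "fs.dim V \<le> fs.dim W"
proof -
  obtain B where "B \<subseteq> W" "fs.independent B" "W \<subseteq> fs.span B" "finite B" "fs.dim W = card B"
    using findim_basis[OF assms(1)] by blast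
  then show ?thesis using fs.dim_le_card[of V B] assms(2) by auto
qed

lemma dim_zero: "fs.dim {0 :: 'i \<Rightarrow> 'k::field} = 0"
  using fs.dim_unique[of "{}" "{0 :: 'i \<Rightarrow> 'k}" 0] fs.independent_empty by simp

lemma dim_eq_0:
  assumes "findim V" "fs.dim V = 0"
  shows "V = {0}"
proof -
  obtain B where B: "B \<subseteq> V" "V \<subseteq> fs.span B" "finite B" "fs.dim V = card B"
    using findim_basis[OF assms(1)] by metis
  then have "B = {}" using assms(2) by simp
  then show ?thesis using B fs.subspace_0[OF findim_subspace[OF assms(1)]] by auto
qed

lemma dim_eq_subspace:
  assumes "findim W" "fs.subspace V" "V \<subseteq> W" "fs.dim W \<le> fs.dim V"
  shows "V = W"
proof (rule ccontr)
  assume "V \<noteq> W"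
  then obtain x where x: "x \<in> W" "x \<notin> V" using assms(3) by blast
  have fV: "findim V" using findim_subset assms by blast
  obtain B where B: "B \<subseteq> V" "fs.independent B" "V \<subseteq> fs.span B" "finite B" "fs.dim V = card B"
    using findim_basis[OF fV] by metis
  have "fs.span B \<subseteq> V" using B(1) assms(2) fs.span_minimal by blast
  then have "x \<notin> fs.span B" using x by blast
  then have ind: "fs.independent (insert x B)" using B(2) fs.independent_insertI by blast
  have nx: "x \<notin> B" using x B(1) by blast
  obtain C where C: "C \<subseteq> W" "W \<subseteq> fs.span C" "finite C" "fs.dim W = card C"
    using findim_basis[OF assms(1)] by metis
  have "insert x B \<subseteq> fs.span C" using x B(1) assms(3) C by auto
  then have "card (insert x B) \<le> card C"
    using fs.independent_span_bound[OF C(3) ind] by blast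
  then show False using nx B C assms(4) by simp
qed

lemma dim_pos:
  assumes "findim V" "f \<in> V" "f \<noteq> 0"
  shows "fs.dim V > 0"
  using dim_eq_0[OF assms(1)] assms by fastforce

text \<open>A basis of the kernel is extended to a basis of \<open>V\<close>, and the images of the
  added vectors \<open>C\<close> form a basis of the image. Linearity is asked on \<open>V\<close>
  only, because taking gradients is linear only where gradients exist.\<close>

lemma rank_nullity:
  fixes T :: "('i \<Rightarrow> 'k::field) \<Rightarrow> ('j \<Rightarrow> 'k)"
  assumes V: "findim V"
    and add: "\<And>f g. f \<in> V \<Longrightarrow> g \<in> V \<Longrightarrow> T (f + g) = T f + T g"
    and scale: "\<And>c f. f \<in> V \<Longrightarrow> T (\<lambda>m. c * f m) = (\<lambda>m. c * T f m)"
  shows "fs.dim V = fs.dim {f \<in> V. T f = 0} + fs.dim (T ` V)"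
    and "fs.subspace {f \<in> V. T f = 0}" and "findim (T ` V)"
proof -
  note sV = findim_subspace[OF V]
  let ?K = "{f \<in> V. T f = 0}"
  have T0: "T 0 = 0"
    using scale[of 0 0] fs.subspace_0[OF sV] by (simp add: zero_fun_def)
  show sK: "fs.subspace ?K"
    unfolding fs.subspace_def
    using T0 add scale fs.subspace_0[OF sV] fs.subspace_add[OF sV] fs.subspace_scale[OF sV]
    by (auto simp: zero_fun_def)
  have fK: "findim ?K" using findim_subset[OF V sK] by blast
  obtain B0 where B0: "B0 \<subseteq> ?K" "fs.independent B0" "?K \<subseteq> fs.span B0" "finite B0"
    "fs.dim ?K = card B0"
    using findim_basis[OF fK] by blast
  obtain B where B: "B0 \<subseteq> B" "B \<subseteq> V" "fs.independent B" "V \<subseteq> fs.span B"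
    using fs.maximal_independent_subset_extend[of B0 V] B0 by blast
  have finB: "finite B" using findim_finite[OF V] B by blast
  have dimV: "fs.dim V = card B" using fs.dim_unique[OF B(2,4,3)] by blast
  define C where "C = B - B0"
  have C: "finite C" "C \<subseteq> V" "B = B0 \<union> C" "B0 \<inter> C = {}"
    using B finB by (auto simp: C_def)
  have Tsum: "(\<Sum>v\<in>S. (\<lambda>m. u v * v m)) \<in> V \<and>
      T (\<Sum>v\<in>S. (\<lambda>m. u v * v m)) = (\<Sum>v\<in>S. (\<lambda>m. u v * T v m))"
    if "finite S" "S \<subseteq> V" for S and u :: "('i \<Rightarrow> 'k) \<Rightarrow> 'k"
    using that
  proof (induction S)
    case empty then show ?case using T0 fs.subspace_0[OF sV] by (simp only: sum.empty)
  next
    case (insert x S)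
    define y where "y = (\<lambda>m. u x * x m)"
    define z where "z = (\<Sum>v\<in>S. (\<lambda>m. u v * v m))"
    have y: "y \<in> V" "T y = (\<lambda>m. u x * T x m)"
      unfolding y_def using insert fs.subspace_scale[OF sV] scale by auto
    have z: "z \<in> V" "T z = (\<Sum>v\<in>S. (\<lambda>m. u v * T v m))"
      unfolding z_def using insert by auto
    show ?case
      unfolding sum.insert[OF insert(1,2)] y_def[symmetric] z_def[symmetric]
      using fs.subspace_add[OF sV y(1) z(1)] add[OF y(1) z(1)] y z by metis
  qed
  have ind: "\<forall>v\<in>C. u v = 0" if z: "(\<Sum>v\<in>C. (\<lambda>m. u v * T v m)) = 0" for u
  proof -
    have "(\<Sum>v\<in>C. (\<lambda>m. u v * v m)) \<in> ?K" using Tsum[OF C(1,2), of u] z by simp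
    then have "(\<Sum>v\<in>C. (\<lambda>m. u v * v m)) \<in> fs.span B0" using B0(3) by blast
    then obtain w where w: "(\<Sum>v\<in>C. (\<lambda>m. u v * v m)) = (\<Sum>v\<in>B0. (\<lambda>m. w v * v m))"
      unfolding fs.span_finite[OF B0(4)] by auto
    \<comment> \<open>A relation among the images puts a combination of \<open>C\<close> into the
      kernel; subtracting its expansion in \<open>B0\<close> turns it into a relation on the whole
      basis \<open>B\<close>.\<close>
    define y where "y v = (if v \<in> C then u v else - w v)" for v
    have "(\<Sum>v\<in>B. (\<lambda>m. y v * v m)) = (\<Sum>v\<in>B0. (\<lambda>m. y v * v m)) + (\<Sum>v\<in>C. (\<lambda>m. y v * v m))"
      unfolding C(3) using C B0(4) by (intro sum.union_disjoint) auto
    also have "(\<Sum>v\<in>C. (\<lambda>m. y v * v m)) = (\<Sum>v\<in>C. (\<lambda>m. u v * v m))"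
      by (simp add: y_def)
    also have "(\<Sum>v\<in>B0. (\<lambda>m. y v * v m)) = - (\<Sum>v\<in>B0. (\<lambda>m. w v * v m))"
      unfolding sum_negf[symmetric]
      using C(4) by (intro sum.cong refl) (auto simp: y_def fun_eq_iff)
    finally have "(\<Sum>v\<in>B. (\<lambda>m. y v * v m)) = 0" using w by (simp add: zero_fun_def)
    then have "\<forall>v\<in>B. y v = 0" using B(3) finB fs.dependent_finite by blast
    then have "\<forall>v\<in>C. y v = 0" using C(3) by blast
    then show ?thesis by (simp add: y_def)
  qed
  have inj: "inj_on T C"
  proof (rule inj_onI, rule ccontr)
    fix a b assume ab: "a \<in> C" "b \<in> C" "T a = T b" "a \<noteq> b"
    define u where "u v = (if v = a then 1 else if v = b then - 1 else (0::'k))" for v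
    have "(\<Sum>v\<in>C. (\<lambda>m. u v * T v m)) = (\<Sum>v\<in>{a,b}. (\<lambda>m. u v * T v m))"
      using ab C(1) by (intro sum.mono_neutral_right) (auto simp: u_def zero_fun_def)
    also have "\<dots> = 0" using ab by (auto simp: u_def fun_eq_iff)
    finally show False using ind[of u] ab by (auto simp: u_def)
  qed
  have indT: "fs.independent (T ` C)"
  proof
    assume "fs.dependent (T ` C)"
    then obtain u where u: "(\<Sum>v\<in>T ` C. (\<lambda>m. u v * v m)) = 0" "\<exists>v\<in>T ` C. u v \<noteq> 0"
      using fs.dependent_finite[of "T ` C"] C(1) by auto
    have "(\<Sum>v\<in>C. (\<lambda>m. u (T v) * T v m)) = 0"
      using u(1) by (simp add: sum.reindex[OF inj] o_def)
    then show False using ind[of "\<lambda>v. u (T v)"] u(2) by auto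
  qed
  have span: "T ` V \<subseteq> fs.span (T ` C)"
  proof
    fix g assume "g \<in> T ` V"
    then obtain f where f: "f \<in> V" "g = T f" by blast
    then have "f \<in> fs.span B" using B(4) by blast
    then obtain u where u: "f = (\<Sum>v\<in>B. (\<lambda>m. u v * v m))"
      unfolding fs.span_finite[OF finB] by auto
    have "T f = (\<Sum>v\<in>B. (\<lambda>m. u v * T v m))" using Tsum[OF finB B(2), of u] u by simp
    also have "\<dots> = (\<Sum>v\<in>C. (\<lambda>m. u v * T v m))"
      using finB B0(1) by (intro sum.mono_neutral_right) (auto simp: C_def zero_fun_def subset_iff)
    finally have "g = (\<Sum>v\<in>C. (\<lambda>m. u v * T v m))" using f(2) by simp
    moreover have "(\<Sum>v\<in>C. (\<lambda>m. u v * T v m)) \<in> fs.span (T ` C)"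
      by (intro fs.span_sum fs.span_scale fs.span_base imageI)
    ultimately show "g \<in> fs.span (T ` C)" by simp
  qed
  have sub: "T ` C \<subseteq> T ` V" using C by blast
  have "fs.dim (T ` V) = card C"
    using fs.dim_unique[OF sub span indT] card_image[OF inj] by simp
  moreover have "card B = card B0 + card C"
    unfolding C(3) using C B0(4) by (intro card_Un_disjoint) auto
  ultimately show "fs.dim V = fs.dim ?K + fs.dim (T ` V)" using dimV B0(5) by simp
  have "fs.subspace (T ` V)"
    unfolding fs.subspace_def
  proof (intro conjI ballI allI)
    show "0 \<in> T ` V" using T0 fs.subspace_0[OF sV] by force
  next
    fix x y assume "x \<in> T ` V" "y \<in> T ` V"
    then obtain f g where "f \<in> V" "g \<in> V" "x = T f" "y = T g" by blast
    then show "x + y \<in> T ` V" using add[of f g] fs.subspace_add[OF sV, of f g] by (metis imageI)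
  next
    fix c x assume "x \<in> T ` V"
    then obtain f where "f \<in> V" "x = T f" by blast
    then show "(\<lambda>m. c * x m) \<in> T ` V"
      using scale[of f c] fs.subspace_scale[OF sV, of f c] by (metis imageI)
  qed
  then show "findim (T ` V)" unfolding findim_def using span C(1) by blast
qed

lemma dim_inj_image:
  fixes T :: "('i \<Rightarrow> 'k::field) \<Rightarrow> ('j \<Rightarrow> 'k)"
  assumes V: "findim V"
    and add: "\<And>f g. f \<in> V \<Longrightarrow> g \<in> V \<Longrightarrow> T (f + g) = T f + T g"
    and scale: "\<And>c f. f \<in> V \<Longrightarrow> T (\<lambda>m. c * f m) = (\<lambda>m. c * T f m)"
    and inj: "\<And>f. f \<in> V \<Longrightarrow> T f = 0 \<Longrightarrow> f = 0"
  shows "fs.dim (T ` V) = fs.dim V"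
proof -
  have "T 0 = 0"
    using scale[of 0 0] fs.subspace_0[OF findim_subspace[OF V]] by (simp add: zero_fun_def)
  then have "{f \<in> V. T f = 0} = {0}"
    using inj fs.subspace_0[OF findim_subspace[OF V]] by auto
  then show ?thesis using rank_nullity(1)[OF V, of T] add scale dim_zero by simp
qed

section \<open>Coordinate spaces and lower bounds for dimensions by evaluation\<close>

definition supp_on :: "'i set \<Rightarrow> ('i \<Rightarrow> 'k::field) set" where
  "supp_on B = {f. \<forall>x. f x \<noteq> 0 \<longrightarrow> x \<in> B}"

lemma supp_on_sum:
  assumes "finite B" "f \<in> supp_on B"
  shows "f = (\<Sum>b\<in>B. (\<lambda>m. f b * (if m = b then 1 else 0)))"
proof
  fix x
  have "(\<Sum>b\<in>B. (\<lambda>m. f b * (if m = b then 1 else 0))) x = (\<Sum>b\<in>B. f b * (if x = b then 1 else 0))"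
    by (induction B rule: infinite_finite_induct) auto
  also have "\<dots> = (\<Sum>b\<in>B. if x = b then f b else 0)" by (intro sum.cong) auto
  also have "\<dots> = f x" using assms by (auto simp: supp_on_def)
  finally show "f x = (\<Sum>b\<in>B. (\<lambda>m. f b * (if m = b then 1 else 0))) x" by simp
qed

lemma subspace_supp_on: "fs.subspace (supp_on B)"
  unfolding fs.subspace_def supp_on_def by auto (metis add_0)

lemma dim_supp_on:
  assumes "finite B"
  shows "fs.dim (supp_on B :: ('i \<Rightarrow> 'k::field) set) = card B" and "findim (supp_on B :: ('i \<Rightarrow> 'k::field) set)"
proof -
  define e where "e b = (\<lambda>m. if m = b then 1 else 0 :: 'k)" for b :: 'i
  have inj: "inj_on e B" by (auto simp: inj_on_def e_def fun_eq_iff split: if_splits)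
  have sp: "supp_on B \<subseteq> fs.span (e ` B)"
  proof
    fix f :: "'i \<Rightarrow> 'k" assume "f \<in> supp_on B"
    then have "f = (\<Sum>b\<in>B. (\<lambda>m. f b * e b m))" using supp_on_sum[OF assms] by (simp add: e_def)
    moreover have "(\<Sum>b\<in>B. (\<lambda>m. f b * e b m)) \<in> fs.span (e ` B)"
      by (intro fs.span_sum fs.span_scale fs.span_base imageI)
    ultimately show "f \<in> fs.span (e ` B)" by simp
  qed
  have sub: "e ` B \<subseteq> supp_on B" by (auto simp: e_def supp_on_def split: if_splits)
  have "fs.independent (e ` B)"
  proof
    assume "fs.dependent (e ` B)"
    then obtain u where u: "(\<Sum>v\<in>e ` B. (\<lambda>m. u v * v m)) = 0" "\<exists>v\<in>e ` B. u v \<noteq> 0"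
      using fs.dependent_finite[of "e ` B"] assms by auto
    have "(\<Sum>b\<in>B. (\<lambda>m. u (e b) * e b m)) = 0"
      using u(1) by (simp add: sum.reindex[OF inj] o_def)
    moreover have "(\<lambda>b. if b \<in> B then u (e b) else 0) = (\<Sum>b\<in>B. (\<lambda>m. u (e b) * e b m))"
      using supp_on_sum[OF assms, of "\<lambda>b. if b \<in> B then u (e b) else 0"]
      by (simp add: e_def supp_on_def)
    ultimately show False using u(2) by (auto simp: fun_eq_iff split: if_splits)
  qed
  then show "fs.dim (supp_on B :: ('i \<Rightarrow> 'k) set) = card B"
    using fs.dim_unique[OF sub sp] card_image[OF inj] by simp
  show "findim (supp_on B :: ('i \<Rightarrow> 'k) set)"
    unfolding findim_def using sp assms subspace_supp_on by blast
qed

text \<open>Restriction to \<open>B\<close> maps \<open>U\<close> onto all functions supported on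
  \<open>B\<close>, because each separating function restricts to a nonzero multiple of an indicator
  function.\<close>

lemma card_le_dim:
  fixes U :: "('i \<Rightarrow> 'k::field) set"
  assumes U: "findim U" and B: "finite B"
    and sep: "\<And>b. b \<in> B \<Longrightarrow> \<exists>f\<in>U. f b \<noteq> 0 \<and> (\<forall>b'\<in>B. b' \<noteq> b \<longrightarrow> f b' = 0)"
  shows "card B \<le> fs.dim U"
proof -
  define T where "T f = (\<lambda>b. if b \<in> B then f b else 0)" for f :: "'i \<Rightarrow> 'k"
  have T: "fs.dim U = fs.dim {f \<in> U. T f = 0} + fs.dim (T ` U)" "findim (T ` U)"
    by (rule rank_nullity[OF U]; force simp: T_def fun_eq_iff)+
  have "f \<in> T ` U" if f: "f \<in> supp_on B" for f
  proof -
    have "(\<lambda>m. if m = b then 1 else 0) \<in> T ` U" if b: "b \<in> B" for b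
    proof -
      obtain g where g: "g \<in> U" "g b \<noteq> 0" "\<forall>b'\<in>B. b' \<noteq> b \<longrightarrow> g b' = 0" using sep[OF b] by blast
      have "(\<lambda>m. inverse (g b) * g m) \<in> U"
        using fs.subspace_scale[OF findim_subspace[OF U] g(1)] by blast
      moreover have "T (\<lambda>m. inverse (g b) * g m) = (\<lambda>m. if m = b then 1 else 0)"
        using g b by (auto simp: T_def fun_eq_iff)
      ultimately show ?thesis by force
    qed
    then have "(\<Sum>b\<in>B. (\<lambda>m. f b * (if m = b then 1 else 0))) \<in> T ` U"
      by (intro fs.subspace_sum fs.subspace_scale findim_subspace[OF T(2)])
    then show ?thesis using supp_on_sum[OF B f] by simp
  qed
  then have "card B \<le> fs.dim (T ` U)"
    using dim_mono[OF T(2), of "supp_on B"] dim_supp_on[OF B] by (metis subsetI)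
  then show ?thesis using T(1) by simp
qed

section \<open>Homogeneous polynomial functions\<close>

lemma smult3_simps [simp]:
  "fst (smult3 c v) = c * fst v" "fst (snd (smult3 c v)) = c * fst (snd v)"
  "snd (snd (smult3 c v)) = c * snd (snd v)"
  by (auto simp: smult3_def split: prod.splits)

lemma dot3_alt: "dot3 a v = fst a * fst v + fst (snd a) * fst (snd v) + snd (snd a) * snd (snd v)"
  by (auto simp: dot3_def split: prod.splits)

lemma vec3_eq_iff: "(u :: 'k::field vec3) = v \<longleftrightarrow>
    fst u = fst v \<and> fst (snd u) = fst (snd v) \<and> snd (snd u) = snd (snd v)"
  by (auto simp: prod_eq_iff)

lemma zero_vec3: "(0, 0, 0) = (0 :: 'k::field vec3)"
  by (simp add: zero_prod_def)

lemma smult3_smult3: "smult3 a (smult3 b v) = smult3 (a * b) v"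
  by (simp add: vec3_eq_iff)

lemma smult3_one [simp]: "smult3 1 v = v"
  by (simp add: vec3_eq_iff)

lemma dot3_add [simp]: "dot3 a (u + v) = dot3 a u + dot3 a v"
  by (simp add: dot3_alt algebra_simps)

lemma dot3_diff [simp]: "dot3 a (u - v) = dot3 a u - dot3 a v"
  by (simp add: dot3_alt algebra_simps)

lemma dot3_smult [simp]: "dot3 a (smult3 c v) = c * dot3 a v"
  by (simp add: dot3_alt algebra_simps)

lemma dot3_smult_left [simp]: "dot3 (smult3 c a) v = c * dot3 a v"
  by (simp add: dot3_alt algebra_simps)

lemma dot3_commute: "dot3 a v = dot3 v a"
  by (simp add: dot3_alt algebra_simps)

lemma dot3_zero [simp]: "dot3 a 0 = 0" "dot3 0 a = 0"
  by (simp_all add: dot3_alt)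

text \<open>Homogeneous polynomial functions of degree d; over an infinite field they are the
  same thing as forms, and linear substitutions are simply compositions.\<close>

primrec hp :: "nat \<Rightarrow> ('k::field vec3 \<Rightarrow> 'k) set" where
  "hp 0 = range (\<lambda>c v. c)"
| "hp (Suc d) = {(\<lambda>v. fst v * f v + fst (snd v) * g v + snd (snd v) * h v) | f g h.
     f \<in> hp d \<and> g \<in> hp d \<and> h \<in> hp d}"

declare hp.simps(2) [simp del]

lemma hp_SucI:
  assumes "f \<in> hp d" "g \<in> hp d" "h \<in> hp d"
    and "\<And>v. F v = fst v * f v + fst (snd v) * g v + snd (snd v) * h v"
  shows "F \<in> hp (Suc d)"
proof -
  have "F = (\<lambda>v. fst v * f v + fst (snd v) * g v + snd (snd v) * h v)"
    using assms(4) by blast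
  then show ?thesis using assms(1-3) by (auto simp: hp.simps(2))
qed

lemma hp_SucE:
  assumes "F \<in> hp (Suc d)"
  obtains f g h where "f \<in> hp d" "g \<in> hp d" "h \<in> hp d"
    "\<And>v. F v = fst v * f v + fst (snd v) * g v + snd (snd v) * h v"
  using assms by (auto simp: hp.simps(2))

lemma hp_add: "f \<in> hp d \<Longrightarrow> g \<in> hp d \<Longrightarrow> (\<lambda>v. f v + g v) \<in> hp d"
proof (induction d arbitrary: f g)
  case 0 then show ?case by auto
next
  case (Suc d)
  obtain f0 f1 f2 where f: "f0 \<in> hp d" "f1 \<in> hp d" "f2 \<in> hp d"
    "\<And>v. f v = fst v * f0 v + fst (snd v) * f1 v + snd (snd v) * f2 v"
    using hp_SucE[OF Suc.prems(1)] by metis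
  obtain g0 g1 g2 where g: "g0 \<in> hp d" "g1 \<in> hp d" "g2 \<in> hp d"
    "\<And>v. g v = fst v * g0 v + fst (snd v) * g1 v + snd (snd v) * g2 v"
    using hp_SucE[OF Suc.prems(2)] by metis
  show ?case
    by (rule hp_SucI[OF Suc.IH[OF f(1) g(1)] Suc.IH[OF f(2) g(2)] Suc.IH[OF f(3) g(3)]])
      (simp add: f(4) g(4) algebra_simps)
qed

lemma hp_scale: "f \<in> hp d \<Longrightarrow> (\<lambda>v. c * f v) \<in> hp d"
proof (induction d arbitrary: f)
  case 0 then show ?case by auto
next
  case (Suc d)
  obtain f0 f1 f2 where f: "f0 \<in> hp d" "f1 \<in> hp d" "f2 \<in> hp d"
    "\<And>v. f v = fst v * f0 v + fst (snd v) * f1 v + snd (snd v) * f2 v"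
    using hp_SucE[OF Suc.prems(1)] by metis
  show ?case
    by (rule hp_SucI[OF Suc.IH[OF f(1)] Suc.IH[OF f(2)] Suc.IH[OF f(3)]])
      (simp add: f(4) algebra_simps)
qed

lemma hp_zero: "0 \<in> hp d"
proof (induction d)
  case 0 then show ?case by (auto simp: zero_fun_def)
next
  case (Suc d) show ?case by (rule hp_SucI[OF Suc Suc Suc]) simp
qed

lemma hp_subspace: "fs.subspace (hp d)"
  unfolding fs.subspace_def using hp_zero hp_scale hp_add
  by (auto simp: plus_fun_def)

lemma hp_dot_mult:
  assumes "f \<in> hp d" shows "(\<lambda>v. dot3 a v * f v) \<in> hp (Suc d)"
  by (rule hp_SucI[OF hp_scale[OF assms, of "fst a"] hp_scale[OF assms, of "fst (snd a)"]
        hp_scale[OF assms, of "snd (snd a)"]]) (simp add: dot3_alt algebra_simps)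

lemma hp_dot: "dot3 a \<in> hp 1"
proof -
  have "(\<lambda>v. 1) \<in> (hp 0 :: ('a vec3 \<Rightarrow> 'a) set)" by auto
  from hp_dot_mult[OF this, of a] show ?thesis by simp
qed

lemma hp_mult:
  assumes "f \<in> hp a" "g \<in> hp b"
  shows "(\<lambda>v. f v * g v) \<in> hp (a + b)"
  using assms(1)
proof (induction a arbitrary: f)
  case 0 then show ?case using hp_scale[OF assms(2)] by auto
next
  case (Suc a)
  obtain f0 f1 f2 where f: "f0 \<in> hp a" "f1 \<in> hp a" "f2 \<in> hp a"
    "\<And>v. f v = fst v * f0 v + fst (snd v) * f1 v + snd (snd v) * f2 v"
    using hp_SucE[OF Suc.prems(1)] by metis
  show ?case unfolding add_Suc
    by (rule hp_SucI[OF Suc.IH[OF f(1)] Suc.IH[OF f(2)] Suc.IH[OF f(3)]])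
      (simp add: f(4) algebra_simps)
qed

lemma hp_power:
  assumes "f \<in> hp a" shows "(\<lambda>v. f v ^ n) \<in> hp (n * a)"
proof (induction n)
  case (Suc n) then show ?case using hp_mult[OF assms Suc] by simp
qed auto

lemma hp_prod:
  assumes "finite S" "\<And>i. i \<in> S \<Longrightarrow> f i \<in> hp 1"
  shows "(\<lambda>v. \<Prod>i\<in>S. f i v) \<in> hp (card S)"
  using assms
proof (induction S)
  case (insert x S)
  then show ?case using hp_mult[of "f x" 1 "\<lambda>v. \<Prod>i\<in>S. f i v" "card S"] by simp
qed auto

lemma hp_homogeneous: "f \<in> hp d \<Longrightarrow> f (smult3 c v) = c ^ d * f v"
proof (induction d arbitrary: f)
  case 0 then show ?case by auto
next
  case (Suc d)
  obtain f0 f1 f2 where f: "f0 \<in> hp d" "f1 \<in> hp d" "f2 \<in> hp d"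
    "\<And>v. f v = fst v * f0 v + fst (snd v) * f1 v + snd (snd v) * f2 v"
    using hp_SucE[OF Suc.prems(1)] by metis
  show ?case using f by (simp add: Suc.IH algebra_simps)
qed

section \<open>Restriction to a line as a polynomial in one variable\<close>

lemma hp_poly_on_line:
  "f \<in> hp d \<Longrightarrow> \<exists>p. degree p \<le> d \<and> (\<forall>s. f (u + smult3 s w) = poly p s)"
proof (induction d arbitrary: f)
  case 0
  then obtain c where "f = (\<lambda>v. c)" by auto
  then show ?case by (intro exI[of _ "[:c:]"]) auto
next
  case (Suc d)
  obtain f0 f1 f2 where f: "f0 \<in> hp d" "f1 \<in> hp d" "f2 \<in> hp d"
    "\<And>v. f v = fst v * f0 v + fst (snd v) * f1 v + snd (snd v) * f2 v"
    using hp_SucE[OF Suc.prems(1)] by metis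
  obtain p0 where p0: "degree p0 \<le> d" "\<And>s. f0 (u + smult3 s w) = poly p0 s" using Suc.IH[OF f(1)] by blast
  obtain p1 where p1: "degree p1 \<le> d" "\<And>s. f1 (u + smult3 s w) = poly p1 s" using Suc.IH[OF f(2)] by blast
  obtain p2 where p2: "degree p2 \<le> d" "\<And>s. f2 (u + smult3 s w) = poly p2 s" using Suc.IH[OF f(3)] by blast
  let ?p = "[:fst u, fst w:] * p0 + [:fst (snd u), fst (snd w):] * p1 + [:snd (snd u), snd (snd w):] * p2"
  have deg: "degree ([:a, b:] * q) \<le> Suc d" if "degree q \<le> d" for a b :: 'a and q
    using degree_mult_le[of "[:a, b:]" q] that degree_pCons_le[of a "[:b:]"] by simp
  have "degree ?p \<le> Suc d"
    by (intro degree_add_le deg p0(1) p1(1) p2(1))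
  moreover have "\<forall>s. f (u + smult3 s w) = poly ?p s"
    by (simp add: f(4) p0(2) p1(2) p2(2) algebra_simps)
  ultimately show ?case by blast
qed

lemma ex_poly_nonzero:
  fixes S :: "'k::field_char_0 poly set"
  assumes "finite S" "0 \<notin> S"
  shows "\<exists>c. \<forall>p\<in>S. poly p c \<noteq> 0"
proof -
  have "\<Prod>S \<noteq> 0" using assms by (simp add: prod_zero_iff)
  then obtain c where "poly (\<Prod>S) c \<noteq> 0" using poly_all_0_iff_0 by blast
  then show ?thesis using assms by (auto simp: poly_prod prod_zero_iff)
qed

text \<open>On the line joining \<open>u\<close> and \<open>w\<close> both functions become nonzero
  polynomials in one parameter, which have finitely many zeros together. Since \<open>v\<close> lies
  on that line, linear forms that vanish at \<open>u\<close> and \<open>w\<close> vanish at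
  \<open>v\<close>; this lets the argument run inside a given projective line as well.\<close>

lemma hp_common_nonzero:
  fixes f g :: "'k::field_char_0 vec3 \<Rightarrow> 'k"
  assumes "f \<in> hp a" "g \<in> hp b" "f u \<noteq> 0" "g w \<noteq> 0"
  obtains v where "f v \<noteq> 0" "g v \<noteq> 0" "\<And>l. dot3 l u = 0 \<Longrightarrow> dot3 l w = 0 \<Longrightarrow> dot3 l v = 0"
proof -
  obtain p where p: "\<And>s. f (u + smult3 s (w - u)) = poly p s"
    using hp_poly_on_line[OF assms(1)] by blast
  obtain q where q: "\<And>s. g (u + smult3 s (w - u)) = poly q s"
    using hp_poly_on_line[OF assms(2)] by blast
  have "u + smult3 0 (w - u) = u" "u + smult3 1 (w - u) = w" by (simp_all add: vec3_eq_iff)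
  then have "poly p 0 \<noteq> 0" "poly q 1 \<noteq> 0" using p[of 0] q[of 1] assms(3,4) by auto
  then have "p \<noteq> 0" "q \<noteq> 0" by auto
  then obtain s where "poly p s \<noteq> 0" "poly q s \<noteq> 0"
    using ex_poly_nonzero[of "{p, q}"] by auto
  then show ?thesis using p q by (intro that[of "u + smult3 s (w - u)"]) auto
qed

lemma hp_mult_eq_0:
  fixes f g :: "'k::field_char_0 vec3 \<Rightarrow> 'k"
  assumes "f \<in> hp a" "g \<in> hp b" "\<And>v. f v * g v = 0"
  shows "f = 0 \<or> g = 0"
proof (rule ccontr)
  assume "\<not> (f = 0 \<or> g = 0)"
  then obtain u w where "f u \<noteq> 0" "g w \<noteq> 0" by (auto simp: fun_eq_iff)
  from hp_common_nonzero[OF assms(1,2) this] show False using assms(3) by (metis mult_eq_0_iff)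
qed

lemma hp_mult_cancel:
  fixes f :: "'k::field_char_0 vec3 \<Rightarrow> 'k"
  assumes "f \<in> hp a" "f \<noteq> 0" "g \<in> hp b" "h \<in> hp b" "\<And>v. f v * g v = f v * h v"
  shows "g = h"
proof -
  have "(\<lambda>v. g v + - 1 * h v) \<in> hp b" by (intro hp_add hp_scale assms)
  from hp_mult_eq_0[OF assms(1) this] assms(2,5)
  have "(\<lambda>v. g v + - 1 * h v) = 0" by (simp add: algebra_simps)
  then show ?thesis by (simp add: fun_eq_iff)
qed

section \<open>Division by a linear form\<close>

definition vanish :: "'k::field vec3 \<Rightarrow> ('k vec3 \<Rightarrow> 'k) \<Rightarrow> bool" where
  "vanish l f \<longleftrightarrow> (\<forall>v. dot3 l v = 0 \<longrightarrow> f v = 0)"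

lemma vanish_mult:
  fixes f g :: "'k::field_char_0 vec3 \<Rightarrow> 'k"
  assumes "f \<in> hp a" "g \<in> hp b" "vanish l (\<lambda>v. f v * g v)"
  shows "vanish l f \<or> vanish l g"
proof (rule ccontr)
  assume "\<not> (vanish l f \<or> vanish l g)"
  then obtain u w where uw: "f u \<noteq> 0" "g w \<noteq> 0" "dot3 l u = 0" "dot3 l w = 0"
    by (auto simp: vanish_def)
  from hp_common_nonzero[OF assms(1,2) uw(1,2)] uw(3,4) assms(3)
  show False by (metis mult_eq_0_iff vanish_def)
qed

text \<open>The coordinates of \<open>v - smult3 (dot3 l v) e\<close> are linear forms
  \<open>c0\<close>, \<open>c1\<close>, \<open>c2\<close> in \<open>v\<close>. If
  \<open>dot3 l e = 1\<close>, this map is the projection onto the line \<open>l\<close> along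
  \<open>e\<close>.\<close>

lemma hp_comp_proj:
  "f \<in> hp d \<Longrightarrow> (\<lambda>v. f (v - smult3 (dot3 l v) e)) \<in> hp d"
proof (induction d arbitrary: f)
  case 0 then show ?case by auto
next
  case (Suc d)
  obtain f0 f1 f2 where f: "f0 \<in> hp d" "f1 \<in> hp d" "f2 \<in> hp d"
    "\<And>v. f v = fst v * f0 v + fst (snd v) * f1 v + snd (snd v) * f2 v"
    using hp_SucE[OF Suc.prems(1)] by metis
  define P where "P v = v - smult3 (dot3 l v) e" for v
  have IH: "(\<lambda>v. g (P v)) \<in> hp d" if "g \<in> hp d" for g using Suc.IH[OF that] by (simp add: P_def)
  define c0 c1 c2 where "c0 = (1 - fst e * fst l, - fst e * fst (snd l), - fst e * snd (snd l))"
    and "c1 = (- fst (snd e) * fst l, 1 - fst (snd e) * fst (snd l), - fst (snd e) * snd (snd l))"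
    and "c2 = (- snd (snd e) * fst l, - snd (snd e) * fst (snd l), 1 - snd (snd e) * snd (snd l))"
  have "(\<lambda>v. f (P v)) = (\<lambda>v. (dot3 c0 v * f0 (P v) + dot3 c1 v * f1 (P v)) + dot3 c2 v * f2 (P v))"
  proof
    fix v
    have "fst (P v) = dot3 c0 v" "fst (snd (P v)) = dot3 c1 v" "snd (snd (P v)) = dot3 c2 v"
      by (simp_all add: P_def dot3_alt c0_def c1_def c2_def algebra_simps)
    then show "f (P v) = (dot3 c0 v * f0 (P v) + dot3 c1 v * f1 (P v)) + dot3 c2 v * f2 (P v)"
      by (simp add: f(4))
  qed
  also have "\<dots> \<in> hp (Suc d)" by (intro hp_add hp_dot_mult IH f)
  finally show ?case by (simp add: P_def)
qed

text \<open>Division with remainder by \<open>l\<close>: each coordinate of \<open>v\<close> is its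
  projection plus \<open>dot3 l v\<close> times a coordinate of \<open>e\<close>, and substituting
  this into \<open>f\<close> collects everything but the projected value into a multiple of
  \<open>dot3 l v\<close>.\<close>

lemma hp_split_line:
  assumes "dot3 l e = 1"
  shows "f \<in> hp (Suc d) \<Longrightarrow>
    \<exists>g\<in>hp d. \<forall>v. f v = f (v - smult3 (dot3 l v) e) + dot3 l v * g v"
proof (induction d arbitrary: f)
  case 0
  then have "f \<in> hp (Suc 0)" by simp
  then obtain a b c where f: "\<And>v. f v = fst v * a + fst (snd v) * b + snd (snd v) * c" by (auto elim!: hp_SucE)
  show ?case
    by (rule bexI[of _ "\<lambda>v. f e"]) (auto simp: f algebra_simps)
next
  case (Suc d)
  obtain f0 f1 f2 where f: "f0 \<in> hp (Suc d)" "f1 \<in> hp (Suc d)" "f2 \<in> hp (Suc d)"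
    "\<And>v. f v = fst v * f0 v + fst (snd v) * f1 v + snd (snd v) * f2 v"
    using hp_SucE[OF Suc.prems(1)] by metis
  define P where "P v = v - smult3 (dot3 l v) e" for v
  obtain g0 where g0: "g0 \<in> hp d" "\<And>v. f0 v = f0 (P v) + dot3 l v * g0 v"
    using Suc.IH[OF f(1)] P_def by metis
  obtain g1 where g1: "g1 \<in> hp d" "\<And>v. f1 v = f1 (P v) + dot3 l v * g1 v"
    using Suc.IH[OF f(2)] P_def by metis
  obtain g2 where g2: "g2 \<in> hp d" "\<And>v. f2 v = f2 (P v) + dot3 l v * g2 v"
    using Suc.IH[OF f(3)] P_def by metis
  define g where "g v = (((fst v * g0 v + fst (snd v) * g1 v + snd (snd v) * g2 v)
    + fst e * f0 (P v)) + fst (snd e) * f1 (P v)) + snd (snd e) * f2 (P v)" for v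
  have "(\<lambda>v. fst v * g0 v + fst (snd v) * g1 v + snd (snd v) * g2 v) \<in> hp (Suc d)"
    by (rule hp_SucI[OF g0(1) g1(1) g2(1)]) simp
  moreover have "(\<lambda>v. h (P v)) \<in> hp (Suc d)" if "h \<in> hp (Suc d)" for h
    using hp_comp_proj[OF that, of l e] by (simp add: P_def)
  ultimately have "g \<in> hp (Suc d)"
    unfolding g_def using f(1-3) by (intro hp_add[OF hp_add[OF hp_add]] hp_scale)
  moreover have "f v = f (P v) + dot3 l v * g v" for v
  proof -
    have P: "fst (P v) = fst v - dot3 l v * fst e" "fst (snd (P v)) = fst (snd v) - dot3 l v * fst (snd e)"
      "snd (snd (P v)) = snd (snd v) - dot3 l v * snd (snd e)" by (simp_all add: P_def)
    have "f v = fst v * (f0 (P v) + dot3 l v * g0 v) + fst (snd v) * (f1 (P v) + dot3 l v * g1 v)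
      + snd (snd v) * (f2 (P v) + dot3 l v * g2 v)"
      using f(4)[of v] g0(2)[of v] g1(2)[of v] g2(2)[of v] by simp
    also have "\<dots> = f (P v) + dot3 l v * g v"
      unfolding f(4)[of "P v"] P g_def by (simp add: algebra_simps)
    finally show ?thesis .
  qed
  ultimately show ?case unfolding P_def by blast
qed

lemma ex_dot3_eq_1:
  assumes "(l :: 'k::field vec3) \<noteq> 0"
  obtains e where "dot3 l e = 1"
proof -
  consider "fst l \<noteq> 0" | "fst (snd l) \<noteq> 0" | "snd (snd l) \<noteq> 0"
    using assms by (auto simp: vec3_eq_iff)
  then show thesis
  proof cases
    case 1 then show ?thesis by (intro that[of "(1 / fst l, 0, 0)"]) (simp add: dot3_alt)
  next
    case 2 then show ?thesis by (intro that[of "(0, 1 / fst (snd l), 0)"]) (simp add: dot3_alt)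
  next
    case 3 then show ?thesis by (intro that[of "(0, 0, 1 / snd (snd l))"]) (simp add: dot3_alt)
  qed
qed

text \<open>The remainder in \<open>hp_split_line\<close> is a value of \<open>f\<close> on the
  line, hence zero. So for nonzero \<open>l\<close> the predicate \<open>vanish\<close> expresses
  divisibility by \<open>dot3 l\<close>.\<close>

lemma hp_divide_line:
  assumes "l \<noteq> 0" "f \<in> hp (Suc d)" "vanish l f"
  obtains g where "g \<in> hp d" "\<And>v. f v = dot3 l v * g v"
proof -
  obtain e where e: "dot3 l e = 1" using ex_dot3_eq_1[OF assms(1)] .
  obtain g where g: "g \<in> hp d" "\<And>v. f v = f (v - smult3 (dot3 l v) e) + dot3 l v * g v"
    using hp_split_line[OF e assms(2)] by blast
  have z: "f (v - smult3 (dot3 l v) e) = 0" for v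
    using assms(3) e unfolding vanish_def by (metis dot3_diff dot3_smult mult.right_neutral diff_self)
  have "f v = dot3 l v * g v" for v using g(2)[of v] unfolding z by simp
  then show ?thesis using g(1) that by blast
qed

lemma hp_0_vanish:
  assumes "f \<in> hp 0" "f v = 0" shows "f = 0"
  using assms by (auto simp: fun_eq_iff)

text \<open>The equation of \<open>l\<close> is solved for a variable with nonzero coefficient, and
  the two other variables serve as coordinates \<open>A\<close>, \<open>B\<close> dual to the
  spanning vectors \<open>u\<close>, \<open>w\<close>.\<close>

lemma line_coordinates:
  assumes "(l :: 'k::field vec3) \<noteq> 0"
  obtains A B u w where "dot3 l u = 0" "dot3 l w = 0"
    "dot3 A u = 1" "dot3 A w = 0" "dot3 B u = 0" "dot3 B w = 1"
    "\<And>v. dot3 l v = 0 \<Longrightarrow> v = smult3 (dot3 A v) u + smult3 (dot3 B v) w"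
proof -
  have solve: "x = y * (- b / a) + z * (- c / a)" if "a * x + b * y + c * z = 0" "a \<noteq> 0" for a b c x y z :: 'k
  proof -
    have "x * a = y * (- b) + z * (- c)" using that(1) by algebra
    moreover have "x = x * a / a" using that(2) by simp
    ultimately have "x = (y * (- b) + z * (- c)) / a" by simp
    also have "\<dots> = y * (- b / a) + z * (- c / a)" by (simp only: add_divide_distrib times_divide_eq_right)
    finally show ?thesis .
  qed
  obtain a b c where l: "l = (a, b, c)" by (cases l) auto
  consider "a \<noteq> 0" | "b \<noteq> 0" | "c \<noteq> 0" using assms by (auto simp: l zero_prod_def)
  then show thesis
  proof cases
    case 1
    have "v = smult3 (dot3 (0, 1, 0) v) (- b / a, 1, 0) + smult3 (dot3 (0, 0, 1) v) (- c / a, 0, 1)"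
      if "dot3 l v = 0" for v
      using solve[of a "fst v" b "fst (snd v)" c "snd (snd v)"] 1 that
      by (simp add: l dot3_alt vec3_eq_iff)
    then show ?thesis using 1
      by (intro that[of "(- b / a, 1, 0)" "(- c / a, 0, 1)" "(0, 1, 0)" "(0, 0, 1)"])
        (auto simp: dot3_alt l)
  next
    case 2
    have "v = smult3 (dot3 (1, 0, 0) v) (1, - a / b, 0) + smult3 (dot3 (0, 0, 1) v) (0, - c / b, 1)"
      if "dot3 l v = 0" for v
      using solve[of b "fst (snd v)" a "fst v" c "snd (snd v)"] 2 that
      by (simp add: l dot3_alt vec3_eq_iff algebra_simps)
    then show ?thesis using 2
      by (intro that[of "(1, - a / b, 0)" "(0, - c / b, 1)" "(1, 0, 0)" "(0, 0, 1)"])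
        (auto simp: dot3_alt l)
  next
    case 3
    have "v = smult3 (dot3 (1, 0, 0) v) (1, 0, - a / c) + smult3 (dot3 (0, 1, 0) v) (0, 1, - b / c)"
      if "dot3 l v = 0" for v
      using solve[of c "snd (snd v)" a "fst v" b "fst (snd v)"] 3 that
      by (simp add: l dot3_alt vec3_eq_iff algebra_simps)
    then show ?thesis using 3
      by (intro that[of "(1, 0, - a / c)" "(0, 1, - b / c)" "(1, 0, 0)" "(0, 1, 0)"])
        (auto simp: dot3_alt l)
  qed
qed

text \<open>In an affine coordinate of the line, \<open>f\<close> is a polynomial of degree at most
  \<open>d\<close>, and pairwise non-proportional vectors give distinct zeros of it, more than
  \<open>d\<close> in number.\<close>

lemma bezout_line:
  fixes f :: "'k::field_char_0 vec3 \<Rightarrow> 'k"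
  assumes l: "l \<noteq> 0" and f: "f \<in> hp d" and P: "finite P" "card P > d"
    and on: "\<And>v. v \<in> P \<Longrightarrow> dot3 l v = 0 \<and> v \<noteq> 0 \<and> f v = 0"
    and prp: "\<And>v v' c. v \<in> P \<Longrightarrow> v' \<in> P \<Longrightarrow> v = smult3 c v' \<Longrightarrow> v = v'"
  shows "vanish l f"
proof -
  obtain A B u w where c: "dot3 l u = 0" "dot3 l w = 0"
    "dot3 A u = 1" "dot3 A w = 0" "dot3 B u = 0" "dot3 B w = 1"
    and rep: "\<And>v. dot3 l v = 0 \<Longrightarrow> v = smult3 (dot3 A v) u + smult3 (dot3 B v) w"
    using line_coordinates[OF l] by metis
  have "0 \<notin> (\<lambda>v. [:dot3 A v, dot3 B v:]) ` P"
  proof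
    assume "0 \<in> (\<lambda>v. [:dot3 A v, dot3 B v:]) ` P"
    then obtain v where "v \<in> P" "dot3 A v = 0" "dot3 B v = 0" by auto
    then show False using on[of v] rep[of v] by (simp add: vec3_eq_iff)
  qed
  \<comment> \<open>The form \<open>G = A + r B\<close> is to be nonzero on all of \<open>P\<close>,
    so that no point of \<open>P\<close> lies at infinity for the affine coordinate
    \<open>dot3 B v / dot3 G v\<close>.\<close>
  then obtain r where r: "\<And>v. v \<in> P \<Longrightarrow> poly [:dot3 A v, dot3 B v:] r \<noteq> 0"
    using ex_poly_nonzero[of "(\<lambda>v. [:dot3 A v, dot3 B v:]) ` P"] P(1) by auto
  define G where "G = A + smult3 r B"
  have G: "dot3 G v = dot3 A v + r * dot3 B v" for v by (simp add: G_def dot3_alt algebra_simps)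
  define z where "z = w - smult3 r u"
  have rep2: "v = smult3 (dot3 G v) u + smult3 (dot3 B v) z" if "dot3 l v = 0" for v
    using rep[OF that] by (simp add: vec3_eq_iff G z_def algebra_simps)
  have rep3: "v = smult3 (dot3 G v) (u + smult3 (dot3 B v / dot3 G v) z)"
    if "dot3 l v = 0" "dot3 G v \<noteq> 0" for v
    using rep2[OF that(1)] that(2) by (simp add: vec3_eq_iff algebra_simps)
  obtain p where p: "degree p \<le> d" "\<And>s. f (u + smult3 s z) = poly p s"
    using hp_poly_on_line[OF f] by blast
  have fv: "f v = dot3 G v ^ d * poly p (dot3 B v / dot3 G v)" if "dot3 l v = 0" "dot3 G v \<noteq> 0" for v
    using hp_homogeneous[OF f, of "dot3 G v" "u + smult3 (dot3 B v / dot3 G v) z"]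
      rep3[OF that] p(2) by simp
  have GP: "dot3 G v \<noteq> 0" if "v \<in> P" for v using r[OF that] by (simp add: G algebra_simps)
  let ?s = "\<lambda>v. dot3 B v / dot3 G v"
  have inj: "inj_on ?s P"
  proof (rule inj_onI)
    fix v v' assume vv: "v \<in> P" "v' \<in> P" "?s v = ?s v'"
    have "v' = smult3 (dot3 G v') (u + smult3 (?s v) z)"
      using rep3[of v'] vv on GP by metis
    moreover have "v = smult3 (dot3 G v) (u + smult3 (?s v) z)"
      using rep3[of v] vv on GP by metis
    ultimately have "v = smult3 (dot3 G v / dot3 G v') v'"
      using GP[OF vv(2)] by (metis nonzero_divide_eq_eq smult3_smult3)
    then show "v = v'" using prp vv by blast
  qed
  have "p = 0"
  proof (rule ccontr)
    assume "p \<noteq> 0"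
    have "?s ` P \<subseteq> {s. poly p s = 0}"
    proof
      fix s assume "s \<in> ?s ` P"
      then obtain v where "v \<in> P" "s = ?s v" by blast
      then show "s \<in> {s. poly p s = 0}" using fv[of v] on[of v] GP[of v] by simp
    qed
    then have "card (?s ` P) \<le> card {s. poly p s = 0}"
      using card_mono poly_roots_finite[OF \<open>p \<noteq> 0\<close>] by blast
    also have "\<dots> \<le> d" using card_poly_roots_bound[OF \<open>p \<noteq> 0\<close>] p(1) by simp
    finally show False using card_image[OF inj] P(2) by simp
  qed
  then have *: "f v = 0" if "dot3 l v = 0" "dot3 G v \<noteq> 0" for v using fv[OF that] by simp
  \<comment> \<open>The points with \<open>G = 0\<close> remain. If \<open>f\<close> were nonzero at
    a point of the line, then \<open>f\<close> and \<open>G\<close> would be nonzero together at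
    some point of the line, against \<open>*\<close>.\<close>
  have "dot3 G u \<noteq> 0" using c by (simp add: G)
  show ?thesis unfolding vanish_def
  proof (intro allI impI, rule ccontr)
    fix v assume v: "dot3 l v = 0" "f v \<noteq> 0"
    from hp_common_nonzero[OF f hp_dot v(2) \<open>dot3 G u \<noteq> 0\<close>] * v(1) c(1) show False by metis
  qed
qed

section \<open>Forms and gradients\<close>

definition mono3 :: "nat \<times> nat \<times> nat \<Rightarrow> 'k::field vec3 \<Rightarrow> 'k" where
  "mono3 m v = fst v ^ fst m * fst (snd v) ^ fst (snd m) * snd (snd v) ^ snd (snd m)"

lemma evalF_alt: "evalF d F v = (\<Sum>m\<in>mons d. F m * mono3 m v)"
  by (auto simp: evalF_def mono3_def split: prod.splits intro!: sum.cong)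

lemma mons_alt: "mons d = (\<lambda>(a, b). (a, b, d - a - b)) ` (SIGMA a:{..d}. {..d - a})"
  by (force simp: mons_def image_iff)

lemma finite_mons [simp]: "finite (mons d)"
  unfolding mons_alt by simp

lemma card_mons: "2 * card (mons d) = (d + 1) * (d + 2)"
proof -
  have "card (mons d) = card (SIGMA a:{..d}. {..d - a})"
    unfolding mons_alt by (intro card_image) (auto simp: inj_on_def)
  also have "\<dots> = (\<Sum>a\<le>d. Suc (d - a))" by simp
  also have "\<dots> = (\<Sum>a\<le>d. Suc a)"
    by (rule sum.reindex_bij_witness[of _ "\<lambda>a. d - a" "\<lambda>a. d - a"]) auto
  also have "2 * \<dots> = (d + 1) * (d + 2)" by (induction d) auto
  finally show ?thesis .
qed

lemma forms_eq: "forms d = supp_on (mons d)"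
  by (auto simp: forms_def supp_on_def)

lemma evalF_add: "evalF d (F + G) = evalF d F + evalF d G"
  by (auto simp: evalF_alt fun_eq_iff algebra_simps sum.distrib)

lemma evalF_scale: "evalF d (\<lambda>m. c * F m) = (\<lambda>v. c * evalF d F v)"
  by (auto simp: evalF_alt fun_eq_iff sum_distrib_left mult.assoc)

lemma mono3_hp:
  assumes "m \<in> mons d" shows "mono3 m \<in> hp d"
proof -
  obtain a b c where m: "m = (a, b, c)" "a + b + c = d" using assms by (auto simp: mons_def)
  have "(\<lambda>v. (dot3 (1, 0, 0) v ^ a * dot3 (0, 1, 0) v ^ b) * dot3 (0, 0, 1) v ^ c)
      \<in> hp ((a * 1 + b * 1) + c * 1)"
    by (intro hp_mult hp_power hp_dot)
  then show ?thesis using m by (simp add: mono3_def[abs_def] dot3_alt)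
qed

lemma hp_sum:
  assumes "\<And>i. i \<in> S \<Longrightarrow> f i \<in> hp d" shows "(\<lambda>v. \<Sum>i\<in>S. f i v) \<in> hp d"
  using assms
proof (induction S rule: infinite_finite_induct)
  case (insert x S) then show ?case using hp_add[of "f x" d "\<lambda>v. \<Sum>i\<in>S. f i v"] by simp
qed (use hp_zero in \<open>auto simp: zero_fun_def\<close>)

lemma evalF_hp: "evalF d F \<in> hp d"
proof -
  have "(\<lambda>v. \<Sum>m\<in>mons d. F m * mono3 m v) \<in> hp d"
    by (intro hp_sum hp_scale mono3_hp)
  then show ?thesis by (simp add: evalF_alt[abs_def])
qed

lemma hp_span: "hp d \<subseteq> fs.span (mono3 ` mons d)"
proof (induction d)
  case 0
  have "(\<lambda>v. c) \<in> fs.span (mono3 ` mons 0)" for c :: 'a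
  proof -
    have "(\<lambda>v. c * mono3 (0, 0, 0) v) \<in> fs.span (mono3 ` mons 0)"
      by (intro fs.span_scale fs.span_base imageI) (simp add: mons_def)
    then show ?thesis by (simp add: mono3_def)
  qed
  then show ?case by auto
next
  case (Suc d)
  have mul: "(\<lambda>v. x v * f v) \<in> fs.span (mono3 ` mons (Suc d))"
    if f: "f \<in> hp d" and x: "\<And>m. m \<in> mons d \<Longrightarrow> \<exists>m'\<in>mons (Suc d). \<forall>v. x v * mono3 m v = mono3 m' v"
    for f x :: "'a vec3 \<Rightarrow> 'a"
  proof -
    have "f \<in> fs.span (mono3 ` mons d)" using Suc f by blast
    then show ?thesis
    proof (induction rule: fs.span_induct_alt)
      case base
      have "0 \<in> fs.span (mono3 ` mons (Suc d) :: ('a vec3 \<Rightarrow> 'a) set)" by (rule fs.span_zero)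
      then show ?case by (simp add: zero_fun_def)
    next
      case (step c f g)
      then obtain m where m: "m \<in> mons d" "f = mono3 m" by blast
      obtain m' where m': "m' \<in> mons (Suc d)" "\<forall>v. x v * mono3 m v = mono3 m' v" using x[OF m(1)] by blast
      have "(\<lambda>v. x v * ((\<lambda>m. c * f m) + g) v) = (\<lambda>v. c * mono3 m' v) + (\<lambda>v. x v * g v)"
        using m(2) m'(2) by (auto simp: fun_eq_iff algebra_simps)
      also have "\<dots> \<in> fs.span (mono3 ` mons (Suc d))"
        by (intro fs.span_add fs.span_scale fs.span_base imageI m'(1) step.IH)
      finally show ?case .
    qed
  qed
  show ?case
  proof
    fix F :: "'a vec3 \<Rightarrow> 'a" assume "F \<in> hp (Suc d)"
    then obtain f g h where f: "f \<in> hp d" "g \<in> hp d" "h \<in> hp d"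
      "\<And>v. F v = fst v * f v + fst (snd v) * g v + snd (snd v) * h v" by (elim hp_SucE) blast
    have "(\<lambda>v. fst v * f v) \<in> fs.span (mono3 ` mons (Suc d))"
    proof (rule mul[OF f(1)])
      fix m assume "m \<in> mons d"
      then show "\<exists>m'\<in>mons (Suc d). \<forall>v. fst v * mono3 m v = (mono3 m' v :: 'a)"
        by (intro bexI[of _ "(Suc (fst m), snd m)"]) (auto simp: mono3_def mons_def)
    qed
    moreover have "(\<lambda>v. fst (snd v) * g v) \<in> fs.span (mono3 ` mons (Suc d))"
    proof (rule mul[OF f(2)])
      fix m assume "m \<in> mons d"
      then show "\<exists>m'\<in>mons (Suc d). \<forall>v. fst (snd v) * mono3 m v = (mono3 m' v :: 'a)"
        by (intro bexI[of _ "(fst m, Suc (fst (snd m)), snd (snd m))"]) (auto simp: mono3_def mons_def)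
    qed
    moreover have "(\<lambda>v. snd (snd v) * h v) \<in> fs.span (mono3 ` mons (Suc d))"
    proof (rule mul[OF f(3)])
      fix m assume "m \<in> mons d"
      then show "\<exists>m'\<in>mons (Suc d). \<forall>v. snd (snd v) * mono3 m v = (mono3 m' v :: 'a)"
        by (intro bexI[of _ "(fst m, fst (snd m), Suc (snd (snd m)))"]) (auto simp: mono3_def mons_def)
    qed
    ultimately have "(\<lambda>v. fst v * f v) + (\<lambda>v. fst (snd v) * g v) + (\<lambda>v. snd (snd v) * h v)
        \<in> fs.span (mono3 ` mons (Suc d))"
      by (intro fs.span_add)
    moreover have "F = (\<lambda>v. fst v * f v) + (\<lambda>v. fst (snd v) * g v) + (\<lambda>v. snd (snd v) * h v)"
      using f(4) by (simp add: fun_eq_iff)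
    ultimately show "F \<in> fs.span (mono3 ` mons (Suc d))" by (simp only:)
  qed
qed

text \<open>Together with \<open>evalF_inj\<close> this identifies forms with polynomial functions,
  so dimensions can be computed among functions.\<close>

lemma evalF_image: "evalF d ` forms d = (hp d :: ('k::field vec3 \<Rightarrow> 'k) set)"
proof
  show "evalF d ` forms d \<subseteq> (hp d :: ('k vec3 \<Rightarrow> 'k) set)" using evalF_hp by blast
  show "(hp d :: ('k vec3 \<Rightarrow> 'k) set) \<subseteq> evalF d ` forms d"
  proof
    fix f :: "'k vec3 \<Rightarrow> 'k" assume "f \<in> hp d"
    then have "f \<in> fs.span (mono3 ` mons d)" using hp_span by blast
    then show "f \<in> evalF d ` forms d"
    proof (induction rule: fs.span_induct_alt)
      case base
      have "evalF d 0 = (0 :: 'k vec3 \<Rightarrow> 'k)" by (simp add: evalF_alt fun_eq_iff)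
      moreover have "0 \<in> forms d" by (simp add: forms_def)
      ultimately show ?case by (metis imageI)
    next
      case (step c f g)
      then obtain m where m: "m \<in> mons d" "f = mono3 m" by blast
      obtain G where G: "G \<in> forms d" "g = evalF d G" using step by blast
      define F :: "nat \<times> nat \<times> nat \<Rightarrow> 'k" where "F = (\<lambda>n. (if n = m then c else 0) + G n)"
      have "F \<in> forms d" using G m by (auto simp: F_def forms_def split: if_splits)
      moreover have "evalF d F = (\<lambda>m. c * f m) + g"
      proof
        fix v
        have "evalF d F v = (\<Sum>n\<in>mons d. (if n = m then c * mono3 m v else 0) + G n * mono3 n v)"
          unfolding evalF_alt F_def by (intro sum.cong) (auto simp: algebra_simps)
        then show "evalF d F v = ((\<lambda>m. c * f m) + g) v"
          using m G(2) by (simp add: sum.distrib evalF_alt)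
      qed
      ultimately show ?case by (metis imageI)
    qed
  qed
qed

lemma evalF_inj:
  fixes F :: "nat \<times> nat \<times> nat \<Rightarrow> 'k::field_char_0"
  assumes "F \<in> forms d" "evalF d F = 0"
  shows "F = 0"
proof -
  \<comment> \<open>Kronecker substitution: on \<open>(s\<^sup>d\<^sup>+\<^sup>1, s, 1)\<close> distinct monomials become distinct powers of \<open>s\<close>.\<close>
  define e where "e m = (d + 1) * fst m + fst (snd m)" for m :: "nat \<times> nat \<times> nat"
  have inj: "m = m'" if mm: "m \<in> mons d" "m' \<in> mons d" "e m = e m'" for m m'
  proof -
    obtain a b c where m: "m = (a, b, c)" "a + b + c = d" using mm(1) by (auto simp: mons_def)
    obtain a' b' c' where m': "m' = (a', b', c')" "a' + b' + c' = d" using mm(2) by (auto simp: mons_def)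
    have "((d + 1) * a + b) div (d + 1) = a" "((d + 1) * a' + b') div (d + 1) = a'"
      using m(2) m'(2) by (simp_all only: div_mult_self4) auto
    then show ?thesis using mm(3) m m' by (auto simp: e_def)
  qed
  define p where "p = (\<Sum>m\<in>mons d. monom (F m) (e m))"
  have "poly p s = 0" for s
  proof -
    have "poly p s = evalF d F (s ^ (d + 1), s, 1)"
      unfolding p_def evalF_alt poly_sum
      by (intro sum.cong) (auto simp: poly_monom mono3_def e_def power_add power_mult power_mult_distrib)
    then show ?thesis using assms(2) by simp
  qed
  then have p0: "p = 0" using poly_all_0_iff_0 by blast
  have "F m = 0" if m: "m \<in> mons d" for m
  proof -
    have "coeff p (e m) = (\<Sum>n\<in>mons d. if n = m then F n else 0)"
      unfolding p_def coeff_sum using inj[OF _ m] by (intro sum.cong) auto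
    then show ?thesis using m p0 by simp
  qed
  then show ?thesis using assms(1) unfolding forms_def fun_eq_iff zero_fun_def by blast
qed

lemma findim_forms: "findim (forms d)"
  unfolding forms_eq by (rule dim_supp_on) simp

lemma findim_hp: "findim (hp d)"
  unfolding findim_def
  by (intro conjI hp_subspace exI[of _ "mono3 ` mons d"] hp_span finite_imageI finite_mons)

lemma dim_forms: "2 * fs.dim (forms d :: (_ \<Rightarrow> 'k::field) set) = (d + 1) * (d + 2)"
  using card_mons[of d] by (simp add: forms_eq dim_supp_on)

lemma dim_evalF:
  fixes V :: "(nat \<times> nat \<times> nat \<Rightarrow> 'k::field_char_0) set"
  assumes "V \<subseteq> forms d" "fs.subspace V"
  shows "fs.dim (evalF d ` V) = fs.dim V"
proof (rule dim_inj_image)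
  show "findim V" using findim_subset[OF findim_forms] assms by blast
qed (use assms evalF_inj evalF_add evalF_scale in blast)+

lemma dim_hp: "2 * fs.dim (hp d :: ('k::field_char_0 vec3 \<Rightarrow> 'k) set) = (d + 1) * (d + 2)"
proof -
  have "fs.dim (evalF d ` (forms d :: (_ \<Rightarrow> 'k) set)) = fs.dim (forms d :: (_ \<Rightarrow> 'k) set)"
    by (rule dim_evalF[OF order_refl findim_subspace[OF findim_forms]])
  then show ?thesis using dim_forms[of d, where 'k = 'k] unfolding evalF_image by simp
qed

text \<open>A first-order Taylor expansion along every line through \<open>v\<close> with a
  polynomial remainder: a derivative without limits, available over any field of characteristic
  zero.\<close>

definition hasgrad :: "('k::field_char_0 vec3 \<Rightarrow> 'k) \<Rightarrow> 'k vec3 \<Rightarrow> 'k vec3 \<Rightarrow> bool" where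
  "hasgrad f v g \<longleftrightarrow> (\<forall>w. \<exists>q. \<forall>s. f (v + smult3 s w) = f v + s * dot3 g w + s\<^sup>2 * poly q s)"

text \<open>The difference of two expansions is a polynomial in \<open>s\<close> that is zero
  everywhere, so its linear coefficient is zero because the field is infinite.\<close>

lemma hasgrad_unique:
  assumes "hasgrad f v g" "hasgrad f v g'"
  shows "g = g'"
proof -
  have *: "dot3 g w = dot3 g' w" for w
  proof -
    obtain q where q: "\<And>s. f (v + smult3 s w) = f v + s * dot3 g w + s\<^sup>2 * poly q s"
      using assms(1) unfolding hasgrad_def by blast
    obtain q' where q': "\<And>s. f (v + smult3 s w) = f v + s * dot3 g' w + s\<^sup>2 * poly q' s"
      using assms(2) unfolding hasgrad_def by blast
    let ?p = "[:0, dot3 g w - dot3 g' w:] + [:0, 0, 1:] * (q - q')"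
    have "poly ?p s = 0" for s using q[of s] q'[of s] by (simp add: algebra_simps power2_eq_square)
    then have "?p = 0" using poly_all_0_iff_0 by blast
    then have "coeff ?p 1 = 0" by simp
    then show ?thesis by simp
  qed
  show ?thesis using *[of "(1, 0, 0)"] *[of "(0, 1, 0)"] *[of "(0, 0, 1)"]
    by (simp add: dot3_alt vec3_eq_iff)
qed

lemma hasgrad_const: "hasgrad (\<lambda>v. c) v 0"
  unfolding hasgrad_def by (intro allI exI[of _ 0]) simp

lemma hasgrad_dot: "hasgrad (dot3 a) v a"
  unfolding hasgrad_def by (intro allI exI[of _ 0]) simp

lemma hasgrad_add:
  assumes "hasgrad f v a" "hasgrad g v b"
  shows "hasgrad (\<lambda>v. f v + g v) v (a + b)"
  unfolding hasgrad_def
proof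
  fix w
  obtain q where q: "\<And>s. f (v + smult3 s w) = f v + s * dot3 a w + s\<^sup>2 * poly q s"
    using assms(1) unfolding hasgrad_def by blast
  obtain r where r: "\<And>s. g (v + smult3 s w) = g v + s * dot3 b w + s\<^sup>2 * poly r s"
    using assms(2) unfolding hasgrad_def by blast
  show "\<exists>q. \<forall>s. f (v + smult3 s w) + g (v + smult3 s w) =
      f v + g v + s * dot3 (a + b) w + s\<^sup>2 * poly q s"
    by (intro exI[of _ "q + r"]) (simp add: q r algebra_simps dot3_commute[of _ w])
qed

lemma hasgrad_mult:
  assumes "hasgrad f v a" "hasgrad g v b"
  shows "hasgrad (\<lambda>v. f v * g v) v (smult3 (f v) b + smult3 (g v) a)"
  unfolding hasgrad_def
proof
  fix w
  obtain q where q: "\<And>s. f (v + smult3 s w) = f v + s * dot3 a w + s\<^sup>2 * poly q s"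
    using assms(1) unfolding hasgrad_def by blast
  obtain r where r: "\<And>s. g (v + smult3 s w) = g v + s * dot3 b w + s\<^sup>2 * poly r s"
    using assms(2) unfolding hasgrad_def by blast
  have D: "dot3 (smult3 (f v) b + smult3 (g v) a) w = f v * dot3 b w + g v * dot3 a w"
    by (simp add: dot3_commute[of _ w])
  define A B where "A = dot3 a w" and "B = dot3 b w"
  define Q where "Q = smult (f v) r + smult (g v) q + [:A * B:] + [:0, A:] * r + [:0, B:] * q + [:0, 0, 1:] * (q * r)"
  have "f (v + smult3 s w) * g (v + smult3 s w) = f v * g v + s * (f v * B + g v * A) + s\<^sup>2 * poly Q s" for s
    unfolding q r Q_def A_def[symmetric] B_def[symmetric] by (simp add: algebra_simps power2_eq_square)
  then show "\<exists>q. \<forall>s. f (v + smult3 s w) * g (v + smult3 s w) =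
      f v * g v + s * dot3 (smult3 (f v) b + smult3 (g v) a) w + s\<^sup>2 * poly q s"
    unfolding D A_def B_def by blast
qed

lemma hasgrad_scale:
  assumes "hasgrad f v a" shows "hasgrad (\<lambda>v. c * f v) v (smult3 c a)"
  using hasgrad_mult[OF hasgrad_const[of c] assms] by (simp add: smult3_def zero_prod_def split: prod.splits)

lemma hasgrad_sum:
  assumes "\<And>i. i \<in> S \<Longrightarrow> hasgrad (f i) v (g i)"
  shows "hasgrad (\<lambda>v. \<Sum>i\<in>S. f i v) v (\<Sum>i\<in>S. g i)"
  using assms
  by (induction S rule: infinite_finite_induct) (auto intro!: hasgrad_add hasgrad_const)

lemma hasgrad_power:
  assumes "hasgrad f v a"
  shows "hasgrad (\<lambda>v. f v ^ n) v (smult3 (of_nat n * f v ^ (n - 1)) a)"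
proof (induction n)
  case 0 show ?case using hasgrad_const[of 1 v] by (simp add: smult3_def zero_prod_def split: prod.splits)
next
  case (Suc n)
  have "smult3 (f v) (smult3 (of_nat n * f v ^ (n - 1)) a) + smult3 (f v ^ n) a
    = smult3 (of_nat (Suc n) * f v ^ (Suc n - 1)) a"
    by (cases n) (simp_all add: vec3_eq_iff algebra_simps)
  then show ?case using hasgrad_mult[OF assms Suc] by simp
qed

lemma hasgrad_mono3:
  "hasgrad (mono3 (a, b, c)) (x, y, z)
    (of_nat a * x ^ (a - 1) * y ^ b * z ^ c, of_nat b * x ^ a * y ^ (b - 1) * z ^ c,
     of_nat c * x ^ a * y ^ b * z ^ (c - 1))"
proof -
  have "hasgrad (\<lambda>v. (dot3 (1, 0, 0) v ^ a * dot3 (0, 1, 0) v ^ b) * dot3 (0, 0, 1) v ^ c) (x, y, z)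
    (of_nat a * x ^ (a - 1) * y ^ b * z ^ c, of_nat b * x ^ a * y ^ (b - 1) * z ^ c,
     of_nat c * x ^ a * y ^ b * z ^ (c - 1))"
    by (rule subst[of _ _ "hasgrad _ _",
      OF _ hasgrad_mult[OF hasgrad_mult[OF hasgrad_power[OF hasgrad_dot] hasgrad_power[OF hasgrad_dot]]
        hasgrad_power[OF hasgrad_dot]]])
      (simp add: vec3_eq_iff dot3_alt)
  then show ?thesis by (simp add: mono3_def[abs_def] dot3_alt)
qed

text \<open>The formal derivatives in the definition of \<open>I2\<close> are the components of the
  gradient, so \<open>I2 X d\<close> can be studied through gradients of functions.\<close>

lemma hasgrad_evalF: "hasgrad (evalF d F) v (dF0 d F v, dF1 d F v, dF2 d F v)"
proof -
  obtain x y z where v: "v = (x, y, z)" by (cases v) auto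
  define g where "g = (\<lambda>(a, b, c). smult3 (F (a, b, c)) (of_nat a * x ^ (a - 1) * y ^ b * z ^ c,
     of_nat b * x ^ a * y ^ (b - 1) * z ^ c, of_nat c * x ^ a * y ^ b * z ^ (c - 1)))"
  have "hasgrad (\<lambda>v. \<Sum>m\<in>mons d. F m * mono3 m v) v (\<Sum>m\<in>mons d. g m)"
  proof (rule hasgrad_sum)
    fix m show "hasgrad (\<lambda>v. F m * mono3 m v) v (g m)"
      using hasgrad_scale[OF hasgrad_mono3] by (cases m) (simp add: g_def v)
  qed
  moreover have "(\<Sum>m\<in>mons d. g m) = (dF0 d F v, dF1 d F v, dF2 d F v)"
  proof -
    have "fst (\<Sum>m\<in>mons d. g m) = dF0 d F v"
      unfolding fst_sum v dF0_def prod.case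
      by (rule sum.cong) (simp_all add: g_def case_prod_beta mult.assoc)
    moreover have "fst (snd (\<Sum>m\<in>mons d. g m)) = dF1 d F v"
      unfolding fst_sum snd_sum v dF1_def prod.case
      by (rule sum.cong) (simp_all add: g_def case_prod_beta mult.assoc)
    moreover have "snd (snd (\<Sum>m\<in>mons d. g m)) = dF2 d F v"
      unfolding snd_sum v dF2_def prod.case
      by (rule sum.cong) (simp_all add: g_def case_prod_beta mult.assoc)
    ultimately show ?thesis by (metis prod.collapse)
  qed
  ultimately show ?thesis by (simp add: evalF_alt[abs_def])
qed

text \<open>Product rule on \<open>f = x f0 + y f1 + z f2\<close>. The summands \<open>f0\<close>,
  \<open>f1\<close>, \<open>f2\<close> that arise from differentiating the coordinates add one more
  \<open>f\<close> and so raise the factor in Euler's identity from \<open>Suc d\<close> to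
  \<open>Suc (Suc d)\<close>.\<close>

lemma hp_gradient:
  fixes f :: "'k::field_char_0 vec3 \<Rightarrow> 'k"
  shows "f \<in> hp (Suc d) \<Longrightarrow> \<exists>p q r. p \<in> hp d \<and> q \<in> hp d \<and> r \<in> hp d \<and>
    (\<forall>v. hasgrad f v (p v, q v, r v) \<and> dot3 (p v, q v, r v) v = of_nat (Suc d) * f v)"
proof (induction d arbitrary: f)
  case 0
  then obtain a b c where "\<And>v. f v = fst v * a + fst (snd v) * b + snd (snd v) * c"
    by (auto elim!: hp_SucE)
  then have "f = dot3 (a, b, c)" by (auto simp: fun_eq_iff dot3_alt mult.commute)
  then show ?case using hasgrad_dot
    by (intro exI[of _ "\<lambda>v. a"] exI[of _ "\<lambda>v. b"] exI[of _ "\<lambda>v. c"]) auto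
next
  case (Suc d)
  obtain f0 f1 f2 where f: "f0 \<in> hp (Suc d)" "f1 \<in> hp (Suc d)" "f2 \<in> hp (Suc d)"
    "\<And>v. f v = fst v * f0 v + fst (snd v) * f1 v + snd (snd v) * f2 v"
    using hp_SucE[OF Suc.prems(1)] by metis
  obtain p0 q0 r0 where 0: "p0 \<in> hp d" "q0 \<in> hp d" "r0 \<in> hp d"
    "\<And>v. hasgrad f0 v (p0 v, q0 v, r0 v)" "\<And>v. dot3 (p0 v, q0 v, r0 v) v = of_nat (Suc d) * f0 v"
    using Suc.IH[OF f(1)] by metis
  obtain p1 q1 r1 where 1: "p1 \<in> hp d" "q1 \<in> hp d" "r1 \<in> hp d"
    "\<And>v. hasgrad f1 v (p1 v, q1 v, r1 v)" "\<And>v. dot3 (p1 v, q1 v, r1 v) v = of_nat (Suc d) * f1 v"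
    using Suc.IH[OF f(2)] by metis
  obtain p2 q2 r2 where 2: "p2 \<in> hp d" "q2 \<in> hp d" "r2 \<in> hp d"
    "\<And>v. hasgrad f2 v (p2 v, q2 v, r2 v)" "\<And>v. dot3 (p2 v, q2 v, r2 v) v = of_nat (Suc d) * f2 v"
    using Suc.IH[OF f(3)] by metis
  define p where "p v = (fst v * p0 v + fst (snd v) * p1 v + snd (snd v) * p2 v) + f0 v" for v
  define q where "q v = (fst v * q0 v + fst (snd v) * q1 v + snd (snd v) * q2 v) + f1 v" for v
  define r where "r v = (fst v * r0 v + fst (snd v) * r1 v + snd (snd v) * r2 v) + f2 v" for v
  have "p \<in> hp (Suc d)" "q \<in> hp (Suc d)" "r \<in> hp (Suc d)"
    unfolding p_def q_def r_def
    by (intro hp_add f hp_SucI[OF 0(1) 1(1) 2(1)] hp_SucI[OF 0(2) 1(2) 2(2)] hp_SucI[OF 0(3) 1(3) 2(3)] refl)+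
  moreover have "hasgrad f v (p v, q v, r v)" for v
  proof -
    have "f = (\<lambda>v. (dot3 (1, 0, 0) v * f0 v + dot3 (0, 1, 0) v * f1 v) + dot3 (0, 0, 1) v * f2 v)"
      using f(4) by (simp add: fun_eq_iff dot3_alt)
    moreover have "hasgrad \<dots> v (p v, q v, r v)"
      by (rule subst[of _ _ "hasgrad _ _",
        OF _ hasgrad_add[OF hasgrad_add[OF hasgrad_mult[OF hasgrad_dot 0(4)] hasgrad_mult[OF hasgrad_dot 1(4)]]
          hasgrad_mult[OF hasgrad_dot 2(4)]]])
        (simp add: vec3_eq_iff dot3_alt p_def q_def r_def)
    ultimately show ?thesis by metis
  qed
  moreover have "dot3 (p v, q v, r v) v = of_nat (Suc (Suc d)) * f v" for v
  proof -
    have "dot3 (p v, q v, r v) v = fst v * dot3 (p0 v, q0 v, r0 v) v + fst (snd v) * dot3 (p1 v, q1 v, r1 v) v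
      + snd (snd v) * dot3 (p2 v, q2 v, r2 v) v + f v"
      by (simp add: p_def q_def r_def f(4) dot3_alt algebra_simps)
    also have "\<dots> = of_nat (Suc (Suc d)) * f v"
      unfolding 0(5) 1(5) 2(5) by (simp add: f(4)[of v] algebra_simps)
    finally show ?thesis .
  qed
  ultimately show ?case by blast
qed

section \<open>Singular points and counting conditions\<close>

lemma hp_hasgrad:
  assumes "f \<in> hp d" obtains g where "hasgrad f v g" "dot3 g v = of_nat d * f v"
proof (cases d)
  case 0
  then obtain c where f: "f = (\<lambda>v. c)" using assms by auto
  show ?thesis by (rule that[of 0]) (use 0 in \<open>simp_all add: f hasgrad_const\<close>)
next
  case (Suc e)
  then show ?thesis using hp_gradient[of f e] assms that by blast
qed

definition grad :: "('k::field_char_0 vec3 \<Rightarrow> 'k) \<Rightarrow> 'k vec3 \<Rightarrow> 'k vec3" where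
  "grad f v = (THE g. hasgrad f v g)"

lemma grad_eq: "hasgrad f v g \<Longrightarrow> grad f v = g"
  unfolding grad_def using hasgrad_unique by blast

lemma hasgrad_grad: "f \<in> hp d \<Longrightarrow> hasgrad f v (grad f v)"
  using hp_hasgrad grad_eq by metis

lemma euler: "f \<in> hp d \<Longrightarrow> dot3 (grad f v) v = of_nat d * f v"
  using hp_hasgrad grad_eq by metis

definition sing :: "('k::field_char_0 vec3 \<Rightarrow> 'k) \<Rightarrow> 'k vec3 \<Rightarrow> bool" where
  "sing f v \<longleftrightarrow> f v = 0 \<and> hasgrad f v 0"

lemma sing_add: "sing f v \<Longrightarrow> sing g v \<Longrightarrow> sing (\<lambda>v. f v + g v) v"
  unfolding sing_def using hasgrad_add[of f v 0 g 0] by auto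

lemma smult3_zero [simp]: "smult3 c 0 = 0" "smult3 0 v = 0"
  by (simp_all add: vec3_eq_iff)

lemma sing_scale: "sing f v \<Longrightarrow> sing (\<lambda>v. c * f v) v"
  unfolding sing_def using hasgrad_scale[of f v 0 c] by auto

lemma sing_mult:
  assumes "sing f v" "g \<in> hp b" shows "sing (\<lambda>v. f v * g v) v"
  using assms hasgrad_mult[OF _ hasgrad_grad[OF assms(2)], of f v 0]
  by (simp add: sing_def)

lemma sing_mult_zeros:
  assumes "f \<in> hp a" "g \<in> hp b" "f v = 0" "g v = 0" shows "sing (\<lambda>v. f v * g v) v"
  using assms hasgrad_mult[OF hasgrad_grad[OF assms(1)] hasgrad_grad[OF assms(2)], of v]
  by (simp add: sing_def)

text \<open>At a zero of \<open>g\<close> the product has gradient \<open>f v\<close> times the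
  gradient of \<open>g\<close>, and \<open>f v\<close> can be cancelled.\<close>

lemma sing_cancel:
  assumes "f \<in> hp a" "g \<in> hp b" "sing (\<lambda>v. f v * g v) v" "f v \<noteq> 0" shows "sing g v"
proof -
  have g0: "g v = 0" using assms(3,4) by (simp add: sing_def)
  have "hasgrad (\<lambda>v. f v * g v) v (smult3 (f v) (grad g v))"
    using hasgrad_mult[OF hasgrad_grad[OF assms(1)] hasgrad_grad[OF assms(2)], of v] g0 by simp
  then have "smult3 (f v) (grad g v) = 0"
    using assms(3) hasgrad_unique unfolding sing_def by blast
  then have "grad g v = 0" using assms(4) by (simp add: vec3_eq_iff)
  then show ?thesis using g0 hasgrad_grad[OF assms(2), of v] by (simp add: sing_def)
qed

text \<open>Being singular is a property of the projective point: by homogeneity the expansion at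
  \<open>smult3 c v\<close> is the one at \<open>v\<close> with the parameter \<open>s\<close>
  replaced by \<open>s / c\<close>, up to a constant.\<close>

lemma sing_smult:
  assumes "f \<in> hp d" "sing f v" "c \<noteq> 0" shows "sing f (smult3 c v)"
proof -
  have "\<exists>q. \<forall>s. f (smult3 c v + smult3 s w) = s\<^sup>2 * poly q s" for w
  proof -
    obtain q where q: "\<And>s. f (v + smult3 s w) = s\<^sup>2 * poly q s"
      using assms(2) unfolding sing_def hasgrad_def by (metis (no_types) add_0 dot3_zero(2) mult_zero_right)
    have "f (smult3 c v + smult3 s w) = s\<^sup>2 * poly (smult (c ^ d / c\<^sup>2) (pcompose q [:0, 1 / c:])) s" for s
    proof -
      have "smult3 c v + smult3 s w = smult3 c (v + smult3 (s / c) w)"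
        using assms(3) by (simp add: vec3_eq_iff algebra_simps)
      then have "f (smult3 c v + smult3 s w) = c ^ d * ((s / c)\<^sup>2 * poly q (s / c))"
        using hp_homogeneous[OF assms(1)] q by metis
      then show ?thesis by (simp add: poly_pcompose power_divide)
    qed
    then show ?thesis by blast
  qed
  moreover have "f (smult3 c v) = 0" using hp_homogeneous[OF assms(1)] assms(2) by (simp add: sing_def)
  ultimately show ?thesis by (simp add: sing_def hasgrad_def)
qed

section \<open>Representatives of points and lines\<close>

lemma mem_pt: "w \<in> pt v \<longleftrightarrow> (\<exists>c. c \<noteq> 0 \<and> w = smult3 c v)"
  by (auto simp: pt_def)

lemma pt_smult: "c \<noteq> 0 \<Longrightarrow> pt (smult3 c v) = pt v"
proof (intro set_eqI)
  fix w assume c: "c \<noteq> 0"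
  have "w = smult3 b v \<Longrightarrow> w = smult3 (b / c) (smult3 c v)" for b using c by (simp add: smult3_smult3)
  then show "w \<in> pt (smult3 c v) \<longleftrightarrow> w \<in> pt v"
    unfolding mem_pt using c by (metis divide_eq_0_iff mult_eq_0_iff smult3_smult3)
qed

text \<open>By homogeneity, conditions on all vectors of a point can be tested at this single
  one.\<close>

definition rp :: "'k::field vec3 set \<Rightarrow> 'k vec3" where
  "rp p = (SOME v. v \<in> p)"

lemma pt_self: "v \<in> pt v"
  unfolding mem_pt by (intro exI[of _ 1]) simp

lemma rp_pt:
  obtains c where "c \<noteq> 0" "rp (pt v) = smult3 c v"
proof -
  have "rp (pt v) \<in> pt v" unfolding rp_def by (rule someI[of _ v]) (rule pt_self)
  then show ?thesis using that unfolding mem_pt by blast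
qed

lemma rp_P2:
  assumes "p \<in> P2"
  shows "pt (rp p) = p" "rp p \<noteq> 0"
proof -
  obtain v where v: "p = pt v" "v \<noteq> 0" using assms by (auto simp: P2_def zero_vec3)
  obtain c where "c \<noteq> 0" "rp p = smult3 c v" using rp_pt v(1) by metis
  then show "pt (rp p) = p" "rp p \<noteq> 0" using v pt_smult[of c v] by (simp_all, auto simp: vec3_eq_iff)
qed

lemma rp_unique:
  assumes "p \<in> P2" "q \<in> P2" "rp p = smult3 c (rp q)" shows "p = q"
proof -
  have "c \<noteq> 0" using rp_P2(2)[OF assms(1)] assms(3) by auto
  then show ?thesis using rp_P2(1) assms pt_smult by metis
qed

lemma inj_rp: "inj_on rp P2"
  by (rule inj_on_inverseI[of _ pt]) (rule rp_P2(1))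

lemma pt_in_P2: "v \<noteq> 0 \<Longrightarrow> pt v \<in> P2"
  unfolding P2_def zero_vec3 by blast

lemma hp_zero_on_point:
  assumes "f \<in> hp d" "p \<in> P2" shows "(\<forall>v\<in>p. f v = 0) \<longleftrightarrow> f (rp p) = 0"
  using rp_P2(1)[OF assms(2)] hp_homogeneous[OF assms(1)] mem_pt[of _ "rp p"] pt_self[of "rp p"]
  by (metis mult_zero_right)

lemma hp_sing_on_point:
  assumes "f \<in> hp d" "p \<in> P2" shows "(\<forall>v\<in>p. sing f v) \<longleftrightarrow> sing f (rp p)"
  using rp_P2(1)[OF assms(2)] sing_smult[OF assms(1)] mem_pt[of _ "rp p"] pt_self[of "rp p"]
  by metis

lemma on_line_iff:
  assumes "p \<in> P2" "L \<in> P2" shows "on_line p L \<longleftrightarrow> dot3 (rp L) (rp p) = 0"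
proof
  assume "on_line p L" then show "dot3 (rp L) (rp p) = 0"
    using rp_P2(1)[OF assms(1)] rp_P2(1)[OF assms(2)] pt_self unfolding on_line_def by metis
next
  assume *: "dot3 (rp L) (rp p) = 0"
  show "on_line p L" unfolding on_line_def
  proof (intro ballI)
    fix a v assume "a \<in> L" "v \<in> p"
    then obtain b c where "a = smult3 b (rp L)" "v = smult3 c (rp p)"
      using rp_P2(1)[OF assms(1)] rp_P2(1)[OF assms(2)] mem_pt by metis
    then show "dot3 a v = 0" using * by simp
  qed
qed

text \<open>For \<open>X \<subseteq> P2\<close>, \<open>J1 X d\<close> and \<open>J2 X d\<close> are
  the images of \<open>I1 X d\<close> and \<open>I2 X d\<close> under \<open>evalF d\<close>; see
  \<open>hilbX_eq\<close> and \<open>hilbZ_eq\<close>.\<close>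

definition J1 :: "'k::field_char_0 vec3 set set \<Rightarrow> nat \<Rightarrow> ('k vec3 \<Rightarrow> 'k) set" where
  "J1 X d = {f \<in> hp d. \<forall>p\<in>X. f (rp p) = 0}"

definition J2 :: "'k::field_char_0 vec3 set set \<Rightarrow> nat \<Rightarrow> ('k vec3 \<Rightarrow> 'k) set" where
  "J2 X d = {f \<in> hp d. \<forall>p\<in>X. sing f (rp p)}"

lemma J1_subspace: "fs.subspace (J1 X d)"
  using findim_subspace[OF findim_hp] unfolding J1_def fs.subspace_def by auto

lemma J2_subspace: "fs.subspace (J2 X d)"
proof -
  have "sing 0 v" for v :: "'a vec3" using hasgrad_const[of 0 v] by (simp add: sing_def zero_fun_def)
  then show ?thesis
    using hp_subspace[of d, where 'a = 'a] sing_add sing_scale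
    unfolding J2_def fs.subspace_def plus_fun_def by blast
qed

lemma findim_J1: "findim (J1 X d)"
  by (rule findim_subset[OF findim_hp J1_subspace]) (auto simp: J1_def)

lemma findim_J2: "findim (J2 X d)"
  by (rule findim_subset[OF findim_hp J2_subspace]) (auto simp: J2_def)

lemma dim_evalF_preimage:
  fixes W :: "('k::field_char_0 vec3 \<Rightarrow> 'k) set"
  assumes "fs.subspace W" "W \<subseteq> hp d"
  shows "fs.dim {F \<in> forms d. evalF d F \<in> W} = fs.dim W"
proof -
  let ?V = "{F \<in> forms d. evalF d F \<in> W}"
  have "evalF d 0 = (0 :: 'k vec3 \<Rightarrow> 'k)" by (simp add: evalF_alt fun_eq_iff)
  then have "fs.subspace ?V"
    using assms(1) findim_subspace[OF findim_forms[of d, where 'a = 'k]]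
    unfolding fs.subspace_def mem_Collect_eq evalF_add evalF_scale by simp
  moreover have "evalF d ` ?V = W"
    using evalF_image[of d, where 'k = 'k] assms(2) by force
  ultimately show ?thesis using dim_evalF[of ?V d] by simp
qed

lemma hilbX_eq:
  assumes "X \<subseteq> P2"
  shows "hilbX X d = fs.dim (hp d :: ('k::field_char_0 vec3 \<Rightarrow> 'k) set) - fs.dim (J1 X d :: ('k vec3 \<Rightarrow> 'k) set)"
proof -
  have "I1 X d = {F \<in> forms d. evalF d F \<in> (J1 X d :: ('k vec3 \<Rightarrow> 'k) set)}"
  proof (rule set_eqI)
    fix F :: "nat \<times> nat \<times> nat \<Rightarrow> 'k"
    have "(\<forall>v\<in>p. evalF d F v = 0) \<longleftrightarrow> evalF d F (rp p) = 0" if "p \<in> X" for p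
      using hp_zero_on_point[OF evalF_hp] assms that by blast
    then show "F \<in> I1 X d \<longleftrightarrow> F \<in> {F \<in> forms d. evalF d F \<in> J1 X d}"
      by (simp add: I1_def J1_def evalF_hp)
  qed
  then have "kdim (I1 X d) = fs.dim (J1 X d :: ('k vec3 \<Rightarrow> 'k) set)"
    using dim_evalF_preimage[OF J1_subspace, of X d] unfolding kdim_def J1_def by auto
  moreover have "kdim (forms d :: (_ \<Rightarrow> 'k) set) = fs.dim (hp d :: ('k vec3 \<Rightarrow> 'k) set)"
    using dim_forms[of d, where 'k = 'k] dim_hp[of d, where 'k = 'k] unfolding kdim_def by simp
  ultimately show ?thesis by (simp add: hilbX_def)
qed

lemma sing_evalF:
  "sing (evalF d F) v \<longleftrightarrow> evalF d F v = 0 \<and> dF0 d F v = 0 \<and> dF1 d F v = 0 \<and> dF2 d F v = 0"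
  using hasgrad_evalF[of d F v] hasgrad_unique[of "evalF d F" v] unfolding sing_def
  by (metis zero_vec3 prod.inject)

lemma hilbZ_eq:
  assumes "X \<subseteq> P2"
  shows "hilbZ X d = fs.dim (hp d :: ('k::field_char_0 vec3 \<Rightarrow> 'k) set) - fs.dim (J2 X d :: ('k vec3 \<Rightarrow> 'k) set)"
proof -
  have "I2 X d = {F \<in> forms d. evalF d F \<in> (J2 X d :: ('k vec3 \<Rightarrow> 'k) set)}"
  proof (rule set_eqI)
    fix F :: "nat \<times> nat \<times> nat \<Rightarrow> 'k"
    have "(\<forall>v\<in>p. sing (evalF d F) v) \<longleftrightarrow> sing (evalF d F) (rp p)" if "p \<in> X" for p
      using hp_sing_on_point[OF evalF_hp] assms that by blast
    then show "F \<in> I2 X d \<longleftrightarrow> F \<in> {F \<in> forms d. evalF d F \<in> J2 X d}"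
      unfolding I2_def sing_evalF[symmetric] by (simp add: J2_def evalF_hp)
  qed
  then have "kdim (I2 X d) = fs.dim (J2 X d :: ('k vec3 \<Rightarrow> 'k) set)"
    using dim_evalF_preimage[OF J2_subspace, of X d] unfolding kdim_def J2_def by auto
  moreover have "kdim (forms d :: (_ \<Rightarrow> 'k) set) = fs.dim (hp d :: ('k vec3 \<Rightarrow> 'k) set)"
    using dim_forms[of d, where 'k = 'k] dim_hp[of d, where 'k = 'k] unfolding kdim_def by simp
  ultimately show ?thesis by (simp add: hilbZ_def)
qed

section \<open>Evaluation at simple and at double points\<close>

definition ev :: "'k::field_char_0 vec3 set set \<Rightarrow> ('k vec3 \<Rightarrow> 'k) \<Rightarrow> 'k vec3 set \<Rightarrow> 'k" where
  "ev X f = (\<lambda>p. if p \<in> X then f (rp p) else 0)"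

lemma dim_J1:
  fixes X :: "'k::field_char_0 vec3 set set"
  assumes "finite X"
  shows "fs.dim (hp d :: ('k vec3 \<Rightarrow> 'k) set) = fs.dim (J1 X d) + fs.dim (ev X ` hp d)"
    and "findim (ev X ` hp d)" and "ev X ` hp d \<subseteq> supp_on X"
proof -
  have K: "{f \<in> hp d. ev X f = 0} = J1 X d" by (auto simp: J1_def ev_def fun_eq_iff)
  have a: "ev X (f + g) = ev X f + ev X g" "ev X (\<lambda>m. c * f m) = (\<lambda>m. c * ev X f m)" for f g c
    by (auto simp: ev_def fun_eq_iff)
  show "fs.dim (hp d :: ('k vec3 \<Rightarrow> 'k) set) = fs.dim (J1 X d) + fs.dim (ev X ` hp d)"
    using rank_nullity(1)[of "hp d" "ev X", OF findim_hp a] unfolding K .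
  show "findim (ev X ` hp d)" by (rule rank_nullity(3)[OF findim_hp a])
  show "ev X ` hp d \<subseteq> supp_on X" by (auto simp: ev_def supp_on_def split: if_splits)
qed

lemma dim_J1_sep:
  fixes X :: "'k::field_char_0 vec3 set set"
  assumes "finite X"
    and sep: "\<And>p. p \<in> X \<Longrightarrow> \<exists>f\<in>hp d. f (rp p) \<noteq> 0 \<and> (\<forall>q\<in>X. q \<noteq> p \<longrightarrow> f (rp q) = 0)"
  shows "fs.dim (hp d :: ('k vec3 \<Rightarrow> 'k) set) = fs.dim (J1 X d) + card X"
proof -
  have "card X \<le> fs.dim (ev X ` hp d)"
  proof (rule card_le_dim[OF dim_J1(2)[OF assms(1)] assms(1)])
    fix p assume p: "p \<in> X"
    obtain f where "f \<in> hp d" "f (rp p) \<noteq> 0" "\<forall>q\<in>X. q \<noteq> p \<longrightarrow> f (rp q) = 0" using sep[OF p] by blast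
    then show "\<exists>f\<in>ev X ` hp d. f p \<noteq> 0 \<and> (\<forall>b'\<in>X. b' \<noteq> p \<longrightarrow> f b' = 0)"
      using p by (intro bexI[of _ "ev X f"]) (auto simp: ev_def)
  qed
  moreover have "fs.dim (ev X ` hp d) \<le> card X"
    using dim_mono[OF dim_supp_on(2)[OF assms(1)] dim_J1(3)[OF assms(1)]] dim_supp_on(1)[OF assms(1)] by metis
  ultimately show ?thesis using dim_J1(1)[OF assms(1), of d] by simp
qed

definition coord3 :: "nat \<Rightarrow> 'k vec3 \<Rightarrow> 'k" where
  "coord3 i v = (if i = 0 then fst v else if i = 1 then fst (snd v) else snd (snd v))"

text \<open>Three partial derivatives per point. In positive degree Euler's identity recovers the
  value from them, which makes \<open>J2\<close> the kernel.\<close>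

definition ev2 :: "'k::field_char_0 vec3 set set \<Rightarrow> ('k vec3 \<Rightarrow> 'k) \<Rightarrow> 'k vec3 set \<times> nat \<Rightarrow> 'k" where
  "ev2 X f = (\<lambda>(p, i). if p \<in> X \<and> i < 3 then coord3 i (grad f (rp p)) else 0)"

lemma dim_J2:
  fixes X :: "'k::field_char_0 vec3 set set"
  assumes "finite X"
  shows "fs.dim (hp (Suc d) :: ('k vec3 \<Rightarrow> 'k) set) = fs.dim (J2 X (Suc d)) + fs.dim (ev2 X ` hp (Suc d))"
    and "findim (ev2 X ` hp (Suc d))" and "fs.dim (ev2 X ` hp (Suc d)) \<le> 3 * card X"
proof -
  let ?V = "hp (Suc d) :: ('k vec3 \<Rightarrow> 'k) set"
  have K: "{f \<in> ?V. ev2 X f = 0} = J2 X (Suc d)"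
  proof -
    have "(\<forall>p\<in>X. sing f (rp p)) \<longleftrightarrow> ev2 X f = 0" if f: "f \<in> ?V" for f
    proof -
      have "sing f v \<longleftrightarrow> grad f v = 0" for v
        using hasgrad_grad[OF f, of v] euler[OF f, of v] grad_eq[of f v 0] by (auto simp: sing_def simp del: of_nat_Suc)
      moreover have "grad f v = 0 \<longleftrightarrow> (\<forall>i<3. coord3 i (grad f v) = 0)" for v
        by (auto simp: coord3_def vec3_eq_iff numeral_3_eq_3 less_Suc_eq)
      ultimately show ?thesis by (auto simp: ev2_def fun_eq_iff)
    qed
    then show ?thesis by (auto simp: J2_def)
  qed
  have a: "ev2 X (f + g) = ev2 X f + ev2 X g" if "f \<in> ?V" "g \<in> ?V" for f g
  proof -
    have "grad (f + g) v = grad f v + grad g v" for v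
      unfolding plus_fun_def[of f g] by (rule grad_eq[OF hasgrad_add[OF hasgrad_grad hasgrad_grad]]) (rule that)+
    then show ?thesis by (auto simp: ev2_def coord3_def fun_eq_iff)
  qed
  have s: "ev2 X (\<lambda>m. c * f m) = (\<lambda>m. c * ev2 X f m)" if "f \<in> ?V" for f c
  proof -
    have "grad (\<lambda>m. c * f m) v = smult3 c (grad f v)" for v
      by (rule grad_eq[OF hasgrad_scale[OF hasgrad_grad]]) (rule that)
    then show ?thesis by (auto simp: ev2_def coord3_def fun_eq_iff)
  qed
  show "fs.dim ?V = fs.dim (J2 X (Suc d)) + fs.dim (ev2 X ` ?V)"
    using rank_nullity(1)[of ?V "ev2 X", OF findim_hp a s] unfolding K .
  show "findim (ev2 X ` ?V)" by (rule rank_nullity(3)[OF findim_hp a s])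
  have fin: "finite (X \<times> {..<3::nat})" using assms by simp
  have "ev2 X ` ?V \<subseteq> supp_on (X \<times> {..<3})" by (auto simp: ev2_def supp_on_def split: if_splits)
  then have "fs.dim (ev2 X ` ?V) \<le> card (X \<times> {..<3::nat})"
    using dim_mono[OF dim_supp_on(2)[OF fin]] dim_supp_on(1)[OF fin] by metis
  then show "fs.dim (ev2 X ` ?V) \<le> 3 * card X" by (simp add: card_cartesian_product)
qed

text \<open>Taking for \<open>b\<close> the three unit vectors gives functions dual to the
  \<open>3 * card X\<close> conditions, which are therefore independent.\<close>

lemma dim_J2_sep:
  fixes X :: "'k::field_char_0 vec3 set set"
  assumes "finite X"
    and sep: "\<And>p b. p \<in> X \<Longrightarrow> \<exists>f\<in>hp (Suc d). hasgrad f (rp p) b \<and> (\<forall>q\<in>X. q \<noteq> p \<longrightarrow> sing f (rp q))"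
  shows "fs.dim (hp (Suc d) :: ('k vec3 \<Rightarrow> 'k) set) = fs.dim (J2 X (Suc d)) + 3 * card X"
proof -
  have fin: "finite (X \<times> {..<3::nat})" using assms by simp
  have "card (X \<times> {..<3::nat}) \<le> fs.dim (ev2 X ` hp (Suc d))"
  proof (rule card_le_dim[OF dim_J2(2)[OF assms(1)] fin])
    fix b assume "b \<in> X \<times> {..<3::nat}"
    then obtain p i where b: "b = (p, i)" "p \<in> X" "i < 3" by auto
    define e :: "'k vec3" where "e = (if i = 0 then 1 else 0, if i = 1 then 1 else 0, if i = 2 then 1 else 0)"
    obtain f where f: "f \<in> hp (Suc d)" "hasgrad f (rp p) e" "\<forall>q\<in>X. q \<noteq> p \<longrightarrow> sing f (rp q)"
      using sep[OF b(2)] by blast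
    have "grad f (rp p) = e" "\<And>q. q \<in> X \<Longrightarrow> q \<noteq> p \<Longrightarrow> grad f (rp q) = 0"
      using f(2,3) grad_eq unfolding sing_def by blast+
    then have "ev2 X f b \<noteq> 0" "\<forall>b'\<in>X \<times> {..<3}. b' \<noteq> b \<longrightarrow> ev2 X f b' = 0"
      using b by (auto simp: ev2_def coord3_def e_def) fastforce+
    then show "\<exists>f\<in>ev2 X ` hp (Suc d). f b \<noteq> 0 \<and> (\<forall>b'\<in>X \<times> {..<3}. b' \<noteq> b \<longrightarrow> f b' = 0)"
      using f(1) by blast
  qed
  then show ?thesis
    using dim_J2(1,3)[OF assms(1), of d] by (simp add: card_cartesian_product)
qed

section \<open>Growth of the space of singular forms\<close>

text \<open>In the one-parameter family \<open>(1, c, c\<^sup>2)\<close> incidence with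
  \<open>v\<close> is a polynomial equation in \<open>c\<close> whose coefficients are the
  coordinates of \<open>v\<close>, so each \<open>v\<close> excludes finitely many
  \<open>c\<close>.\<close>

lemma ex_avoiding_line:
  fixes S :: "'k::field_char_0 vec3 set"
  assumes "finite S" "0 \<notin> S"
  obtains c where "\<And>v. v \<in> S \<Longrightarrow> dot3 (1, c, c\<^sup>2) v \<noteq> 0"
proof -
  let ?p = "\<lambda>v :: 'k vec3. [:fst v, fst (snd v), snd (snd v):]"
  have "0 \<notin> ?p ` S" using assms(2) by (auto simp: zero_prod_def)
  then obtain c where "\<And>v. v \<in> S \<Longrightarrow> poly (?p v) c \<noteq> 0"
    using ex_poly_nonzero[of "?p ` S"] assms(1) by auto
  then show ?thesis
    by (intro that[of c]) (auto simp: dot3_alt algebra_simps power2_eq_square)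
qed

text \<open>Restriction to the affine part \<open>z = 1\<close> of the line
  \<open>(1, c, c\<^sup>2)\<close>, parametrized by the second coordinate.\<close>

definition restr :: "'k::field_char_0 \<Rightarrow> ('k vec3 \<Rightarrow> 'k) \<Rightarrow> 'k \<Rightarrow> 'k" where
  "restr c f = (\<lambda>s. f (- c * s - c\<^sup>2, s, 1))"

lemma restr_eq_0:
  assumes f: "f \<in> hp d" and 0: "restr c f = 0"
  shows "vanish (1, c, c\<^sup>2) f"
  unfolding vanish_def
proof (intro allI impI, rule ccontr)
  fix v assume v: "dot3 (1, c, c\<^sup>2) v = 0" "f v \<noteq> 0"
  \<comment> \<open>The parametrization misses the point of the line with third coordinate zero, so
    \<open>v\<close> is first moved along the line to a point \<open>w\<close> where this coordinate
    and \<open>f\<close> are both nonzero.\<close>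
  have "dot3 (0, 0, 1) (- c\<^sup>2, 0, 1 :: 'a) \<noteq> 0" by (simp add: dot3_def)
  from hp_common_nonzero[OF f hp_dot v(2) this]
  obtain w where w: "f w \<noteq> 0" "dot3 (0, 0, 1) w \<noteq> 0"
    "\<And>l. dot3 l v = 0 \<Longrightarrow> dot3 l (- c\<^sup>2, 0, 1) = 0 \<Longrightarrow> dot3 l w = 0" by blast
  have "dot3 (1, c, c\<^sup>2) w = 0" using w(3)[of "(1, c, c\<^sup>2)"] v(1) by (simp add: dot3_alt)
  then have fw: "fst w = - c * fst (snd w) - c\<^sup>2 * snd (snd w)"
    by (simp add: dot3_alt eq_neg_iff_add_eq_0 algebra_simps)
  have nz: "snd (snd w) \<noteq> 0" using w(2) by (simp add: dot3_alt)
  define s where "s = fst (snd w) / snd (snd w)"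
  have "w = smult3 (snd (snd w)) (- c * s - c\<^sup>2, s, 1)"
    using nz fw by (simp add: vec3_eq_iff s_def algebra_simps)
  then have "f w = snd (snd w) ^ d * restr c f s"
    using hp_homogeneous[OF f] unfolding restr_def by metis
  then show False using 0 w(1) by simp
qed

lemma restr_poly:
  assumes "f \<in> hp d" obtains p where "restr c f = poly p"
proof -
  obtain p where "\<And>s. f ((- c\<^sup>2, 0, 1) + smult3 s (- c, 1, 0)) = poly p s"
    using hp_poly_on_line[OF assms] by blast
  then show ?thesis by (intro that[of p]) (auto simp: restr_def smult3_def algebra_simps fun_eq_iff)
qed

lemma findim_restr: "findim (restr c ` J2 X d)"
  by (rule rank_nullity(3)[OF findim_J2]) (auto simp: restr_def fun_eq_iff)

text \<open>The kernel of the restriction consists of the multiples of the line. As the line avoids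
  \<open>X\<close>, the cofactor is again singular along \<open>X\<close>, so the kernel is a copy
  of \<open>J2 X d\<close>.\<close>

lemma dim_J2_Suc:
  fixes X :: "'k::field_char_0 vec3 set set"
  assumes c: "\<And>p. p \<in> X \<Longrightarrow> dot3 (1, c, c\<^sup>2) (rp p) \<noteq> 0"
  shows "fs.dim (J2 X (Suc d)) = fs.dim (J2 X d) + fs.dim (restr c ` J2 X (Suc d))"
proof -
  let ?l = "(1, c, c\<^sup>2) :: 'k vec3"
  have l0: "?l \<noteq> 0" by (simp add: zero_prod_def)
  have K: "{f \<in> J2 X (Suc d). restr c f = 0} = (\<lambda>f v. dot3 ?l v * f v) ` J2 X d"
  proof (intro equalityI subsetI)
    fix f assume f: "f \<in> {f \<in> J2 X (Suc d). restr c f = 0}"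
    then have fh: "f \<in> hp (Suc d)" by (simp add: J2_def)
    obtain g where g: "g \<in> hp d" "\<And>v. f v = dot3 ?l v * g v"
      using hp_divide_line[OF l0 fh] restr_eq_0[OF fh] f by blast
    have fg: "f = (\<lambda>v. dot3 ?l v * g v)" using g(2) by blast
    have "sing g (rp p)" if "p \<in> X" for p
      using sing_cancel[OF hp_dot g(1) _ c[OF that]] f that unfolding fg J2_def by blast
    then have "g \<in> J2 X d" using g(1) by (simp add: J2_def)
    then show "f \<in> (\<lambda>f v. dot3 ?l v * f v) ` J2 X d" using fg by blast
  next
    fix f assume "f \<in> (\<lambda>f v. dot3 ?l v * f v) ` J2 X d"
    then obtain g where g: "g \<in> J2 X d" "f = (\<lambda>v. dot3 ?l v * g v)" by blast
    have "restr c f = 0" by (auto simp: g(2) restr_def fun_eq_iff dot3_def power2_eq_square algebra_simps)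
    moreover have "sing f (rp p)" if "p \<in> X" for p
      using sing_mult[OF _ hp_dot, of g "rp p" ?l] g that by (simp add: J2_def mult.commute)
    ultimately show "f \<in> {f \<in> J2 X (Suc d). restr c f = 0}"
      using g hp_dot_mult[of g d ?l] by (simp add: J2_def)
  qed
  have "fs.dim ((\<lambda>f v. dot3 ?l v * f v) ` J2 X d) = fs.dim (J2 X d)"
  proof (rule dim_inj_image[OF findim_J2])
    fix f assume f: "f \<in> J2 X d" "(\<lambda>v. dot3 ?l v * f v) = 0"
    have "dot3 ?l = 0 \<or> f = 0"
      by (rule hp_mult_eq_0[OF hp_dot, of f d]) (use f in \<open>auto simp: J2_def fun_eq_iff\<close>)
    moreover have "dot3 ?l (1, 0, 0) = 1" by (simp add: dot3_def)
    ultimately show "f = 0" by auto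
  qed (auto simp: fun_eq_iff algebra_simps)
  moreover have "fs.dim (J2 X (Suc d)) =
      fs.dim {f \<in> J2 X (Suc d). restr c f = 0} + fs.dim (restr c ` J2 X (Suc d))"
    by (rule rank_nullity(1)[OF findim_J2]) (auto simp: restr_def fun_eq_iff)
  ultimately show ?thesis using K by simp
qed

text \<open>The restrictions W of J2 X d to a line satisfy W + sW <= restrictions of J2 X (d + 1),
  and W <= sW is impossible for a nonzero space of polynomials (consider an element of minimal degree).\<close>

lemma restr_growth:
  fixes X :: "'k::field_char_0 vec3 set set"
  assumes pos: "0 < fs.dim (restr c ` J2 X d)"
  shows "fs.dim (restr c ` J2 X d) < fs.dim (restr c ` J2 X (Suc d))"
proof (rule ccontr)
  let ?W = "restr c ` J2 X d" and ?W' = "restr c ` J2 X (Suc d)"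
  assume *: "\<not> fs.dim ?W < fs.dim ?W'"
  let ?M = "\<lambda>g s. s * g s :: 'k"
  have mult: "(\<lambda>v. dot3 a v * f v) \<in> J2 X (Suc d)" if "f \<in> J2 X d" for a f
    using that hp_dot_mult[of f d a] sing_mult[OF _ hp_dot, of f _ a] by (auto simp: J2_def mult.commute)
  have sub: "?W \<subseteq> ?W'"
  proof
    fix g assume "g \<in> ?W"
    then obtain f where f: "f \<in> J2 X d" "g = restr c f" by blast
    \<comment> \<open>On the parametrized line the third coordinate is 1 and the second is
      \<open>s\<close>; multiplication by them gives the inclusions of \<open>W\<close> and of
      \<open>sW\<close>.\<close>
    have "g = restr c (\<lambda>v. dot3 (0, 0, 1) v * f v)" by (simp add: f(2) restr_def dot3_def)
    then show "g \<in> ?W'" using mult[OF f(1)] by blast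
  qed
  have subM: "?M ` ?W \<subseteq> ?W'"
  proof
    fix g assume "g \<in> ?M ` ?W"
    then obtain f where f: "f \<in> J2 X d" "g = ?M (restr c f)" by blast
    have "g = restr c (\<lambda>v. dot3 (0, 1, 0) v * f v)" by (simp add: f(2) restr_def dot3_def)
    then show "g \<in> ?W'" using mult[OF f(1)] by blast
  qed
  have poly: "\<exists>p. g = poly p" if "g \<in> ?W" for g
    using that restr_poly[of _ d c] by (auto simp: J2_def) metis
  have "fs.dim (?M ` ?W) = fs.dim ?W"
  proof (rule dim_inj_image[OF findim_restr])
    fix g assume g: "g \<in> ?W" "?M g = 0"
    obtain p where p: "g = poly p" using poly[OF g(1)] by blast
    have "poly ([:0, 1:] * p) s = 0" for s using g(2) p by (auto simp: fun_eq_iff)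
    then have "[:0, 1:] * p = 0" using poly_all_0_iff_0 by blast
    then show "g = 0" using p by (auto simp: fun_eq_iff)
  qed (auto simp: fun_eq_iff algebra_simps)
  moreover have "findim (?M ` ?W)"
    by (rule rank_nullity(3)[OF findim_restr]) (auto simp: fun_eq_iff algebra_simps)
  ultimately have "?M ` ?W = ?W'"
    using dim_eq_subspace[OF findim_restr findim_subspace subM] * by simp
  then have WM: "?W \<subseteq> ?M ` ?W" using sub by simp
  obtain g0 where g0: "g0 \<in> ?W" "g0 \<noteq> 0"
  proof -
    have "?W \<noteq> {0}" using pos dim_zero[where 'k = 'k and 'i = 'k] by auto
    then show ?thesis using that fs.subspace_0[OF findim_subspace[OF findim_restr[of c X d]]] by blast
  qed
  define P where "P p \<longleftrightarrow> poly p \<in> ?W \<and> p \<noteq> 0" for p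
  obtain p0 where p0: "g0 = poly p0" using poly[OF g0(1)] by blast
  then have "p0 \<noteq> 0" using g0(2) by (auto simp: fun_eq_iff)
  then have "P p0" using g0(1) p0 by (simp add: P_def)
  then obtain p where p: "P p" "\<And>q. P q \<Longrightarrow> degree p \<le> degree q"
    using arg_min_natI[of P p0 degree] arg_min_nat_le[of P _ degree] by metis
  obtain g where g: "g \<in> ?W" "poly p = ?M g" using WM p(1) by (auto simp: P_def)
  obtain q where q: "g = poly q" using poly[OF g(1)] by blast
  have "poly (p - [:0, 1:] * q) s = 0" for s using g(2) q by (simp add: fun_eq_iff)
  then have pq: "p = [:0, 1:] * q" using poly_all_0_iff_0 by (metis eq_iff_diff_eq_0)
  then have "q \<noteq> 0" using p(1) by (auto simp: P_def)
  then have "P q" "degree p = Suc (degree q)" using pq g(1) q by (auto simp: P_def)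
  then show False using p(2) by fastforce
qed

text \<open>If \<open>C i\<close> exceeded \<open>1 + ... + i\<close>, some increment would satisfy
  \<open>W j > j\<close>; strict growth would preserve this for all later indices and make
  \<open>C n\<close> too large. If \<open>C 1\<close> is positive, growth gives
  \<open>W k \<ge> k\<close> for \<open>k \<ge> 1\<close>, so the upper bounds are attained.\<close>

lemma triangular_bound:
  fixes C W :: "nat \<Rightarrow> nat"
  assumes Suc: "\<And>d. C (Suc d) = C d + W (Suc d)" and grow: "\<And>d. 0 < W d \<Longrightarrow> W d < W (Suc d)"
    and C0: "C 0 = 0" and Cn: "2 * C n = n * (n + 1)"
  shows "i \<le> n \<Longrightarrow> 2 * C i \<le> i * (i + 1)"
    and "0 < C 1 \<Longrightarrow> i \<le> n \<Longrightarrow> 2 * C i = i * (i + 1)"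
proof -
  have bound: "2 * C i \<le> i * (i + 1)" if "i \<le> n" for i
  proof (rule ccontr)
    assume *: "\<not> 2 * C i \<le> i * (i + 1)"
    have "\<exists>j. 0 < j \<and> j \<le> i \<and> W j > j"
    proof (rule ccontr)
      assume **: "\<not> (\<exists>j. 0 < j \<and> j \<le> i \<and> W j > j)"
      have "k \<le> i \<Longrightarrow> 2 * C k \<le> k * (k + 1)" for k
      proof (induction k)
        case (Suc k)
        have "W (Suc k) \<le> Suc k" using ** Suc.prems by force
        then show ?case using Suc by (simp add: assms(1))
      qed (simp add: C0)
      then show False using * by blast
    qed
    then obtain j where j: "j \<le> i" "W j > j" by blast
    have Wk: "W k > k" if "j \<le> k" for k
      using that
    proof (induction k rule: dec_induct)
      case (step k) then show ?case using grow[of k] by linarith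
    qed (rule j(2))
    have "2 * C k > k * (k + 1)" if "i \<le> k" for k
      using that
    proof (induction k rule: dec_induct)
      case (step k) then show ?case using Wk[of "Suc k"] j(1) Suc[of k] by simp
    qed (use * in simp)
    then show False using that Cn by fastforce
  qed
  show "i \<le> n \<Longrightarrow> 2 * C i \<le> i * (i + 1)" by (rule bound)
  assume C1: "0 < C 1" and i: "i \<le> n"
  have W: "W (Suc k) \<ge> Suc k" for k
  proof (induction k)
    case 0 then show ?case using C1 Suc[of 0] C0 by simp
  next
    case (Suc k) then show ?case using grow[of "Suc k"] by linarith
  qed
  have "2 * C k \<ge> k * (k + 1)" for k
  proof (induction k)
    case (Suc k) then show ?case using W[of k] assms(1)[of k] by simp
  qed simp
  then show "2 * C i = i * (i + 1)" using bound[OF i] by (metis le_antisym)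
qed

text \<open>The common setting for the sets \<open>X\<close> of part (b) and for the crossings of
  \<open>n + 2\<close> general lines; see \<open>config_of_Delta\<close> and
  \<open>config_crossings\<close>.\<close>

locale config =
  fixes X :: "'k::field_char_0 vec3 set set" and n :: nat
  assumes fin: "finite X" and sub: "X \<subseteq> P2" and card: "2 * card X = (n + 1) * (n + 2)"
    and J1: "J1 X n = {0}"
begin

lemma rp_nz: "p \<in> X \<Longrightarrow> rp p \<noteq> 0"
  using sub rp_P2(2) by blast

text \<open>Evaluation at \<open>X\<close> is injective on \<open>hp n\<close> as
  \<open>J1 X n\<close> is zero. Both sides have dimension \<open>card X\<close>, so it is also
  onto.\<close>

lemma separator:
  assumes p: "p \<in> X"
  obtains f where "f \<in> hp n" "f (rp p) = 1" "\<And>q. q \<in> X \<Longrightarrow> q \<noteq> p \<Longrightarrow> f (rp q) = 0"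
proof -
  have "fs.dim (supp_on X :: (_ \<Rightarrow> 'k) set) \<le> fs.dim (ev X ` hp n)"
    using dim_J1(1)[OF fin, of n] J1 card dim_hp[of n, where 'k = 'k] dim_supp_on(1)[OF fin, where 'k = 'k]
    by (simp add: dim_zero)
  then have "ev X ` hp n = supp_on X"
    using dim_eq_subspace[OF dim_supp_on(2)[OF fin] findim_subspace[OF dim_J1(2)[OF fin]] dim_J1(3)[OF fin]]
    by blast
  moreover have "(\<lambda>q. if q = p then 1 else 0 :: 'k) \<in> supp_on X" using p by (auto simp: supp_on_def)
  ultimately obtain f where f: "f \<in> hp n" "(\<lambda>q. if q = p then 1 else 0) = ev X f" by (metis (no_types, lifting) imageE)
  have "f (rp q) = (if q = p then 1 else 0)" if "q \<in> X" for q
    using fun_cong[OF f(2), of q] that by (simp add: ev_def)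
  then show ?thesis using p f(1) that by auto
qed

text \<open>The square of a separator, padded by a power of a linear form that is 1 at
  \<open>p\<close>, is a form \<open>g\<close> with \<open>g = 1\<close> at \<open>p\<close> that is
  singular at the other points. Multiplying by one more linear form produces any prescribed gradient
  at \<open>p\<close>, which accounts for the degree \<open>2 * n + 1\<close>.\<close>

lemma dim_J2_high:
  assumes d: "d \<ge> 2 * n + 1"
  shows "fs.dim (hp d :: ('k vec3 \<Rightarrow> 'k) set) = fs.dim (J2 X d) + 3 * card X"
proof -
  obtain e where e: "d = Suc e" "e \<ge> 2 * n" using d by (cases d) auto
  show ?thesis unfolding e(1)
  proof (rule dim_J2_sep[OF fin])
    fix p and b :: "'k vec3" assume p: "p \<in> X"
    obtain f where f: "f \<in> hp n" "f (rp p) = 1" "\<And>q. q \<in> X \<Longrightarrow> q \<noteq> p \<Longrightarrow> f (rp q) = 0"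
      using separator[OF p] by metis
    obtain m where "dot3 (rp p) m = 1" using ex_dot3_eq_1[OF rp_nz[OF p]] .
    then have m: "dot3 m (rp p) = 1" by (simp add: dot3_commute)
    define g where "g v = (f v * f v) * dot3 m v ^ (e - 2 * n)" for v
    have mh: "(\<lambda>v. dot3 m v ^ (e - 2 * n)) \<in> hp (e - 2 * n)"
      using hp_power[OF hp_dot, of m "e - 2 * n"] by simp
    have g: "g \<in> hp e"
      using hp_mult[OF hp_mult[OF f(1) f(1)] mh] e(2) by (simp add: g_def[abs_def])
    have gp: "g (rp p) = 1" by (simp add: g_def f(2) m)
    have gs: "sing g (rp q)" if "q \<in> X" "q \<noteq> p" for q
      using sing_mult[OF sing_mult_zeros[OF f(1) f(1) f(3)[OF that] f(3)[OF that]] mh]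
      by (simp add: g_def[abs_def])
    define \<gamma> where "\<gamma> = grad g (rp p)"
    have eul: "dot3 \<gamma> (rp p) = of_nat e" using euler[OF g, of "rp p"] gp by (simp add: \<gamma>_def)
    \<comment> \<open>The product rule demands \<open>a + a(P) \<gamma> = b\<close>, writing
      \<open>a(P)\<close> for the value of the form \<open>a\<close> at \<open>rp p\<close>. Pairing
      with \<open>rp p\<close> and using Euler's identity \<open>eul\<close> gives
      \<open>(e + 1) a(P) = b(P)\<close>, so \<open>a(P)\<close> has to be \<open>c\<close>.\<close>
    define c where "c = dot3 b (rp p) / of_nat (Suc e)"
    define a where "a = b - smult3 c \<gamma>"
    have "dot3 a (rp p) = dot3 b (rp p) - c * of_nat e"
      using eul by (simp add: a_def dot3_commute[of _ "rp p"])
    also have "dot3 b (rp p) = c * of_nat (Suc e)" unfolding c_def by (simp del: of_nat_Suc)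
    finally have ap: "dot3 a (rp p) = c" by (simp add: algebra_simps)
    have "hasgrad (\<lambda>v. dot3 a v * g v) (rp p) b"
      using hasgrad_mult[OF hasgrad_dot[of a] hasgrad_grad[OF g], of "rp p"] gp ap
      by (simp add: \<gamma>_def[symmetric] a_def)
    moreover have "sing (\<lambda>v. dot3 a v * g v) (rp q)" if "q \<in> X" "q \<noteq> p" for q
      using sing_mult[OF gs[OF that] hp_dot, of a] by (simp add: mult.commute)
    ultimately show "\<exists>f\<in>hp (Suc e). hasgrad f (rp p) b \<and> (\<forall>q\<in>X. q \<noteq> p \<longrightarrow> sing f (rp q))"
      using hp_dot_mult[OF g, of a] by blast
  qed
qed

text \<open>The three partial derivatives lie in \<open>J1 X n\<close>, hence are zero, and Euler's
  identity returns \<open>f\<close>.\<close>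

lemma J2_low: "J2 X (Suc n) = {0}"
proof -
  have "f = 0" if f: "f \<in> J2 X (Suc n)" for f
  proof -
    have fh: "f \<in> hp (Suc n)" using f by (simp add: J2_def)
    obtain p q r where g: "p \<in> hp n" "q \<in> hp n" "r \<in> hp n" "\<And>v. hasgrad f v (p v, q v, r v)"
      "\<And>v. dot3 (p v, q v, r v) v = of_nat (Suc n) * f v"
      using hp_gradient[OF fh] by metis
    have "(p (rp x), q (rp x), r (rp x)) = 0" if "x \<in> X" for x
      using f that g(4)[of "rp x"] hasgrad_unique unfolding J2_def sing_def by blast
    then have "p \<in> J1 X n" "q \<in> J1 X n" "r \<in> J1 X n" using g(1-3) by (auto simp: J1_def zero_prod_def)
    then have "p = 0" "q = 0" "r = 0" using J1 by auto
    then have "of_nat (Suc n) * f v = 0" for v using g(5)[of v] by (simp add: dot3_alt del: of_nat_Suc)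
    then have "f v = 0" for v by (metis mult_eq_0_iff of_nat_eq_0_iff nat.distinct(1))
    then show ?thesis by (simp add: fun_eq_iff)
  qed
  then show ?thesis using fs.subspace_0[OF J2_subspace, of X "Suc n"] by auto
qed

text \<open>\<open>triangular_bound\<close> for the dimensions counted from degree
  \<open>n + 1\<close>, where there are no singular forms, up to degree \<open>2 * n + 1\<close>,
  where the dimension is known.\<close>

lemma J2_bounds:
  shows "i \<le> n \<Longrightarrow> 2 * fs.dim (J2 X (Suc n + i)) \<le> i * (i + 1)"
    and "0 < fs.dim (J2 X (Suc n + 1)) \<Longrightarrow> i \<le> n \<Longrightarrow> 2 * fs.dim (J2 X (Suc n + i)) = i * (i + 1)"
    and "d \<le> Suc n \<Longrightarrow> fs.dim (J2 X d) = 0"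
proof -
  have nz: "0 \<notin> rp ` X" using rp_nz by force
  obtain c where "\<And>v. v \<in> rp ` X \<Longrightarrow> dot3 (1, c, c\<^sup>2) v \<noteq> 0"
    using ex_avoiding_line[OF finite_imageI[OF fin] nz] by metis
  then have c: "\<And>p. p \<in> X \<Longrightarrow> dot3 (1, c, c\<^sup>2) (rp p) \<noteq> 0" by blast
  define C where "C i = fs.dim (J2 X (Suc n + i))" for i
  define W where "W i = fs.dim (restr c ` J2 X (Suc n + i))" for i
  have Suc: "C (Suc i) = C i + W (Suc i)" for i using dim_J2_Suc[OF c] by (simp add: C_def W_def)
  have grow: "0 < W i \<Longrightarrow> W i < W (Suc i)" for i using restr_growth[of c X "Suc n + i"] by (simp add: W_def)
  have C0: "C 0 = 0" using J2_low by (simp add: C_def dim_zero)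
  \<comment> \<open>Twice the dimension in degree \<open>2 * n + 1\<close> is
    \<open>(2n + 2)(2n + 3) - 3(n + 1)(n + 2) = n(n + 1)\<close>.\<close>
  have "2 * fs.dim (hp (Suc n + n) :: ('k vec3 \<Rightarrow> 'k) set) = 2 * C n + 3 * (2 * card X)"
    using dim_J2_high[of "Suc n + n"] by (simp add: C_def)
  then have Cn: "2 * C n = n * (n + 1)"
    unfolding dim_hp card by (simp add: algebra_simps)
  note B = triangular_bound[of C W n, OF Suc grow C0 Cn]
  show "i \<le> n \<Longrightarrow> 2 * fs.dim (J2 X (Suc n + i)) \<le> i * (i + 1)"
    using B(1)[of i] by (simp add: C_def)
  show "0 < fs.dim (J2 X (Suc n + 1)) \<Longrightarrow> i \<le> n \<Longrightarrow> 2 * fs.dim (J2 X (Suc n + i)) = i * (i + 1)"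
    using B(2)[of i] by (simp add: C_def)
  have mono: "fs.dim (J2 X d) \<le> fs.dim (J2 X (d + j))" for d j
  proof (induction j)
    case (Suc j) then show ?case using dim_J2_Suc[OF c, where d = "d + j"] by simp
  qed simp
  show "fs.dim (J2 X d) = 0" if "d \<le> Suc n"
    using mono[of d "Suc n - d"] that J2_low by (simp add: dim_zero)
qed

end

section \<open>Points and lines\<close>

text \<open>Points and lines are both elements of \<open>P2\<close> and the relation is symmetric,
  so each statement about two lines also serves for two points.\<close>

definition inc :: "'k::field vec3 set \<Rightarrow> 'k vec3 set \<Rightarrow> bool" where
  "inc L p \<longleftrightarrow> dot3 (rp L) (rp p) = 0"

lemma inc_commute: "inc L p = inc p L"
  by (simp add: inc_def dot3_commute)

lemma not_subset_line:
  fixes L M :: "'k::field_char_0 vec3 set"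
  assumes "L \<in> P2" "M \<in> P2" "vanish (rp L) (dot3 (rp M))"
  shows "L = M"
proof -
  have "dot3 (rp M) \<in> hp (Suc 0)" using hp_dot[of "rp M"] by simp
  then obtain g where "g \<in> hp 0" and g: "\<And>v. dot3 (rp M) v = dot3 (rp L) v * g v"
    using hp_divide_line[OF rp_P2(2)[OF assms(1)] _ assms(3)] by metis
  then obtain c where "g = (\<lambda>v. c)" by auto
  then have "rp M = smult3 c (rp L)"
    using g[of "(1, 0, 0)"] g[of "(0, 1, 0)"] g[of "(0, 0, 1)"] by (simp add: dot3_alt vec3_eq_iff mult.commute)
  then show ?thesis using rp_unique[OF assms(2,1)] by blast
qed

text \<open>Used in dual form as well, for the line through two points.\<close>

lemma meet_point:
  fixes L M :: "'k::field_char_0 vec3 set"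
  assumes L: "L \<in> P2" and M: "M \<in> P2" and "L \<noteq> M"
  obtains p where "p \<in> P2" "inc L p" "inc M p" "\<And>q. q \<in> P2 \<Longrightarrow> inc L q \<Longrightarrow> inc M q \<Longrightarrow> q = p"
proof -
  obtain A B u w where c: "dot3 (rp L) u = 0" "dot3 (rp L) w = 0"
    "dot3 A u = 1" "dot3 A w = 0" "dot3 B u = 0" "dot3 B w = 1"
    and rep: "\<And>v. dot3 (rp L) v = 0 \<Longrightarrow> v = smult3 (dot3 A v) u + smult3 (dot3 B v) w"
    using line_coordinates[OF rp_P2(2)[OF L]] by metis
  define mu mw where "mu = dot3 (rp M) u" and "mw = dot3 (rp M) w"
  have M_rep: "dot3 (rp M) v = dot3 A v * mu + dot3 B v * mw" if "dot3 (rp L) v = 0" for v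
  proof -
    have "dot3 (rp M) v = dot3 (rp M) (smult3 (dot3 A v) u + smult3 (dot3 B v) w)"
      using rep[OF that] by simp
    then show ?thesis by (simp add: mu_def mw_def)
  qed
  have nz: "mu \<noteq> 0 \<or> mw \<noteq> 0"
  proof (rule ccontr)
    assume "\<not> (mu \<noteq> 0 \<or> mw \<noteq> 0)"
    then have "vanish (rp L) (dot3 (rp M))" using M_rep by (simp add: vanish_def)
    then show False using not_subset_line assms by blast
  qed
  \<comment> \<open>In the coordinates \<open>A\<close>, \<open>B\<close> of \<open>L\<close> the
    form of \<open>M\<close> is \<open>mu A + mw B\<close>; up to scaling its zero is
    \<open>(mw, - mu)\<close>.\<close>
  define v where "v = smult3 mw u - smult3 mu w"
  have Av: "dot3 A v = mw" "dot3 B v = - mu" by (simp_all add: v_def c)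
  have Lv: "dot3 (rp L) v = 0" by (simp add: v_def c)
  have Mv: "dot3 (rp M) v = 0" by (simp add: v_def mu_def mw_def)
  have "v \<noteq> 0" using Av nz by auto
  have uniq: "\<exists>c. x = smult3 c v" if x: "dot3 (rp L) x = 0" "dot3 (rp M) x = 0" for x
  proof (cases "mw = 0")
    case True
    then have "dot3 A x = 0" using M_rep[OF x(1)] x(2) nz by simp
    then have "x = smult3 (dot3 B x) w" using rep[OF x(1)] by simp
    then have "x = smult3 (- dot3 B x / mu) v" using True nz by (simp add: v_def vec3_eq_iff)
    then show ?thesis by blast
  next
    case False
    have "dot3 B x = - (dot3 A x / mw) * mu"
      using M_rep[OF x(1)] x(2) False by (simp add: field_simps eq_neg_iff_add_eq_0)
    then have "x = smult3 (dot3 A x / mw) v"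
      using rep[OF x(1)] False by (simp add: v_def vec3_eq_iff algebra_simps)
    then show ?thesis by blast
  qed
  obtain c where c: "c \<noteq> 0" "rp (pt v) = smult3 c v" using rp_pt .
  have p: "pt v \<in> P2" using \<open>v \<noteq> 0\<close> pt_in_P2 by blast
  show ?thesis
  proof (rule that[OF p])
    show "inc L (pt v)" "inc M (pt v)" by (simp_all add: inc_def c Lv Mv)
    fix q assume q: "q \<in> P2" "inc L q" "inc M q"
    then obtain b where "rp q = smult3 b v" using uniq unfolding inc_def by blast
    then have "rp q = smult3 (b / c) (rp (pt v))" using c by (simp add: smult3_smult3)
    then show "q = pt v" using rp_unique[OF q(1) p] by blast
  qed
qed

lemma inc_unique:
  fixes L M :: "'k::field_char_0 vec3 set"
  assumes "L \<in> P2" "M \<in> P2" "L \<noteq> M" "p \<in> P2" "q \<in> P2" "inc L p" "inc M p" "inc L q" "inc M q"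
  shows "p = q"
  using meet_point[OF assms(1-3)] assms(4-9) by metis

lemma bezout_points:
  fixes f :: "'k::field_char_0 vec3 \<Rightarrow> 'k"
  assumes "L \<in> P2" "f \<in> hp d" "finite P" "P \<subseteq> P2" "card P > d"
    and "\<And>p. p \<in> P \<Longrightarrow> inc L p \<and> f (rp p) = 0"
  shows "vanish (rp L) f"
proof (rule bezout_line[OF rp_P2(2)[OF assms(1)] assms(2)])
  show "finite (rp ` P)" using assms(3) by simp
  have "inj_on rp P" by (rule inj_on_subset[OF inj_rp assms(4)])
  then show "card (rp ` P) > d" using assms(5) by (simp add: card_image)
next
  fix v assume "v \<in> rp ` P"
  then obtain p where p: "p \<in> P" "v = rp p" by (elim imageE)
  have "p \<in> P2" using p(1) assms(4) by blast
  then show "dot3 (rp L) v = 0 \<and> v \<noteq> 0 \<and> f v = 0"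
    using assms(6)[OF p(1)] rp_P2(2)[of p] p(2) by (simp add: inc_def)
next
  fix v v' c assume "v \<in> rp ` P" "v' \<in> rp ` P" "v = smult3 c v'"
  moreover from this obtain p q where pq: "p \<in> P" "q \<in> P" "v = rp p" "v' = rp q" by (elim imageE)
  moreover from pq have "p \<in> P2" "q \<in> P2" using assms(4) by auto
  ultimately show "v = v'" using rp_unique[of p q c] by simp
qed

text \<open>Lines are divided off one at a time; a different line does not vanish on the removed
  one, so the remaining lines still divide the quotient, whose degree has dropped by one.\<close>

lemma card_lines_le:
  fixes f :: "'k::field_char_0 vec3 \<Rightarrow> 'k"
  assumes "finite S" "S \<subseteq> P2" "f \<in> hp d" "f \<noteq> 0" "\<And>L. L \<in> S \<Longrightarrow> vanish (rp L) f"
  shows "card S \<le> d"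
  using assms
proof (induction d arbitrary: f S)
  case 0
  have "S = {}"
  proof (rule ccontr)
    assume "S \<noteq> {}"
    then obtain L where "L \<in> S" by blast
    then have "f 0 = 0" using "0.prems"(5) unfolding vanish_def by (metis dot3_zero(1))
    then show False using hp_0_vanish "0.prems"(3,4) by blast
  qed
  then show ?case by simp
next
  case (Suc d)
  show ?case
  proof (cases "S = {}")
    case False
    then obtain L where L: "L \<in> S" by blast
    then have LP: "L \<in> P2" using Suc.prems by blast
    obtain g where g: "g \<in> hp d" "\<And>v. f v = dot3 (rp L) v * g v"
      using hp_divide_line[OF rp_P2(2)[OF LP] Suc.prems(3) Suc.prems(5)[OF L]] by metis
    have fg: "f = (\<lambda>v. dot3 (rp L) v * g v)" using g(2) by blast
    have "card (S - {L}) \<le> d"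
    proof (rule Suc.IH[OF _ _ g(1)])
      show "g \<noteq> 0" using fg Suc.prems(4) by (auto simp: zero_fun_def)
      fix M assume M: "M \<in> S - {L}"
      then have "vanish (rp M) (dot3 (rp L)) \<or> vanish (rp M) g"
        using vanish_mult[OF hp_dot g(1)] Suc.prems(5)[of M] fg by blast
      then show "vanish (rp M) g" using not_subset_line[of M L] M LP Suc.prems(2) by blast
    qed (use Suc.prems in auto)
    then show ?thesis using L Suc.prems(1) by (simp add: card_Diff_singleton)
  qed simp
qed

section \<open>Lines in general position and their crossings\<close>

definition general :: "'k::field vec3 set set \<Rightarrow> bool" where
  "general S \<longleftrightarrow> finite S \<and> S \<subseteq> P2 \<and> (\<forall>L\<in>S. \<forall>M\<in>S. \<forall>K\<in>S. L \<noteq> M \<and> L \<noteq> K \<and> M \<noteq> K \<longrightarrow>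
     \<not> (\<exists>p\<in>P2. inc L p \<and> inc M p \<and> inc K p))"

definition crossings :: "'k::field vec3 set set \<Rightarrow> 'k vec3 set set" where
  "crossings S = {p \<in> P2. \<exists>L\<in>S. \<exists>M\<in>S. L \<noteq> M \<and> inc L p \<and> inc M p}"

text \<open>Translates the indexed families of the theorem into sets of lines, which suit the
  counting arguments better.\<close>

lemma good_lines_iff:
  "good_lines t lam \<longleftrightarrow> inj_on lam {..<t} \<and> general (lam ` {..<t})"
proof -
  have on: "on_line p (lam i) = inc (lam i) p" if "p \<in> P2" "lam i \<in> P2" for p i
    using on_line_iff[OF that] by (simp add: inc_def)
  have d: "lam i \<noteq> lam j \<longleftrightarrow> i \<noteq> j" if "inj_on lam {..<t}" "i < t" "j < t" for i j
    using that by (auto simp: inj_on_def)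
  show ?thesis
  proof (cases "inj_on lam {..<t} \<and> (\<forall>i<t. lam i \<in> P2)")
    case True
    then show ?thesis using on d unfolding good_lines_def general_def
      by (simp add: image_subset_iff cong: conj_cong) (simp add: Ball_def)
  qed (auto simp: good_lines_def general_def)
qed

lemma cross_pts_eq:
  assumes "good_lines t lam" shows "cross_pts t lam = crossings (lam ` {..<t})"
proof -
  have P: "lam i \<in> P2" if "i < t" for i using assms that by (simp add: good_lines_def)
  have on: "on_line p (lam i) = inc (lam i) p" if "p \<in> P2" "i < t" for p i
    using on_line_iff[OF that(1) P[OF that(2)]] by (simp add: inc_def)
  have d: "lam i \<noteq> lam j \<longleftrightarrow> i \<noteq> j" if "i < t" "j < t" for i j
    using that assms by (auto simp: inj_on_def good_lines_def)
  show ?thesis unfolding cross_pts_def crossings_def using on d by (auto simp: Bex_def) blast+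
qed

lemma card_pairs: "finite S \<Longrightarrow> 2 * card {T. T \<subseteq> S \<and> card T = 2} = card S * (card S - 1)"
proof -
  have "2 * (m * (m - 1) div 2) = m * (m - 1)" for m :: nat
    by (intro dvd_mult_div_cancel) (cases m; simp)
  then show "finite S \<Longrightarrow> 2 * card {T. T \<subseteq> S \<and> card T = 2} = card S * (card S - 1)"
    by (simp add: n_subsets choose_two)
qed

text \<open>Each crossing is the only common point of some pair of lines, so the pairs map onto the
  crossings.\<close>

lemma card_crossings_le:
  fixes S :: "'k::field_char_0 vec3 set set"
  assumes "finite S" "S \<subseteq> P2"
  shows "finite (crossings S)" "2 * card (crossings S) \<le> card S * (card S - 1)"
proof -
  define m where "m T = (SOME p. p \<in> P2 \<and> (\<forall>L\<in>T. inc L p))" for T :: "'k vec3 set set"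
  let ?Q = "{T. T \<subseteq> S \<and> card T = 2}"
  have "crossings S \<subseteq> m ` ?Q"
  proof
    fix p assume "p \<in> crossings S"
    then obtain L M where p: "p \<in> P2" "L \<in> S" "M \<in> S" "L \<noteq> M" "inc L p" "inc M p"
      by (auto simp: crossings_def)
    have "m {L, M} \<in> P2 \<and> (\<forall>K\<in>{L, M}. inc K (m {L, M}))"
      unfolding m_def by (rule someI[of _ p]) (use p in auto)
    then have "m {L, M} = p" using inc_unique[of L M "m {L, M}" p] p assms(2) by blast
    then show "p \<in> m ` ?Q" using p by (intro image_eqI[of _ _ "{L, M}"]) auto
  qed
  moreover have "finite ?Q" using assms(1) by simp
  ultimately show "finite (crossings S)" "2 * card (crossings S) \<le> card S * (card S - 1)"
    using card_pairs[OF assms(1)] surj_card_le[of ?Q "crossings S" m] finite_surj[of ?Q "crossings S" m] by auto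
qed

text \<open>On each line the other \<open>n + 1\<close> lines cut out distinct points, since no
  three lines are concurrent. A form of degree \<open>n\<close> through all crossings thus contains
  all \<open>n + 2\<close> lines and is zero. Injectivity of the evaluation bounds the number of
  crossings below by the dimension of \<open>hp n\<close>, and the number of pairs of lines bounds
  it above by the same value.\<close>

lemma config_crossings:
  fixes S :: "'k::field_char_0 vec3 set set"
  assumes S: "general S" and card: "card S = n + 2"
  shows "config (crossings S) n"
proof -
  have fS: "finite S" "S \<subseteq> P2" using S by (auto simp: general_def)
  note fin = card_crossings_le(1)[OF fS]
  have J: "J1 (crossings S) n = {0}"
  proof -
    have "f = 0" if f: "f \<in> J1 (crossings S) n" for f
    proof (rule ccontr)
      assume nz: "f \<noteq> 0"
      have "vanish (rp L) f" if L: "L \<in> S" for L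
      proof -
        have "\<exists>p. p \<in> P2 \<and> inc L p \<and> inc M p" if "M \<in> S - {L}" for M
        proof -
          have "L \<in> P2" "M \<in> P2" "L \<noteq> M" using L that fS(2) by auto
          from meet_point[OF this] show ?thesis by metis
        qed
        then have "\<forall>M\<in>S - {L}. \<exists>p. p \<in> P2 \<and> inc L p \<and> inc M p" by blast
        from bchoice[OF this] obtain m where
          m: "\<And>M. M \<in> S - {L} \<Longrightarrow> m M \<in> P2 \<and> inc L (m M) \<and> inc M (m M)" by blast
        have inj: "inj_on m (S - {L})"
        proof (rule inj_onI, rule ccontr)
          fix M K assume *: "M \<in> S - {L}" "K \<in> S - {L}" "m M = m K" "M \<noteq> K"
          then have "m M \<in> P2 \<and> inc L (m M) \<and> inc M (m M) \<and> inc K (m M)" using m by metis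
          moreover have "L \<in> S" "M \<in> S" "K \<in> S" "L \<noteq> M" "L \<noteq> K" using * L by auto
          ultimately show False using S *(4) unfolding general_def by blast
        qed
        show ?thesis
        proof (rule bezout_points)
          show "L \<in> P2" using L fS by blast
          show "f \<in> hp n" using f by (simp add: J1_def)
          show "finite (m ` (S - {L}))" "m ` (S - {L}) \<subseteq> P2" using fS m by auto
          show "n < card (m ` (S - {L}))" using card_image[OF inj] L fS card by simp
          fix p assume "p \<in> m ` (S - {L})"
          then obtain M where M: "M \<in> S - {L}" "p = m M" by blast
          then have "p \<in> crossings S" using m L unfolding crossings_def by blast
          then show "inc L p \<and> f (rp p) = 0" using f M m by (auto simp: J1_def)
        qed
      qed
      then have "card S \<le> n" using card_lines_le[OF fS _ nz] f by (simp add: J1_def)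
      then show False using card by simp
    qed
    then show ?thesis using fs.subspace_0[OF J1_subspace, of "crossings S" n] by auto
  qed
  have "fs.dim (hp n :: ('k vec3 \<Rightarrow> 'k) set) \<le> card (crossings S)"
    using dim_J1(1)[OF fin, of n] dim_mono[OF dim_supp_on(2)[OF fin] dim_J1(3)[OF fin], of n] J
    by (simp add: dim_zero dim_supp_on(1)[OF fin])
  then have "2 * card (crossings S) = (n + 1) * (n + 2)"
    using dim_hp[of n, where 'k = 'k] card_crossings_le(2)[OF fS] card by (simp add: mult.commute)
  then show ?thesis using fin J by unfold_locales (auto simp: crossings_def)
qed

lemma dim_J2_crossings_pos:
  fixes S :: "'k::field_char_0 vec3 set set"
  assumes S: "finite S" "S \<subseteq> P2"
  shows "0 < fs.dim (J2 (crossings S) (card S))"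
proof -
  define F where "F v = (\<Prod>L\<in>S. dot3 (rp L) v)" for v
  have F: "F \<in> hp (card S)" unfolding F_def[abs_def] by (rule hp_prod[OF S(1) hp_dot])
  have "sing F (rp p)" if pS: "p \<in> crossings S" for p
  proof -
    obtain L M where p: "p \<in> P2" "L \<in> S" "M \<in> S" "L \<noteq> M" "inc L p" "inc M p"
      using pS by (auto simp: crossings_def)
    define G where "G v = (\<Prod>L\<in>S - {L} - {M}. dot3 (rp L) v)" for v
    have G: "G \<in> hp (card (S - {L} - {M}))" unfolding G_def[abs_def] by (rule hp_prod[OF _ hp_dot]) (use S in simp)
    have "F = (\<lambda>v. (dot3 (rp L) v * dot3 (rp M) v) * G v)"
      using p S by (simp add: F_def[abs_def] G_def prod.remove[of S L] prod.remove[of "S - {L}" M] mult.assoc)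
    moreover have "sing (\<lambda>v. (dot3 (rp L) v * dot3 (rp M) v) * G v) (rp p)"
      using p by (intro sing_mult[OF sing_mult_zeros[OF hp_dot hp_dot] G]) (auto simp: inc_def)
    ultimately show ?thesis by simp
  qed
  then have "F \<in> J2 (crossings S) (card S)" using F by (simp add: J2_def)
  moreover have "F \<noteq> 0"
  proof -
    \<comment> \<open>\<open>ex_avoiding_line\<close> is used dually: it yields a point that lies on
      none of the lines.\<close>
    have "0 \<notin> rp ` S" using S(2) rp_P2(2) by force
    then obtain c where "\<And>v. v \<in> rp ` S \<Longrightarrow> dot3 (1, c, c\<^sup>2) v \<noteq> 0"
      using ex_avoiding_line[OF finite_imageI[OF S(1)]] by metis
    then have "F (1, c, c\<^sup>2) \<noteq> 0" using S(1) by (simp add: F_def dot3_commute[of _ "(1, c, c\<^sup>2)"])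
    then show ?thesis by auto
  qed
  ultimately show ?thesis using dim_pos[OF findim_J2] by blast
qed

section \<open>Hilbert function of the double points of a configuration\<close>

context config
begin

lemma hilbZ_dim: "hilbZ X d + fs.dim (J2 X d) = fs.dim (hp d :: ('k vec3 \<Rightarrow> 'k) set)"
  using hilbZ_eq[OF sub, of d] dim_mono[OF findim_hp, of "J2 X d" d] by (simp add: J2_def)

lemma hilbZ_low: "d \<le> n + 1 \<Longrightarrow> 2 * hilbZ X d = (d + 1) * (d + 2)"
  using hilbZ_dim[of d] dim_hp[of d, where 'k = 'k] J2_bounds(3)[of d] by simp

lemma hilbZ_high: "2 * n + 1 \<le> d \<Longrightarrow> hilbZ X d = 3 * card X"
  using hilbZ_dim[of d] dim_J2_high[of d] by simp

text \<open>With \<open>d = n + 1 + i\<close> the bound is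
  \<open>(d + 2 choose 2) - (i + 1 choose 2)\<close>, doubled and rearranged so that no subtraction
  of naturals occurs.\<close>

lemma hilbZ_ge: "i \<le> n \<Longrightarrow> (n + i + 2) * (n + i + 3) \<le> 2 * hilbZ X (n + 1 + i) + i * (i + 1)"
  using hilbZ_dim[of "n + 1 + i"] dim_hp[of "n + 1 + i", where 'k = 'k] J2_bounds(1)[of i] by (simp add: algebra_simps)

lemma hilbZ_eq_mid:
  "0 < fs.dim (J2 X (n + 2)) \<Longrightarrow> i \<le> n \<Longrightarrow>
    2 * hilbZ X (n + 1 + i) + i * (i + 1) = (n + i + 2) * (n + i + 3)"
  using hilbZ_dim[of "n + 1 + i"] dim_hp[of "n + 1 + i", where 'k = 'k] J2_bounds(2)[of i] by (simp add: algebra_simps)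

end

section \<open>The extremal case\<close>

lemma dim_mult_image:
  fixes f :: "'k::field_char_0 vec3 \<Rightarrow> 'k"
  assumes f: "f \<in> hp a" "f \<noteq> 0" and V: "findim V" "V \<subseteq> hp b"
  shows "fs.dim ((\<lambda>g v. f v * g v) ` V) = fs.dim V" "findim ((\<lambda>g v. f v * g v) ` V)"
proof -
  show "fs.dim ((\<lambda>g v. f v * g v) ` V) = fs.dim V"
  proof (rule dim_inj_image[OF V(1)])
    fix g assume g: "g \<in> V" "(\<lambda>v. f v * g v) = 0"
    then show "g = 0" using hp_mult_eq_0[OF f(1), of g b] V(2) f(2) by (auto simp: fun_eq_iff)
  qed (auto simp: fun_eq_iff algebra_simps)
  show "findim ((\<lambda>g v. f v * g v) ` V)"
    by (rule rank_nullity(3)[OF V(1)]) (auto simp: fun_eq_iff algebra_simps)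
qed

text \<open>Up to degree \<open>n + 1\<close> and from \<open>2 * n + 1\<close> on the values are
  the same for every configuration; in between, the crossings attain the lower bound
  \<open>hilbZ_ge\<close>.\<close>

lemma hilbZ_crossings_le:
  fixes X S :: "'k::field_char_0 vec3 set set"
  assumes "config X n" and S: "general S" "card S = n + 2"
  shows "hilbZ (crossings S) d \<le> hilbZ X d"
proof -
  interpret X: config X n by fact
  interpret Y: config "crossings S" n by (rule config_crossings[OF S])
  have pos: "0 < fs.dim (J2 (crossings S) (n + 2))"
    using dim_J2_crossings_pos[of S] S by (simp add: general_def)
  have "d \<le> n + 1 \<or> (\<exists>i. d = n + 1 + i \<and> i \<le> n) \<or> 2 * n + 1 \<le> d" by presburger
  then consider "d \<le> n + 1" | i where "d = n + 1 + i" "i \<le> n" | "2 * n + 1 \<le> d" by blast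
  then show ?thesis
  proof cases
    case 1 then show ?thesis using X.hilbZ_low Y.hilbZ_low by (metis le_refl mult_left_cancel zero_neq_numeral)
  next
    case 2 then show ?thesis using X.hilbZ_ge[of i] Y.hilbZ_eq_mid[OF pos, of i] by simp
  next
    case 3 then show ?thesis using X.hilbZ_high Y.hilbZ_high X.card Y.card by simp
  qed
qed

lemma Delta_hilbZ_crossings:
  fixes S :: "'k::field_char_0 vec3 set set"
  assumes S: "general S" "card S = n + 2"
  shows "Delta (hilbZ (crossings S)) d =
    (if d \<le> n + 1 then int d + 1 else if d \<le> 2 * n + 1 then int (n + 2) else 0)"
proof -
  interpret Y: config "crossings S" n by (rule config_crossings[OF S])
  have pos: "0 < fs.dim (J2 (crossings S) (n + 2))"
    using dim_J2_crossings_pos[of S] S by (simp add: general_def)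
  let ?h = "hilbZ (crossings S)"
  have low: "2 * int (?h d) = (int d + 1) * (int d + 2)" if "d \<le> n + 1" for d
    using arg_cong[OF Y.hilbZ_low[OF that], of int] by (simp add: algebra_simps)
  have mid: "2 * int (?h (n + 1 + i)) + int i * (int i + 1) = (int n + int i + 2) * (int n + int i + 3)" if "i \<le> n" for i
    using arg_cong[OF Y.hilbZ_eq_mid[OF pos that], of int] by (simp add: algebra_simps)
  show ?thesis
  proof (cases d)
    case 0
    then show ?thesis using low[of 0] by (simp add: Delta_def)
  next
    case (Suc e)
    have "d \<le> n + 1 \<or> (\<exists>i. e = n + 1 + i \<and> Suc i \<le> n) \<or> 2 * n + 1 \<le> e" using Suc by presburger
    then consider "d \<le> n + 1" | i where "e = n + 1 + i" "Suc i \<le> n" | "2 * n + 1 \<le> e" by blast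
    then show ?thesis
    proof cases
      case 1 then show ?thesis using low[of d] low[of e] Suc by (simp add: Delta_def algebra_simps)
    next
      case 2
      \<comment> \<open>In the middle range the increment is
        \<open>(n + i + 3) - (i + 1) = n + 2\<close>.\<close>
      then show ?thesis using mid[of i] mid[of "Suc i"] Suc by (simp add: Delta_def algebra_simps)
    next
      case 3
      then show ?thesis using Y.hilbZ_high[of e] Y.hilbZ_high[of d] Suc by (simp add: Delta_def)
    qed
  qed
qed

section \<open>From the Hilbert function of the points to a configuration\<close>

lemma ex_line_avoiding_point:
  fixes p q :: "'k::field_char_0 vec3 set"
  assumes "p \<in> P2" "q \<in> P2" "p \<noteq> q"
  obtains a where "dot3 a (rp q) = 0" "dot3 a (rp p) \<noteq> 0"
proof -
  have "\<not> vanish (rp q) (dot3 (rp p))" using not_subset_line[OF assms(2,1)] assms(3) by blast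
  then show ?thesis using that unfolding vanish_def by (metis dot3_commute)
qed

text \<open>A product of \<open>card X - 1\<close> lines, one through each other point and none
  through \<open>p\<close>, separates \<open>p\<close>; a power of a linear form that is nonzero at
  \<open>p\<close> raises its degree to \<open>d\<close>.\<close>

lemma hilbX_large:
  fixes X :: "'k::field_char_0 vec3 set set"
  assumes X: "finite X" "X \<subseteq> P2" and d: "d \<ge> card X"
  shows "hilbX X d = card X"
proof -
  have "fs.dim (hp d :: ('k vec3 \<Rightarrow> 'k) set) = fs.dim (J1 X d) + card X"
  proof (rule dim_J1_sep[OF X(1)])
    fix p assume p: "p \<in> X"
    have pP: "p \<in> P2" using p X by blast
    have "\<exists>a. dot3 a (rp q) = 0 \<and> dot3 a (rp p) \<noteq> 0" if "q \<in> X - {p}" for q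
    proof -
      have "q \<in> P2" "p \<noteq> q" using that X by auto
      from ex_line_avoiding_point[OF pP this] show ?thesis by metis
    qed
    then have "\<forall>q\<in>X - {p}. \<exists>a. dot3 a (rp q) = 0 \<and> dot3 a (rp p) \<noteq> 0" by blast
    from bchoice[OF this] obtain a where
      a: "\<And>q. q \<in> X - {p} \<Longrightarrow> dot3 (a q) (rp q) = 0 \<and> dot3 (a q) (rp p) \<noteq> 0" by blast
    obtain m where "dot3 (rp p) m = 1" using ex_dot3_eq_1[OF rp_P2(2)[OF pP]] .
    then have m: "dot3 m (rp p) = 1" by (simp add: dot3_commute)
    define f where "f v = (\<Prod>q\<in>X - {p}. dot3 (a q) v) * dot3 m v ^ (d - (card X - 1))" for v
    have 1: "(\<lambda>v. \<Prod>q\<in>X - {p}. dot3 (a q) v) \<in> hp (card (X - {p}))"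
      by (rule hp_prod[OF _ hp_dot]) (use X in simp)
    have 2: "(\<lambda>v. dot3 m v ^ (d - (card X - 1))) \<in> hp (d - (card X - 1))"
      using hp_power[OF hp_dot, of m "d - (card X - 1)"] by simp
    have "card (X - {p}) + (d - (card X - 1)) = d" using p X d by simp
    then have "f \<in> hp d" using hp_mult[OF 1 2] by (simp add: f_def[abs_def])
    moreover have "f (rp p) \<noteq> 0" using a X(1) by (simp add: f_def m)
    moreover have "f (rp q) = 0" if "q \<in> X" "q \<noteq> p" for q
      using that X(1) a[of q] by (auto simp: f_def)
    ultimately show "\<exists>f\<in>hp d. f (rp p) \<noteq> 0 \<and> (\<forall>q\<in>X. q \<noteq> p \<longrightarrow> f (rp q) = 0)" by blast
  qed
  then show ?thesis using hilbX_eq[OF X(2), of d] by simp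
qed

text \<open>Summing the differences, the Hilbert function is maximal up to degree \<open>n\<close>,
  so no form of degree \<open>n\<close> vanishes on \<open>X\<close>. It is constant afterwards, and
  in large degree it counts the points.\<close>

lemma config_of_Delta:
  fixes X :: "'k::field_char_0 vec3 set set"
  assumes X: "finite X" "X \<subseteq> P2"
    and D: "\<And>d. Delta (hilbX X) d = (if d \<le> n then int d + 1 else 0)"
  shows "config X n"
proof
  show "finite X" "X \<subseteq> P2" by fact+
  have low: "2 * hilbX X d = (d + 1) * (d + 2)" if "d \<le> n" for d
    using that
  proof (induction d)
    case 0 then show ?case using D[of 0] by (simp add: Delta_def)
  next
    case (Suc d)
    then have "int (hilbX X (Suc d)) = int (hilbX X d) + (int d + 2)" using D[of "Suc d"] by (simp add: Delta_def)
    then have "hilbX X (Suc d) = hilbX X d + (d + 2)" by linarith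
    then show ?case using Suc by simp
  qed
  have high: "hilbX X (n + j) = hilbX X n" for j
  proof (induction j)
    case (Suc j) then show ?case using D[of "Suc (n + j)"] by (simp add: Delta_def)
  qed simp
  have "hilbX X (n + card X) = card X" by (rule hilbX_large[OF X]) simp
  then show "2 * card X = (n + 1) * (n + 2)" using high[of "card X"] low[of n] by simp
  have "2 * fs.dim (hp n :: ('k vec3 \<Rightarrow> 'k) set) = 2 * hilbX X n"
    using low[of n] dim_hp[of n, where 'k = 'k] by simp
  \<comment> \<open>For naturals \<open>a - b = a\<close> forces \<open>b = 0\<close> only when
    \<open>a\<close> is positive.\<close>
  moreover have "hilbX X n > 0" using low[of n] by (cases "hilbX X n") auto
  ultimately have "fs.dim (J1 X n) = 0" using hilbX_eq[OF X(2), of n] by linarith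
  then show "J1 X n = {0}" by (rule dim_eq_0[OF findim_J1])
qed

context config
begin

text \<open>With \<open>n + 2\<close> points on \<open>L\<close>, the separator of one of them would
  have \<open>n + 1\<close> zeros on \<open>L\<close>, hence vanish on all of \<open>L\<close>,
  including that point.\<close>

lemma points_on_line_le:
  assumes L: "L \<in> P2" shows "card {p \<in> X. inc L p} \<le> n + 1"
proof (rule ccontr)
  assume *: "\<not> card {p \<in> X. inc L p} \<le> n + 1"
  then have "{p \<in> X. inc L p} \<noteq> {}" by (metis card.empty le0)
  then obtain p where p: "p \<in> X" "inc L p" by blast
  obtain f where f: "f \<in> hp n" "f (rp p) = 1" "\<And>q. q \<in> X \<Longrightarrow> q \<noteq> p \<Longrightarrow> f (rp q) = 0"
    using separator[OF p(1)] by metis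
  have "vanish (rp L) f"
  proof (rule bezout_points[OF L f(1)])
    show "finite ({p \<in> X. inc L p} - {p})" using fin by simp
    show "{p \<in> X. inc L p} - {p} \<subseteq> P2" using sub by blast
    show "n < card ({p \<in> X. inc L p} - {p})" using * p fin by simp
  qed (use f(3) in auto)
  then have "f (rp p) = 0" using p(2) unfolding vanish_def inc_def by blast
  then show False using f(2) by simp
qed

end

text \<open>\<open>F\<close> is the singular form of degree \<open>t = n + 2\<close> that equality
  provides; its linear factors will be the lines sought. For \<open>n = 0\<close> the cofactor
  degree \<open>n - 1\<close> has no meaning; that case is a single point and is settled by
  \<open>single_point_crossing\<close>.\<close>

locale extremal_config = config X n for X :: "'k::field_char_0 vec3 set set" and n +
  fixes F :: "'k vec3 \<Rightarrow> 'k"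
  assumes F: "F \<in> J2 X (n + 2)" "F \<noteq> 0" and n: "n \<ge> 1"
begin

definition lines :: "'k vec3 set set" where
  "lines = {L \<in> P2. vanish (rp L) F}"

lemma F_hp: "F \<in> hp (n + 2)"
  using F(1) by (simp add: J2_def)

lemma lines: "finite lines" "card lines \<le> n + 2"
proof -
  have "finite lines \<and> card lines \<le> n + 2"
  proof (rule finite_if_finite_subsets_card_bdd)
    fix G assume "G \<subseteq> lines" "finite G"
    then show "card G \<le> n + 2" by (intro card_lines_le[OF _ _ F_hp F(2)]) (auto simp: lines_def)
  qed
  then show "finite lines" "card lines \<le> n + 2" by blast+
qed

text \<open>The existence of \<open>F\<close> puts \<open>J2_bounds\<close> into its equality case,
  so the dimension in degree \<open>2 * n + 1\<close> is \<open>n(n + 1)/2\<close>, which is already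
  that of the multiples of \<open>F\<close>.\<close>

lemma J2_eq: "J2 X (2 * n + 1) = (\<lambda>H v. F v * H v) ` hp (n - 1)"
proof -
  let ?I = "(\<lambda>H v. F v * H v) ` hp (n - 1)"
  note I = dim_mult_image[OF F_hp F(2) findim_hp order_refl, of "n - 1"]
  have "0 < fs.dim (J2 X (Suc n + 1))" using dim_pos[OF findim_J2 F(1) F(2)] by simp
  then have "2 * fs.dim (J2 X (2 * n + 1)) = n * (n + 1)"
    using J2_bounds(2)[of n] by (simp add: mult_2 add.assoc)
  also have "\<dots> = 2 * fs.dim ?I"
    unfolding I(1) using dim_hp[of "n - 1", where 'k = 'k] n by (cases n) simp_all
  finally have dim: "fs.dim (J2 X (2 * n + 1)) \<le> fs.dim ?I" by simp
  have "?I \<subseteq> J2 X (2 * n + 1)"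
  proof
    fix g assume "g \<in> ?I"
    then obtain H where H: "H \<in> hp (n - 1)" "g = (\<lambda>v. F v * H v)" by blast
    have "n + 2 + (n - 1) = 2 * n + 1" using n by simp
    then have "g \<in> hp (2 * n + 1)" using hp_mult[OF F_hp H(1)] H(2) by metis
    moreover have "sing g (rp p)" if "p \<in> X" for p
      using sing_mult[OF _ H(1), of F "rp p"] F(1) that H(2) by (simp add: J2_def)
    ultimately show "g \<in> J2 X (2 * n + 1)" by (simp add: J2_def)
  qed
  then show ?thesis
    using dim_eq_subspace[OF findim_J2 findim_subspace[OF I(2)] _ dim] by blast
qed

text \<open>For points \<open>P \<noteq> Q\<close> the product of their separators with the line \<open>PQ\<close> is singular on \<open>X\<close>, hence a
  multiple \<open>F H\<close>; if the line does not divide \<open>F\<close> it divides \<open>H\<close>.\<close>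

lemma separator_product:
  assumes P: "P \<in> X" and Q: "Q \<in> X" "Q \<noteq> P" and no: "\<not> (\<exists>L\<in>lines. inc L P \<and> inc L Q)"
    and f: "f \<in> hp n" "f (rp P) \<noteq> 0" "\<And>q. q \<in> X \<Longrightarrow> q \<noteq> P \<Longrightarrow> f (rp q) = 0"
    and g: "g \<in> hp n" "g (rp Q) \<noteq> 0" "\<And>q. q \<in> X \<Longrightarrow> q \<noteq> Q \<Longrightarrow> g (rp q) = 0"
  obtains H where "n \<ge> 2" "H \<in> hp (n - 2)" "(\<lambda>v. f v * g v) = (\<lambda>v. F v * H v)"
proof -
  have PQ: "P \<in> P2" "Q \<in> P2" "P \<noteq> Q" using P Q sub by auto
  obtain L where L: "L \<in> P2" "inc L P" "inc L Q"
    using meet_point[OF PQ] inc_commute by metis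
  have LF: "\<not> vanish (rp L) F" using no L by (auto simp: lines_def)
  let ?l = "dot3 (rp L)"
  have fg: "(\<lambda>v. f v * g v) \<in> hp (2 * n)" using hp_mult[OF f(1) g(1)] by (simp add: mult_2)
  \<comment> \<open>At \<open>P\<close> and \<open>Q\<close> the line vanishes and so does the
    product \<open>f g\<close>; at every other point of \<open>X\<close> both \<open>f\<close> and
    \<open>g\<close> vanish.\<close>
  have "sing (\<lambda>v. ?l v * (f v * g v)) (rp p)" if p: "p \<in> X" for p
  proof (cases "p = P \<or> p = Q")
    case True
    then have "?l (rp p) = 0" "f (rp p) * g (rp p) = 0" using L f(3)[of p] g(3)[of p] P Q by (auto simp: inc_def)
    then show ?thesis by (rule sing_mult_zeros[OF hp_dot fg])
  next
    case False
    then have "sing (\<lambda>v. f v * g v) (rp p)" using f(3) g(3) p by (intro sing_mult_zeros[OF f(1) g(1)]) auto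
    from sing_mult[OF this hp_dot, of "rp L"] show ?thesis by (simp add: mult.commute)
  qed
  then have "(\<lambda>v. ?l v * (f v * g v)) \<in> J2 X (2 * n + 1)"
    using hp_dot_mult[OF fg, of "rp L"] by (simp add: J2_def)
  then obtain H where H: "H \<in> hp (n - 1)" "(\<lambda>v. ?l v * (f v * g v)) = (\<lambda>v. F v * H v)"
    unfolding J2_eq by blast
  have "vanish (rp L) (\<lambda>v. ?l v * (f v * g v))" by (simp add: vanish_def)
  then have LH: "vanish (rp L) H" using vanish_mult[OF F_hp H(1), of "rp L"] LF H(2) by simp
  have nz: False if "\<And>v. ?l v * (f v * g v) = 0"
  proof -
    have "?l = 0 \<or> (\<lambda>v. f v * g v) = 0" by (rule hp_mult_eq_0[OF hp_dot fg that])
    moreover have "?l \<noteq> 0"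
    proof
      assume "?l = 0"
      moreover obtain e where "?l e = 1" using ex_dot3_eq_1[OF rp_P2(2)[OF L(1)]] .
      ultimately show False by simp
    qed
    moreover have "(\<lambda>v. f v * g v) \<noteq> 0"
    proof
      assume "(\<lambda>v. f v * g v) = 0"
      from fun_cong[OF this] have "f v * g v = 0" for v by simp
      then have "f = 0 \<or> g = 0" by (rule hp_mult_eq_0[OF f(1) g(1)])
      then show False using f(2) g(2) by auto
    qed
    ultimately show False by blast
  qed
  \<comment> \<open>For \<open>n = 1\<close> the cofactor \<open>H\<close> would be a constant that
    vanishes on a line, hence zero, against \<open>nz\<close>.\<close>
  have n2: "n \<ge> 2"
  proof (rule ccontr)
    assume "\<not> n \<ge> 2"
    then have "H \<in> hp 0" using H(1) n by simp
    moreover have "H 0 = 0" using LH unfolding vanish_def by (metis dot3_zero(1))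
    ultimately have "H = 0" using hp_0_vanish by blast
    then have "?l v * (f v * g v) = 0" for v using fun_cong[OF H(2), of v] by simp
    then show False using nz by blast
  qed
  then have "n - 1 = Suc (n - 2)" by simp
  then have "H \<in> hp (Suc (n - 2))" using H(1) by simp
  then obtain K where K: "K \<in> hp (n - 2)" "\<And>v. H v = ?l v * K v"
    using hp_divide_line[OF rp_P2(2)[OF L(1)] _ LH] by metis
  have l0: "?l \<noteq> 0" using nz by (auto simp: fun_eq_iff)
  have "n + 2 + (n - 2) = 2 * n" using n2 by simp
  then have FK: "(\<lambda>v. F v * K v) \<in> hp (2 * n)" using hp_mult[OF F_hp K(1)] by metis
  have "?l v * (f v * g v) = ?l v * (F v * K v)" for v
    using fun_cong[OF H(2), of v] K(2)[of v] by simp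
  then have "(\<lambda>v. f v * g v) = (\<lambda>v. F v * K v)"
    using hp_mult_cancel[OF hp_dot l0 fg FK] by blast
  then show ?thesis using that n2 K(1) by blast
qed

text \<open>For such \<open>Q\<close> the form \<open>F\<close> divides the product of the
  separators of \<open>P\<close> and \<open>Q\<close>. The forms \<open>g\<close> of degree
  \<open>n\<close> for which \<open>F\<close> divides \<open>f g\<close> form a space
  \<open>U\<close> that embeds into \<open>hp (n - 2)\<close> by \<open>f g / F\<close>. It contains
  the separators of all these \<open>Q\<close>, so their number is at most the dimension of
  \<open>hp (n - 2)\<close>.\<close>

lemma card_not_joined:
  assumes P: "P \<in> X"
  shows "2 * card {Q \<in> X - {P}. \<not> (\<exists>L\<in>lines. inc L P \<and> inc L Q)} \<le> n * (n - 1)"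
    (is "2 * card ?B \<le> _")
proof (cases "?B = {}")
  case True then show ?thesis by (simp only: card.empty)
next
  case False
  obtain f where f: "f \<in> hp n" "f (rp P) = 1" "\<And>q. q \<in> X \<Longrightarrow> q \<noteq> P \<Longrightarrow> f (rp q) = 0"
    using separator[OF P] by metis
  have sep: "\<exists>g. g \<in> hp n \<and> g (rp Q) = 1 \<and> (\<forall>q\<in>X. q \<noteq> Q \<longrightarrow> g (rp q) = 0)
      \<and> n \<ge> 2 \<and> (\<lambda>v. f v * g v) \<in> (\<lambda>H v. F v * H v) ` hp (n - 2)" if Q: "Q \<in> ?B" for Q
  proof -
    have QX: "Q \<in> X" "Q \<noteq> P" "\<not> (\<exists>L\<in>lines. inc L P \<and> inc L Q)" using Q by auto
    obtain g where g: "g \<in> hp n" "g (rp Q) = 1" "\<And>q. q \<in> X \<Longrightarrow> q \<noteq> Q \<Longrightarrow> g (rp q) = 0"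
      using separator[OF QX(1)] by metis
    have "f (rp P) \<noteq> 0" "g (rp Q) \<noteq> 0" using f(2) g(2) by simp_all
    from separator_product[OF P QX f(1) this(1) f(3) g(1) this(2) g(3)]
    obtain H where "n \<ge> 2" "H \<in> hp (n - 2)" "(\<lambda>v. f v * g v) = (\<lambda>v. F v * H v)" by metis
    then show ?thesis using g by blast
  qed
  \<comment> \<open>A member of \<open>?B\<close> supplies this through
    \<open>separator_product\<close>, which is why the empty case was split off; it makes
    \<open>n - 2\<close> a true difference.\<close>
  have n2: "n \<ge> 2" using sep False by blast
  have f0: "f \<noteq> 0" using f(2) by auto
  let ?I = "(\<lambda>H v. F v * H v) ` (hp (n - 2) :: ('k vec3 \<Rightarrow> 'k) set)"
  note I = dim_mult_image[OF F_hp F(2) findim_hp order_refl, of "n - 2"]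
  define U where "U = {g \<in> hp n. (\<lambda>v. f v * g v) \<in> ?I}"
  have subU: "fs.subspace U"
    unfolding fs.subspace_def
  proof (intro conjI ballI allI)
    have "(\<lambda>v. f v * (0 :: 'k vec3 \<Rightarrow> 'k) v) = 0" by (simp add: fun_eq_iff)
    then show "0 \<in> U" using fs.subspace_0[OF findim_subspace[OF I(2)]] hp_zero by (simp add: U_def)
  next
    fix g h assume gh: "g \<in> U" "h \<in> U"
    have "(\<lambda>v. f v * (g + h) v) = (\<lambda>v. f v * g v) + (\<lambda>v. f v * h v)" by (simp add: fun_eq_iff algebra_simps)
    moreover have "(\<lambda>v. f v * g v) + (\<lambda>v. f v * h v) \<in> ?I"
      by (rule fs.subspace_add[OF findim_subspace[OF I(2)]]) (use gh in \<open>simp_all add: U_def\<close>)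
    moreover have "g + h \<in> hp n"
      by (rule fs.subspace_add[OF hp_subspace]) (use gh in \<open>simp_all add: U_def\<close>)
    ultimately show "g + h \<in> U" unfolding U_def mem_Collect_eq by metis
  next
    fix c g assume g: "g \<in> U"
    have "(\<lambda>v. f v * (c * g v)) = (\<lambda>v. c * (f v * g v))" by (simp add: fun_eq_iff algebra_simps)
    moreover have "(\<lambda>v. c * (f v * g v)) \<in> ?I"
      by (rule fs.subspace_scale[OF findim_subspace[OF I(2)]]) (use g in \<open>simp add: U_def\<close>)
    moreover have "(\<lambda>m. c * g m) \<in> hp n"
      by (rule hp_scale) (use g in \<open>simp add: U_def\<close>)
    ultimately show "(\<lambda>m. c * g m) \<in> U" unfolding U_def mem_Collect_eq by metis
  qed
  have U2: "U \<subseteq> hp n" by (auto simp: U_def)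
  note U = findim_subset[OF findim_hp subU U2] U2
  have "fs.dim U = fs.dim ((\<lambda>g v. f v * g v) ` U)" using dim_mult_image(1)[OF f(1) f0 U] by simp
  also have "\<dots> \<le> fs.dim ?I" by (rule dim_mono[OF I(2)]) (auto simp: U_def)
  finally have dimU: "fs.dim U \<le> fs.dim (hp (n - 2) :: ('k vec3 \<Rightarrow> 'k) set)" using I(1) by simp
  have inj: "inj_on rp ?B" by (rule inj_on_subset[OF inj_rp]) (use sub in blast)
  have "card (rp ` ?B) \<le> fs.dim U"
  proof (rule card_le_dim[OF U(1)])
    show "finite (rp ` ?B)" using fin by simp
    fix b assume "b \<in> rp ` ?B"
    then obtain Q where Q: "Q \<in> ?B" "b = rp Q" by (elim imageE)
    obtain g where g: "g \<in> hp n" "g (rp Q) = 1" "\<forall>q\<in>X. q \<noteq> Q \<longrightarrow> g (rp q) = 0"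
      "(\<lambda>v. f v * g v) \<in> ?I" using sep[OF Q(1)] by blast
    have "g \<in> U" using g by (simp add: U_def)
    moreover have "g b' = 0" if b': "b' \<in> rp ` ?B" "b' \<noteq> b" for b'
    proof -
      obtain q where "q \<in> ?B" "b' = rp q" using b'(1) by (elim imageE)
      then show ?thesis using g(3) b'(2) Q(2) by auto
    qed
    ultimately show "\<exists>g\<in>U. g b \<noteq> 0 \<and> (\<forall>b'\<in>rp ` ?B. b' \<noteq> b \<longrightarrow> g b' = 0)"
      using g(2) Q(2) by (intro bexI[of _ g]) auto
  qed
  then have "2 * card ?B \<le> 2 * fs.dim (hp (n - 2) :: ('k vec3 \<Rightarrow> 'k) set)"
    using dimU card_image[OF inj] by simp
  also have "\<dots> = (n - 1) * n"
  proof -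
    have "n - 2 + 1 = n - 1" "n - 2 + 2 = n" using n2 by simp_all
    then show ?thesis unfolding dim_hp by (simp only:)
  qed
  finally show ?thesis by (simp add: mult.commute)
qed

text \<open>At least \<open>(n + 1)(n + 2)/2 - 1 - n(n - 1)/2 = 2n\<close> points other than
  \<open>P\<close> are joined to \<open>P\<close> by a line dividing \<open>F\<close>, and each such
  line carries at most \<open>n\<close> of them.\<close>

lemma card_lines_through_ge:
  assumes P: "P \<in> X"
  shows "card {L \<in> lines. inc L P} \<ge> 2"
proof -
  let ?A = "{L \<in> lines. inc L P}" and ?B = "{Q \<in> X - {P}. \<not> (\<exists>L\<in>lines. inc L P \<and> inc L Q)}"
  have finA: "finite ?A" using lines(1) by simp
  have "X - {P} \<subseteq> ?B \<union> (\<Union>L\<in>?A. {p \<in> X. inc L p} - {P})" by blast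
  then have "card (X - {P}) \<le> card (?B \<union> (\<Union>L\<in>?A. {p \<in> X. inc L p} - {P}))"
    by (rule card_mono[rotated]) (use fin finA in simp)
  also have "\<dots> \<le> card ?B + card (\<Union>L\<in>?A. {p \<in> X. inc L p} - {P})" by (rule card_Un_le)
  also have "card (\<Union>L\<in>?A. {p \<in> X. inc L p} - {P}) \<le> (\<Sum>L\<in>?A. card ({p \<in> X. inc L p} - {P}))"
    by (rule card_UN_le[OF finA])
  also have "\<dots> \<le> (\<Sum>L\<in>?A. n)"
  proof (rule sum_mono)
    fix L assume L: "L \<in> ?A"
    then have "card {p \<in> X. inc L p} \<le> n + 1" by (intro points_on_line_le) (auto simp: lines_def)
    then show "card ({p \<in> X. inc L p} - {P}) \<le> n" using L P fin by simp
  qed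
  finally have "card X - 1 \<le> card ?B + card ?A * n" using P fin by simp
  then have "2 * card X \<le> 2 * card ?B + 2 * card ?A * n + 2" by simp
  then have "(n + 1) * (n + 2) \<le> n * (n - 1) + 2 * card ?A * n + 2" using card card_not_joined[OF P] by simp
  then have "4 * n \<le> 2 * card ?A * n" using n by (cases n) simp_all
  then show ?thesis using n by simp
qed

text \<open>Incidences are counted twice: at least two lines pass through each of the
  \<open>(n + 1)(n + 2)/2\<close> points, while at most \<open>n + 2\<close> lines carry at most
  \<open>n + 1\<close> points each. The totals agree, so no point can lie on a third line.\<close>

lemma card_lines_through:
  assumes P: "P \<in> X"
  shows "card {L \<in> lines. inc L P} = 2"
proof (rule ccontr)
  assume *: "card {L \<in> lines. inc L P} \<noteq> 2"
  have "(\<Sum>p\<in>X. 2) < (\<Sum>p\<in>X. card {L \<in> lines. inc L p})"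
  proof (rule sum_strict_mono_ex1[OF fin])
    show "\<forall>p\<in>X. 2 \<le> card {L \<in> lines. inc L p}" using card_lines_through_ge by blast
    show "\<exists>p\<in>X. 2 < card {L \<in> lines. inc L p}"
      using P * card_lines_through_ge[OF P] by (intro bexI[of _ P]) auto
  qed
  also have "(\<Sum>p\<in>X. card {L \<in> lines. inc L p}) = (\<Sum>L\<in>lines. card {p \<in> X. inc L p})"
    using sum_multicount_gen[OF fin lines(1), of "\<lambda>p L. inc L p" "\<lambda>L. card {p \<in> X. inc L p}"] by simp
  also have "\<dots> \<le> (\<Sum>L\<in>lines. n + 1)"
    by (intro sum_mono points_on_line_le) (auto simp: lines_def)
  also have "\<dots> \<le> (n + 2) * (n + 1)" using mult_le_mono1[OF lines(2), of "n + 1"] by simp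
  finally show False using card by simp
qed

text \<open>Sending a point to the pair of lines through it is injective on \<open>X\<close>. There
  are no more than \<open>(n + 2 choose 2)\<close> pairs, which is \<open>card X\<close>, so there
  are exactly \<open>n + 2\<close> lines and every pair meets in a point of \<open>X\<close> that
  lies on no third line.\<close>

lemma general_lines: "general lines" "card lines = n + 2" "X = crossings lines"
proof -
  define A where "A P = {L \<in> lines. inc L P}" for P
  let ?Q = "{T. T \<subseteq> lines \<and> card T = 2}"
  have linesP2: "lines \<subseteq> P2" by (auto simp: lines_def)
  have AQ: "A ` X \<subseteq> ?Q" using card_lines_through by (auto simp: A_def)
  have inj: "inj_on A X"
  proof (rule inj_onI)
    fix p q assume pq: "p \<in> X" "q \<in> X" "A p = A q"
    obtain L M where LM: "A p = {L, M}" "L \<noteq> M"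
      using card_lines_through[OF pq(1)] unfolding A_def card_2_iff by blast
    then have "L \<in> A p" "M \<in> A p" "L \<in> A q" "M \<in> A q" using pq(3) by auto
    then have "L \<in> P2" "M \<in> P2" "inc L p" "inc M p" "inc L q" "inc M q" using linesP2 by (auto simp: A_def)
    then show "p = q" using inc_unique[of L M p q] LM(2) pq sub by blast
  qed
  have finQ: "finite ?Q" using lines(1) by simp
  have le: "card X \<le> card ?Q" using card_inj_on_le[OF inj AQ finQ] .
  have "(n + 1) * (n + 2) \<le> card lines * (card lines - 1)"
    using le card card_pairs[OF lines(1)] by simp
  moreover have "card lines * (card lines - 1) \<le> (n + 1) * n" if "card lines \<le> n + 1"
    using that by (intro mult_le_mono) auto
  ultimately show cl: "card lines = n + 2" using lines(2) by (cases "card lines \<le> n + 1") auto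
  have "card ?Q = card X" using card_pairs[OF lines(1)] cl card by simp
  then have surj: "A ` X = ?Q"
    using card_subset_eq[OF finQ AQ] card_image[OF inj] by simp
  have meet: "p \<in> X \<and> A p = {L, M}"
    if "L \<in> lines" "M \<in> lines" "L \<noteq> M" "p \<in> P2" "inc L p" "inc M p" for L M p
  proof -
    have "{L, M} \<in> ?Q" using that by simp
    then obtain P where P: "P \<in> X" "A P = {L, M}" using surj by (metis (no_types, lifting) imageE)
    then have "inc L P" "inc M P" by (auto simp: A_def)
    moreover have "L \<in> P2" "M \<in> P2" "P \<in> P2" using that linesP2 P sub by auto
    ultimately have "P = p" using inc_unique that by metis
    then show ?thesis using P by simp
  qed
  show "general lines"
    unfolding general_def
  proof (intro conjI lines linesP2 ballI impI notI)
    fix L M K assume LMK: "L \<in> lines" "M \<in> lines" "K \<in> lines" "L \<noteq> M \<and> L \<noteq> K \<and> M \<noteq> K"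
      and "\<exists>p\<in>P2. inc L p \<and> inc M p \<and> inc K p"
    then obtain p where p: "p \<in> P2" "inc L p" "inc M p" "inc K p" by blast
    then have "A p = {L, M}" using meet[of L M p] LMK by blast
    moreover have "K \<in> A p" using LMK(3) p(4) by (simp add: A_def)
    ultimately show False using LMK(4) by auto
  qed
  show "X = crossings lines"
  proof (intro equalityI subsetI)
    fix p assume p: "p \<in> X"
    obtain L M where LM: "A p = {L, M}" "L \<noteq> M"
      using card_lines_through[OF p] unfolding A_def card_2_iff by blast
    then have "L \<in> A p" "M \<in> A p" by auto
    then show "p \<in> crossings lines" using LM(2) p sub by (auto simp: A_def crossings_def)
  next
    fix p assume "p \<in> crossings lines"
    then obtain L M where "L \<in> lines" "M \<in> lines" "L \<noteq> M" "p \<in> P2" "inc L p" "inc M p"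
      unfolding crossings_def by blast
    then show "p \<in> X" using meet by blast
  qed
qed

end

lemma single_point_crossing:
  fixes p :: "'k::field_char_0 vec3 set"
  assumes p: "p \<in> P2"
  obtains S where "general S" "card S = 2" "crossings S = {p}"
proof -
  \<comment> \<open>Dually, \<open>u\<close> and \<open>w\<close> span the forms vanishing at
    \<open>p\<close>, so they represent two distinct lines through \<open>p\<close>.\<close>
  obtain A B u w where c: "dot3 (rp p) u = 0" "dot3 (rp p) w = 0"
    "dot3 A u = 1" "dot3 A w = 0" "dot3 B u = 0" "dot3 B w = (1 :: 'k)"
    using line_coordinates[OF rp_P2(2)[OF p]] by metis
  have P: "pt u \<in> P2" "pt w \<in> P2" using c by (auto intro!: pt_in_P2)
  have I: "inc (pt u) p" "inc (pt w) p"
  proof -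
    obtain a where "rp (pt u) = smult3 a u" using rp_pt by blast
    then show "inc (pt u) p" using c(1) by (simp add: inc_def dot3_commute[of u])
    obtain b where "rp (pt w) = smult3 b w" using rp_pt by blast
    then show "inc (pt w) p" using c(2) by (simp add: inc_def dot3_commute[of w])
  qed
  have ne: "pt u \<noteq> pt w"
  proof
    assume "pt u = pt w"
    then have "u \<in> pt w" using pt_self by blast
    then obtain b where "u = smult3 b w" by (auto simp: mem_pt)
    then show False using c(3,4) by simp
  qed
  show ?thesis
  proof (rule that[of "{pt u, pt w}"])
    show "general {pt u, pt w}" unfolding general_def using P by auto
    show "card {pt u, pt w} = 2" using ne by simp
    show "crossings {pt u, pt w} = {p}"
    proof
      show "{p} \<subseteq> crossings {pt u, pt w}" unfolding crossings_def using p I ne by blast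
      show "crossings {pt u, pt w} \<subseteq> {p}"
      proof
        fix q assume "q \<in> crossings {pt u, pt w}"
        then have "q \<in> P2" "inc (pt u) q" "inc (pt w) q" by (auto simp: crossings_def)
        then show "q \<in> {p}" using inc_unique[OF P ne p _ I] by blast
      qed
    qed
  qed
qed

text \<open>Equal Hilbert functions in degree \<open>n + 2\<close> mean equal dimensions of the
  spaces of singular forms. For the crossings this space contains the product of the lines, so
  \<open>X\<close> also has a nonzero singular form of degree \<open>n + 2\<close>.\<close>

lemma crossings_of_equality:
  fixes X S :: "'k::field_char_0 vec3 set set"
  assumes X: "config X n" and S: "general S" "card S = n + 2"
    and eq: "hilbZ X (n + 2) = hilbZ (crossings S) (n + 2)"
  obtains S' where "general S'" "card S' = n + 2" "X = crossings S'"
proof (cases "n = 0")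
  case True
  interpret X: config X n by fact
  have "card X = 1" using X.card True by simp
  then obtain p where p: "X = {p}" by (auto simp: card_1_singleton_iff)
  then have "p \<in> P2" using X.sub by simp
  from single_point_crossing[OF this] show ?thesis using that p True by (metis add_0)
next
  case False
  interpret X: config X n by fact
  interpret Y: config "crossings S" n by (rule config_crossings[OF S])
  have "0 < fs.dim (J2 (crossings S) (n + 2))"
    using dim_J2_crossings_pos[of S] S by (simp add: general_def)
  then have "0 < fs.dim (J2 X (n + 2))"
    using X.hilbZ_dim[of "n + 2"] Y.hilbZ_dim[of "n + 2"] eq by linarith
  then have "J2 X (n + 2) \<noteq> {0}" using dim_zero[where 'k = 'k and 'i = "'k vec3"] by auto
  then obtain F where F: "F \<in> J2 X (n + 2)" "F \<noteq> 0"
    using fs.subspace_0[OF J2_subspace, of X "n + 2"] by blast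
  interpret E: extremal_config X n F by unfold_locales (use F False in auto)
  show ?thesis using that E.general_lines by blast
qed

theorem theorem7p10:
  fixes t :: nat and lam :: "nat \<Rightarrow> ('k::field_char_0) vec3 set"
  assumes "t \<ge> 2" and "good_lines t lam"
  shows "(\<forall>d. Delta (hilbZ (cross_pts t lam)) d =
            (if d \<le> t - 1 then int d + 1
             else if d \<le> 2 * t - 3 then int t else 0))
       \<and> (\<forall>X :: 'k vec3 set set. finite X \<and> X \<subseteq> P2 \<and>
            (\<forall>d. Delta (hilbX X) d = (if d \<le> t - 2 then int d + 1 else 0)) \<longrightarrow>
            (\<forall>d. hilbZ X d \<ge> hilbZ (cross_pts t lam) d) \<and>
            (hilbZ X t = hilbZ (cross_pts t lam) t \<longrightarrow>
               (\<exists>mu. good_lines t mu \<and> X = cross_pts t mu)))"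
proof -
  define n where "n = t - 2"
  have t: "t = n + 2" using assms(1) by (simp add: n_def)
  have inj: "inj_on lam {..<t}" and S: "general (lam ` {..<t})"
    using assms(2) good_lines_iff by auto
  have cS: "card (lam ` {..<t}) = n + 2" using card_image[OF inj] t by simp
  note cp = cross_pts_eq[OF assms(2)]
  show ?thesis
  proof (intro conjI allI impI)
    fix d
    show "Delta (hilbZ (cross_pts t lam)) d =
        (if d \<le> t - 1 then int d + 1 else if d \<le> 2 * t - 3 then int t else 0)"
      using Delta_hilbZ_crossings[OF S cS, of d] unfolding cp using t by auto
  next
    fix X :: "'k vec3 set set" and d
    assume X: "finite X \<and> X \<subseteq> P2 \<and> (\<forall>d. Delta (hilbX X) d = (if d \<le> t - 2 then int d + 1 else 0))"
    then have "config X n" by (intro config_of_Delta) (auto simp: n_def)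
    then show "hilbZ (cross_pts t lam) d \<le> hilbZ X d"
      unfolding cp by (rule hilbZ_crossings_le[OF _ S cS])
  next
    fix X :: "'k vec3 set set"
    assume X: "finite X \<and> X \<subseteq> P2 \<and> (\<forall>d. Delta (hilbX X) d = (if d \<le> t - 2 then int d + 1 else 0))"
      and eq: "hilbZ X t = hilbZ (cross_pts t lam) t"
    have "config X n" using X by (intro config_of_Delta) (auto simp: n_def)
    moreover have "hilbZ X (n + 2) = hilbZ (crossings (lam ` {..<t})) (n + 2)" using eq unfolding cp using t by simp
    ultimately obtain S' where S': "general S'" "card S' = n + 2" "X = crossings S'"
      using crossings_of_equality[OF _ S cS] by metis
    have "finite S'" using S'(1) by (simp add: general_def)
    then obtain mu where "bij_betw mu {0..<card S'} S'" using ex_bij_betw_nat_finite by blast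
    then have mu: "inj_on mu {..<t}" "mu ` {..<t} = S'"
      using S'(2) t by (auto simp: bij_betw_def lessThan_atLeast0)
    then have "good_lines t mu" using S'(1) good_lines_iff by blast
    then show "\<exists>mu. good_lines t mu \<and> X = cross_pts t mu"
      using cross_pts_eq[of t mu] mu(2) S'(3) by auto
  qed
qed

end
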